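(* Let $n\in\{0,1,2\}$ and $E\in\mathcal{K}^n_1$. If there exists a discrete Schrödinger operator $H\in\mathcal{J}(E)$, then the dynamical system $(\mathcal{J}(E),\mathcal{S})$ is periodic, i.e. there is an integer $p\ge1$ such that $\mathcal{S}^pJ=J$ for all $J\in\mathcal{J}(E)$.
   Context: $\mathcal{K}^n_1$ is the set of compact sets $E\subset\mathbb{R}$ that are unions of $n+1$ pairwise disjoint nondegenerate compact intervals (so $E$ has $n$ gaps) and have logarithmic capacity $\operatorname{cap}(E)=1$, where $\operatorname{cap}(E)=\sup_{\mu}\exp\left(-\int_E\int_E\log|x-y|^{-1}\,d\mu(x)\,d\mu(y)\right)$, the supremum being over Borel probability measures $\mu$ supported on $E$. A Jacobi operator is a bounded self-adjoint operator $J=J(a,b)$ on $\ell^2(\mathbb{Z})$, $(Ju)_n = a_n u_{n-1} + b_n u_n + a_{n+1}u_{n+1}$, where $a,b\in\ell^\infty(\mathbb{Z})$ are real and the entries of $a$ are positive and bounded uniformly away from $0$. A discrete Schrödinger operator (DSO) is a Jacobi operator with $a_n=1$ for all $n$. Let $r(n,z,J)=\langle \delta_n,(J-z)^{-1}\delta_n\rangle$ and $r(n,x+i0,J)=\lim_{\varepsilon\downarrow 0} r(n,x+i\varepsilon,J)$, which exists for Lebesgue-a.e. $x\in\mathbb{R}$. $J$ is reflectionless on $E$ if for every $n\in\mathbb{Z}$, $\operatorname{Re}\, r(n,x+i0,J)=0$ for Lebesgue-a.e. $x\in E$. Define $\mathcal{J}(E)=\{J \text{ Jacobi operator}: \sigma(J)\subset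 E \text{ and } J \text{ is reflectionless on } E\}$, with the topology of pointwise convergence of the sequences $(a,b)$. Let $S:\delta_n\mapsto\delta_{n+1}$ be the shift on $\ell^2(\mathbb{Z})$ and $\mathcal{S}J=SJS^{-1}$; $\mathcal{S}$ maps $\mathcal{J}(E)$ to itself. *)

theory Defs
  imports "HOL-Analysis.Analysis"
begin

section \<open>Logarithmic capacity\<close>

text \<open>Integral of an extended-real function as integral of the positive part minus integral of
  the negative part. It has its usual meaning whenever one of the two is finite. This is always so
  below: the logarithmic kernel is bounded below on bounded sets.\<close>

definition ereal_integral :: "'a measure \<Rightarrow> ('a \<Rightarrow> ereal) \<Rightarrow> ereal" where
  "ereal_integral M f =
     enn2ereal (\<integral>\<^sup>+ x. e2ennreal (f x) \<partial>M) - enn2ereal (\<integral>\<^sup>+ x. e2ennreal (- f x) \<partial>M)"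

text \<open>The kernel $\log |x-y|^{-1}$, with its correct value $+\infty$ on the diagonal
  (in HOL, \<open>ln 0 = 0\<close>).\<close>

definition log_kernel :: "real \<Rightarrow> real \<Rightarrow> ereal" where
  "log_kernel x y = (if x = y then \<infinity> else ereal (ln (inverse \<bar>x - y\<bar>)))"

definition log_energy :: "real measure \<Rightarrow> ereal" where
  "log_energy \<mu> = ereal_integral \<mu> (\<lambda>x. ereal_integral \<mu> (\<lambda>y. log_kernel x y))"

definition exp_ereal :: "ereal \<Rightarrow> ennreal" where
  "exp_ereal t = (case t of ereal r \<Rightarrow> ennreal (exp r) | PInfty \<Rightarrow> \<infinity> | MInfty \<Rightarrow> 0)"

text \<open>For closed \<open>E\<close>, a Borel probability measure is supported on \<open>E\<close> iff \<open>E\<close> has full measure;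
  integrals over \<open>E\<close> are then integrals over the whole line.\<close>

definition prob_measures_on :: "real set \<Rightarrow> real measure set" where
  "prob_measures_on E =
     {\<mu>. sets \<mu> = sets borel \<and> emeasure \<mu> (space \<mu>) = 1 \<and> emeasure \<mu> (- E) = 0}"

definition log_capacity :: "real set \<Rightarrow> ennreal" where
  "log_capacity E = (SUP \<mu>\<in>prob_measures_on E. exp_ereal (- log_energy \<mu>))"

definition finite_gap_sets :: "nat \<Rightarrow> real set set" where
  "finite_gap_sets n =
     {E. (\<exists>\<I>. finite \<I> \<and> card \<I> = n + 1 \<and> (\<forall>I\<in>\<I>. \<exists>c d. c < d \<and> I = {c..d}) \<and>
              pairwise disjnt \<I> \<and> E = \<Union>\<I>) \<and>
         log_capacity E = 1}"

section \<open>Operators on \<open>l2\<close>\<close>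

text \<open>The Hilbert space of square-summable two-sided complex sequences, as a carrier set.
  Operators on it are functions that are \<open>undefined\<close> off the carrier (as in
  \<open>HOL-Library.FuncSet\<close>), so that equality of operators is equality on \<open>l2\<close>.\<close>

type_synonym operator = "(int \<Rightarrow> complex) \<Rightarrow> (int \<Rightarrow> complex)"

definition l2 :: "(int \<Rightarrow> complex) set" where
  "l2 = {u. (\<lambda>k. (cmod (u k))\<^sup>2) summable_on UNIV}"

definition l2_inner :: "(int \<Rightarrow> complex) \<Rightarrow> (int \<Rightarrow> complex) \<Rightarrow> complex" where
  "l2_inner u v = (\<Sum>\<^sub>\<infinity>k. cnj (u k) * v k)"

definition l2_norm :: "(int \<Rightarrow> complex) \<Rightarrow> real" where
  "l2_norm u = sqrt (\<Sum>\<^sub>\<infinity>k. (cmod (u k))\<^sup>2)"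

definition delta :: "int \<Rightarrow> int \<Rightarrow> complex" where
  "delta n = (\<lambda>k. if k = n then 1 else 0)"

definition minus_scalar :: "operator \<Rightarrow> complex \<Rightarrow> operator" where
  "minus_scalar J z = (\<lambda>u\<in>l2. \<lambda>k. J u k - z * u k)"

text \<open>\<open>(J - z)\<^sup>-\<^sup>1\<close>; meaningful for \<open>z\<close> off the spectrum.\<close>

definition resolvent :: "operator \<Rightarrow> complex \<Rightarrow> operator" where
  "resolvent J z = (\<lambda>u\<in>l2. inv_into l2 (minus_scalar J z) u)"

definition spectrum :: "operator \<Rightarrow> complex set" where
  "spectrum J =
     {z. \<not> (bij_betw (minus_scalar J z) l2 l2 \<and>
            (\<exists>C. \<forall>u\<in>l2. l2_norm (resolvent J z u) \<le> C * l2_norm u))}"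

section \<open>Jacobi operators\<close>

definition jacobi :: "(int \<Rightarrow> real) \<Rightarrow> (int \<Rightarrow> real) \<Rightarrow> operator" where
  "jacobi a b = (\<lambda>u\<in>l2. \<lambda>k. of_real (a k) * u (k - 1) + of_real (b k) * u k
                             + of_real (a (k + 1)) * u (k + 1))"

text \<open>Boundedness and self-adjointness of the operator follow from the conditions on the real
  coefficients.\<close>

definition is_jacobi :: "operator \<Rightarrow> bool" where
  "is_jacobi J \<longleftrightarrow>
     (\<exists>a b. bounded (range a) \<and> bounded (range b) \<and> (\<exists>c>0. \<forall>k. c \<le> a k) \<and> J = jacobi a b)"

definition is_discrete_schroedinger :: "operator \<Rightarrow> bool" where
  "is_discrete_schroedinger H \<longleftrightarrow> (\<exists>b. bounded (range b) \<and> H = jacobi (\<lambda>_. 1) b)"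

definition green :: "int \<Rightarrow> complex \<Rightarrow> operator \<Rightarrow> complex" where
  "green n z J = l2_inner (delta n) (resolvent J z (delta n))"

text \<open>The boundary value \<open>r(n, x + i0, J)\<close> exists for almost every \<open>x\<close>. The existential below
  only avoids the arbitrary value of \<open>Lim\<close> at the exceptional points.\<close>

definition reflectionless_on :: "operator \<Rightarrow> real set \<Rightarrow> bool" where
  "reflectionless_on J E \<longleftrightarrow>
     (\<forall>n. AE x in lebesgue. x \<in> E \<longrightarrow>
        (\<exists>L. ((\<lambda>\<epsilon>. green n (Complex x \<epsilon>) J) \<longlongrightarrow> L) (at_right 0) \<and> Re L = 0))"

definition reflectionless_jacobi :: "real set \<Rightarrow> operator set" where
  "reflectionless_jacobi E =
     {J. is_jacobi J \<and> spectrum J \<subseteq> complex_of_real ` E \<and> reflectionless_on J E}"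

definition shift :: operator where
  "shift = (\<lambda>u\<in>l2. \<lambda>k. u (k - 1))"

lemma delta_in_l2: "delta n \<in> l2"
proof -
  have "(\<lambda>k. (cmod (delta n k))\<^sup>2) summable_on {n}" by simp
  then have "(\<lambda>k. (cmod (delta n k))\<^sup>2) summable_on UNIV"
    by (rule summable_on_cong_neutral[THEN iffD1, rotated -1]) (auto simp: delta_def)
  then show ?thesis by (simp add: l2_def)
qed

lemma shift_delta: "shift (delta n) = delta (n + 1)"
  using delta_in_l2[of n] by (auto simp: shift_def delta_def fun_eq_iff)

text \<open>\<open>S J S\<^sup>-\<^sup>1\<close>\<close>

definition conj_shift :: "operator \<Rightarrow> operator" where
  "conj_shift J = compose l2 shift (compose l2 J (inv_into l2 shift))"

end

theory Submission
  imports Defs "HOL-Complex_Analysis.Complex_Analysis"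
    "HOL-Computational_Algebra.Computational_Algebra" "HOL-Computational_Algebra.Field_as_Ring"
begin

text \<open>
  Let \<open>g\<close> be the number of gaps of \<open>E\<close> and \<open>R\<close> the monic polynomial whose zeros are the end points of
  its bands. For a reflectionless \<open>J\<close>, Krein's argument applies to the logarithm of the diagonal Green
  function: its imaginary part is bounded and has known boundary values, so the Green function at site
  \<open>n\<close> is \<open>- G\<^sub>n R\<^sup>-\<^sup>1\<^sup>/\<^sup>2\<close> with a monic polynomial \<open>G\<^sub>n\<close> of degree \<open>g\<close>. With
  \<open>h\<^sub>n = 2 a\<^sub>n\<^sub>+\<^sub>1 \<langle>\<delta>\<^sub>n, (J - z)\<^sup>-\<^sup>1 \<delta>\<^sub>n\<^sub>+\<^sub>1\<rangle> - 1\<close>, the identities between entries of the resolvent give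
  \<open>h\<^sub>n = - H\<^sub>n R\<^sup>-\<^sup>1\<^sup>/\<^sup>2\<close> with a monic polynomial \<open>H\<^sub>n\<close> of degree \<open>g + 1\<close> and
  \<open>H\<^sub>n\<^sup>2 = R + 4 a\<^sub>n\<^sub>+\<^sub>1\<^sup>2 G\<^sub>n G\<^sub>n\<^sub>+\<^sub>1\<close>, \<open>H\<^sub>n + H\<^sub>n\<^sub>-\<^sub>1 = 2 (z - b\<^sub>n) G\<^sub>n\<close>.

  For a discrete Schroedinger operator and \<open>g \<le> 2\<close>, comparing coefficients in these two relations shows
  that \<open>b\<^sub>n + b\<^sub>n\<^sub>+\<^sub>1\<close> is a root of a fixed cubic polynomial and determines \<open>b\<^sub>n b\<^sub>n\<^sub>+\<^sub>1\<close>, and that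
  \<open>b\<^sub>n\<^sub>+\<^sub>1 + b\<^sub>n\<^sub>-\<^sub>1\<close> is a function of \<open>b\<^sub>n\<close>. So \<open>b\<close> takes finitely many values and is periodic, say
  with period \<open>p\<close>.

  The monodromy multipliers \<open>\<lambda>\<^sup>\<plusminus>\<close> of this operator over a period then satisfy \<open>\<lambda>\<^sup>+ - \<lambda>\<^sup>- = - Q R\<^sup>1\<^sup>/\<^sup>2\<close> with a
  polynomial \<open>Q\<close>. For any other \<open>J\<close> in the class, the products of the Weyl functions over \<open>p\<close> sites
  have polynomial quotients by \<open>\<lambda>\<^sup>\<plusminus>\<close>, with limits \<open>\<alpha>\<close> and \<open>1 / \<alpha>\<close> at infinity, and both quotients
  are equal. So they are \<open>1\<close>, and the Weyl functions of \<open>J\<close>, hence also its coefficients, have period \<open>p\<close>.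
\<close>

section \<open>Square-summable sequences\<close>

text \<open>Bilinear, without conjugation: Jacobi matrices are real and symmetric, so the resolvent
  is symmetric for this pairing, and pairings of its columns are holomorphic in the spectral
  parameter.\<close>

definition dot :: "(int \<Rightarrow> complex) \<Rightarrow> (int \<Rightarrow> complex) \<Rightarrow> complex" where
  "dot u v = (\<Sum>\<^sub>\<infinity>k. u k * v k)"

lemma l2D: "u \<in> l2 \<Longrightarrow> (\<lambda>k. (cmod (u k))\<^sup>2) summable_on UNIV"
  by (simp add: l2_def)

lemma l2_cmult:
  assumes "u \<in> l2" and "\<And>k. cmod (f k) \<le> C"
  shows "(\<lambda>k. f k * u k) \<in> l2"
proof -
  have "(\<lambda>k. C\<^sup>2 * (cmod (u k))\<^sup>2) summable_on UNIV"
    using l2D[OF assms(1)] by (rule summable_on_cmult_right)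
  then have "(\<lambda>k. (cmod (f k * u k))\<^sup>2) summable_on UNIV"
  proof (rule summable_on_comparison_test)
    fix k
    show "(cmod (f k * u k))\<^sup>2 \<le> C\<^sup>2 * (cmod (u k))\<^sup>2"
      using power_mono[OF assms(2)[of k], of 2]
      by (simp add: norm_mult power_mult_distrib mult_right_mono)
  qed auto
  then show ?thesis by (simp add: l2_def)
qed

lemma l2_scale: "u \<in> l2 \<Longrightarrow> (\<lambda>k. c * u k) \<in> l2"
  by (rule l2_cmult[where C = "cmod c"]) auto

lemma l2_add:
  assumes "u \<in> l2" "v \<in> l2"
  shows "(\<lambda>k. u k + v k) \<in> l2"
proof -
  have "(\<lambda>k. 2 * (cmod (u k))\<^sup>2 + 2 * (cmod (v k))\<^sup>2) summable_on UNIV"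
    by (intro summable_on_add summable_on_cmult_right l2D assms)
  then have "(\<lambda>k. (cmod (u k + v k))\<^sup>2) summable_on UNIV"
  proof (rule summable_on_comparison_test)
    fix k
    have "(cmod (u k + v k))\<^sup>2 \<le> (cmod (u k) + cmod (v k))\<^sup>2"
      by (intro power_mono norm_triangle_ineq) auto
    also have "\<dots> \<le> 2 * (cmod (u k))\<^sup>2 + 2 * (cmod (v k))\<^sup>2"
      using zero_le_power2[of "cmod (u k) - cmod (v k)"] by (simp add: power2_eq_square algebra_simps)
    finally show "(cmod (u k + v k))\<^sup>2 \<le> 2 * (cmod (u k))\<^sup>2 + 2 * (cmod (v k))\<^sup>2" .
  qed auto
  then show ?thesis by (simp add: l2_def)
qed

lemma l2_diff:
  assumes "u \<in> l2" "v \<in> l2"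
  shows "(\<lambda>k. u k - v k) \<in> l2"
  using l2_add[OF assms(1) l2_scale[OF assms(2), of "-1"]] by simp

lemma l2_cnj: "u \<in> l2 \<Longrightarrow> (\<lambda>k. cnj (u k)) \<in> l2"
  by (simp add: l2_def)

lemma bij_add_int: "bij (\<lambda>k::int. k + c)"
  by (rule bij_betw_byWitness[where f' = "\<lambda>k. k - c"]) auto

lemma infsum_shift_int:
  fixes f :: "int \<Rightarrow> 'a::{comm_monoid_add,t2_space}"
  shows "(\<Sum>\<^sub>\<infinity>k. f (k + c)) = (\<Sum>\<^sub>\<infinity>k. f k)"
  using infsum_reindex_bij_betw[OF bij_add_int[of c], of f] by simp

lemma summable_on_shift_int:
  fixes f :: "int \<Rightarrow> 'a::{comm_monoid_add,t2_space}"
  shows "(\<lambda>k. f (k + c)) summable_on UNIV \<longleftrightarrow> f summable_on UNIV"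
  using summable_on_reindex_bij_betw[OF bij_add_int[of c], of f] by simp

lemma l2_translate: "(\<lambda>k. u (k + c)) \<in> l2 \<longleftrightarrow> u \<in> l2"
  using summable_on_shift_int[of "\<lambda>k. (cmod (u k))\<^sup>2" c] by (simp add: l2_def)

lemma l2_translate_minus: "(\<lambda>k. u (k - c)) \<in> l2 \<longleftrightarrow> u \<in> l2"
  using l2_translate[of u "- c"] by simp

lemma l2_norm_translate: "l2_norm (\<lambda>k. u (k + c)) = l2_norm u"
  using infsum_shift_int[of "\<lambda>k. (cmod (u k))\<^sup>2" c] by (simp add: l2_norm_def)

lemma l2_norm_nonneg: "l2_norm u \<ge> 0"
  by (simp add: l2_norm_def infsum_nonneg)

lemma L2_set_le_l2_norm:
  assumes "u \<in> l2" "finite F"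
  shows "L2_set (\<lambda>k. cmod (u k)) F \<le> l2_norm u"
  unfolding L2_set_def l2_norm_def
  by (intro real_sqrt_le_mono finite_sum_le_infsum l2D assms) auto

lemma cmod_le_l2_norm:
  assumes "u \<in> l2"
  shows "cmod (u k) \<le> l2_norm u"
  using L2_set_le_l2_norm[OF assms, of "{k}"] by simp

lemma l2_product_summable:
  assumes "u \<in> l2" "v \<in> l2"
  shows "(\<lambda>k. norm (u k * v k)) summable_on UNIV"
proof (rule Infinite_Sum.abs_summable_on_comparison_test')
  show "(\<lambda>k. (cmod (u k))\<^sup>2 + (cmod (v k))\<^sup>2) summable_on UNIV"
    by (intro summable_on_add l2D assms)
  fix k
  show "cmod (u k * v k) \<le> (cmod (u k))\<^sup>2 + (cmod (v k))\<^sup>2"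
    using sum_squares_bound[of "cmod (u k)" "cmod (v k)"]
      mult_nonneg_nonneg[OF norm_ge_zero[of "u k"] norm_ge_zero[of "v k"]]
    by (simp only: norm_mult mult.assoc)
qed

lemma cmod_dot_le:
  assumes "u \<in> l2" "v \<in> l2"
  shows "cmod (dot u v) \<le> l2_norm u * l2_norm v"
proof -
  note s = l2_product_summable[OF assms]
  have "cmod (dot u v) \<le> (\<Sum>\<^sub>\<infinity>k. cmod (u k * v k))"
    unfolding dot_def using s by (rule norm_infsum_bound)
  also have "\<dots> \<le> l2_norm u * l2_norm v"
  proof (rule infsum_le_finite_sums[OF s])
    fix F :: "int set" assume "finite F"
    have "(\<Sum>k\<in>F. cmod (u k * v k)) = (\<Sum>k\<in>F. \<bar>cmod (u k)\<bar> * \<bar>cmod (v k)\<bar>)"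
      by (simp add: norm_mult)
    also have "\<dots> \<le> L2_set (\<lambda>k. cmod (u k)) F * L2_set (\<lambda>k. cmod (v k)) F"
      by (rule L2_set_mult_ineq)
    also have "\<dots> \<le> l2_norm u * l2_norm v"
      by (intro mult_mono L2_set_le_l2_norm assms \<open>finite F\<close> L2_set_nonneg l2_norm_nonneg)
    finally show "(\<Sum>k\<in>F. cmod (u k * v k)) \<le> l2_norm u * l2_norm v" .
  qed
  finally show ?thesis .
qed

lemma l2_norm_power2: "(l2_norm u)\<^sup>2 = (\<Sum>\<^sub>\<infinity>k. (cmod (u k))\<^sup>2)"
  by (simp add: l2_norm_def infsum_nonneg)

lemma dot_cnj:
  assumes "u \<in> l2"
  shows "dot u (\<lambda>k. cnj (u k)) = of_real ((l2_norm u)\<^sup>2)"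
proof -
  have "((\<lambda>k. (cmod (u k))\<^sup>2) has_sum (l2_norm u)\<^sup>2) UNIV"
    unfolding l2_norm_power2 by (intro has_sum_infsum l2D assms)
  then have "((\<lambda>k. u k * cnj (u k)) has_sum of_real ((l2_norm u)\<^sup>2)) UNIV"
    by (simp only: complex_norm_square[symmetric] has_sum_of_real_iff)
  then show ?thesis by (simp add: dot_def infsumI)
qed

lemma l2_norm_scale: "l2_norm (\<lambda>k. c * u k) = cmod c * l2_norm u"
proof -
  have "(\<Sum>\<^sub>\<infinity>k. (cmod (c * u k))\<^sup>2) = (cmod c)\<^sup>2 * (\<Sum>\<^sub>\<infinity>k. (cmod (u k))\<^sup>2)"
    by (simp add: norm_mult power_mult_distrib infsum_cmult_right')
  then show ?thesis by (simp add: l2_norm_def real_sqrt_mult)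
qed

lemma l2_norm_triangle:
  assumes "u \<in> l2" "v \<in> l2"
  shows "l2_norm (\<lambda>k. u k + v k) \<le> l2_norm u + l2_norm v"
proof -
  have "(\<Sum>\<^sub>\<infinity>k. (cmod (u k + v k))\<^sup>2) \<le> (l2_norm u + l2_norm v)\<^sup>2"
  proof (rule infsum_le_finite_sums[OF l2D[OF l2_add[OF assms]]])
    fix F :: "int set" assume F: "finite F"
    have "L2_set (\<lambda>k. cmod (u k + v k)) F \<le> L2_set (\<lambda>k. cmod (u k) + cmod (v k)) F"
      by (intro L2_set_mono norm_triangle_ineq) auto
    also have "\<dots> \<le> L2_set (\<lambda>k. cmod (u k)) F + L2_set (\<lambda>k. cmod (v k)) F"
      by (rule L2_set_triangle_ineq)
    also have "\<dots> \<le> l2_norm u + l2_norm v"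
      by (intro add_mono L2_set_le_l2_norm assms F)
    finally have "(L2_set (\<lambda>k. cmod (u k + v k)) F)\<^sup>2 \<le> (l2_norm u + l2_norm v)\<^sup>2"
      by (intro power_mono L2_set_nonneg)
    then show "(\<Sum>k\<in>F. (cmod (u k + v k))\<^sup>2) \<le> (l2_norm u + l2_norm v)\<^sup>2"
      by (simp add: L2_set_def sum_nonneg)
  qed
  then show ?thesis
    unfolding l2_norm_def[of "\<lambda>k. u k + v k"] using l2_norm_nonneg
    by (intro real_le_lsqrt add_nonneg_nonneg) (auto simp: infsum_nonneg)
qed

lemma dot_add_right:
  assumes "u \<in> l2" "v \<in> l2" "w \<in> l2"
  shows "dot u (\<lambda>k. v k + w k) = dot u v + dot u w"
  using infsum_add[OF abs_summable_summable[OF l2_product_summable[OF assms(1,2)]]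
      abs_summable_summable[OF l2_product_summable[OF assms(1,3)]]]
  by (simp add: dot_def distrib_left)

lemma dot_scale_right: "dot u (\<lambda>k. c * v k) = c * dot u v"
  unfolding dot_def by (subst infsum_cmult_right'[symmetric]) (simp add: mult_ac)

lemma dot_diff_right:
  assumes "u \<in> l2" "v \<in> l2" "w \<in> l2"
  shows "dot u (\<lambda>k. v k - w k) = dot u v - dot u w"
  using dot_add_right[OF assms(1,2) l2_scale[OF assms(3), of "-1"]] dot_scale_right[of u "-1" w]
  by simp

lemma dot_commute: "dot u v = dot v u"
  by (simp add: dot_def mult.commute)

lemma dot_delta: "dot u (delta n) = u n"
proof -
  have "(\<Sum>\<^sub>\<infinity>k. u k * delta n k) = (\<Sum>\<^sub>\<infinity>k\<in>{n}. u k * delta n k)"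
    by (rule infsum_cong_neutral) (auto simp: delta_def)
  then show ?thesis by (simp add: dot_def delta_def)
qed

lemma l2_inner_delta: "l2_inner (delta n) v = v n"
  using dot_delta[of v n] by (simp add: l2_inner_def dot_def delta_def mult.commute if_distrib[of cnj] cong: if_cong)

text \<open>Serves to make Wronskians vanish at both ends of the lattice.\<close>

lemma l2_tendsto_0:
  assumes "u \<in> l2"
  shows "((\<lambda>j. u (k + int j)) \<longlonglongrightarrow> 0)" and "((\<lambda>j. u (k - int j)) \<longlonglongrightarrow> 0)"
proof -
  have "(\<lambda>j. u (k + s * int j)) \<longlonglongrightarrow> 0" if "s = 1 \<or> s = -1" for s
  proof -
    have "inj (\<lambda>j::nat. k + s * int j)" using that by (auto simp: inj_on_def)
    then have "(\<lambda>j. (cmod (u (k + s * int j)))\<^sup>2) summable_on UNIV"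
      using summable_on_reindex[of "\<lambda>j::nat. k + s * int j" UNIV "\<lambda>k. (cmod (u k))\<^sup>2"]
        summable_on_subset_banach[OF l2D[OF assms]] by (simp add: o_def)
    then have "summable (\<lambda>j. (cmod (u (k + s * int j)))\<^sup>2)"
      by (rule summable_on_imp_summable)
    then have "(\<lambda>j. (cmod (u (k + s * int j)))\<^sup>2) \<longlonglongrightarrow> 0"
      by (rule summable_LIMSEQ_zero)
    then have "(\<lambda>j. sqrt ((cmod (u (k + s * int j)))\<^sup>2)) \<longlonglongrightarrow> sqrt 0"
      by (rule tendsto_real_sqrt)
    then show ?thesis by (simp add: tendsto_norm_zero_iff)
  qed
  from this[of 1] this[of "-1"]
  show "((\<lambda>j. u (k + int j)) \<longlonglongrightarrow> 0)" "((\<lambda>j. u (k - int j)) \<longlonglongrightarrow> 0)" by simp_all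
qed

section \<open>Resolvents of Jacobi operators\<close>

locale jacobi_coefficients =
  fixes a b :: "int \<Rightarrow> real" and E :: "real set"
  assumes bounded_a: "bounded (range a)" and bounded_b: "bounded (range b)"
    and a_lower: "\<exists>c>0. \<forall>k. c \<le> a k"
    and spectrum_subset: "spectrum (jacobi a b) \<subseteq> complex_of_real ` E"
begin

text \<open>The difference expression on all sequences, free of the restriction to \<open>l2\<close>
  built into \<open>jacobi\<close>.\<close>

definition jac :: "(int \<Rightarrow> complex) \<Rightarrow> (int \<Rightarrow> complex)" where
  "jac u = (\<lambda>k. of_real (a k) * u (k - 1) + of_real (b k) * u k + of_real (a (k + 1)) * u (k + 1))"

text \<open>Column \<open>n\<close> of the resolvent matrix, so that \<open>col z n n\<close> is the
  diagonal Green function.\<close>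

definition col :: "complex \<Rightarrow> int \<Rightarrow> int \<Rightarrow> complex" where
  "col z n = resolvent (jacobi a b) z (delta n)"

definition bound :: real where
  "bound = (SOME C. (\<forall>k. \<bar>a k\<bar> \<le> C) \<and> (\<forall>k. \<bar>b k\<bar> \<le> C))"

lemma bound: "\<bar>a k\<bar> \<le> bound" "\<bar>b k\<bar> \<le> bound"
proof -
  obtain A B where "\<forall>k. \<bar>a k\<bar> \<le> A" "\<forall>k. \<bar>b k\<bar> \<le> B"
    using bounded_a bounded_b by (auto simp: bounded_iff)
  then have "(\<forall>k. \<bar>a k\<bar> \<le> max A B) \<and> (\<forall>k. \<bar>b k\<bar> \<le> max A B)"
    by (meson max.coboundedI1 max.coboundedI2)
  then have "(\<forall>k. \<bar>a k\<bar> \<le> bound) \<and> (\<forall>k. \<bar>b k\<bar> \<le> bound)"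
    unfolding bound_def by (rule someI)
  then show "\<bar>a k\<bar> \<le> bound" "\<bar>b k\<bar> \<le> bound" by blast+
qed

lemma a_pos: "a k > 0"
  using a_lower less_le_trans by blast

lemma bound_nonneg: "bound \<ge> 0"
  using bound(1)[of 0] by linarith

lemma jac_terms_l2:
  assumes "u \<in> l2"
  shows "(\<lambda>k. of_real (a k) * u (k - 1)) \<in> l2"
    and "(\<lambda>k. of_real (b k) * u k) \<in> l2"
    and "(\<lambda>k. of_real (a (k + 1)) * u (k + 1)) \<in> l2"
proof -
  have "(\<lambda>k. u (k - 1)) \<in> l2" "(\<lambda>k. u (k + 1)) \<in> l2"
    using assms by (simp_all add: l2_translate l2_translate_minus)
  then show "(\<lambda>k. of_real (a k) * u (k - 1)) \<in> l2" "(\<lambda>k. of_real (b k) * u k) \<in> l2"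
    "(\<lambda>k. of_real (a (k + 1)) * u (k + 1)) \<in> l2"
    using assms bound by (auto intro!: l2_cmult[where C = bound])
qed

lemma jac_l2: "u \<in> l2 \<Longrightarrow> jac u \<in> l2"
  unfolding jac_def by (intro l2_add jac_terms_l2)

text \<open>A shift of the summation index exchanges the two off-diagonal terms.\<close>

lemma dot_jac:
  assumes "u \<in> l2" "v \<in> l2"
  shows "dot u (jac v) = dot v (jac u)"
proof -
  have *: "dot x (\<lambda>k. of_real (a k) * y (k - 1)) = dot y (\<lambda>k. of_real (a (k + 1)) * x (k + 1))"
    for x y
    unfolding dot_def
    by (subst infsum_shift_int[symmetric, where c = 1]) (simp add: mult_ac)
  have eq: "dot x (jac y) = dot x (\<lambda>k. of_real (a k) * y (k - 1)) + dot x (\<lambda>k. of_real (b k) * y k)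
      + dot x (\<lambda>k. of_real (a (k + 1)) * y (k + 1))" if "x \<in> l2" "y \<in> l2" for x y
    unfolding jac_def using that by (simp add: dot_add_right l2_add jac_terms_l2)
  have "dot u (\<lambda>k. of_real (b k) * v k) = dot v (\<lambda>k. of_real (b k) * u k)"
    by (simp add: dot_def mult_ac)
  then show ?thesis using eq[OF assms] eq[OF assms(2,1)] *[of u v] *[of v u] by simp
qed

text \<open>Each of the three diagonals has operator norm at most \<open>bound\<close>. The
  resulting constant delimits the region outside which the Green function has a definite
  sign.\<close>

lemma cmod_dot_jac_le:
  assumes "u \<in> l2"
  shows "cmod (dot (\<lambda>k. cnj (u k)) (jac u)) \<le> 3 * bound * (l2_norm u)\<^sup>2"
proof -
  have nc: "l2_norm (\<lambda>k. cnj (u k)) = l2_norm u" by (simp add: l2_norm_def)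
  have le: "l2_norm (\<lambda>k. f k * v k) \<le> bound * l2_norm v" if "v \<in> l2" "\<And>k. cmod (f k) \<le> bound" for f v
  proof -
    have "(\<Sum>\<^sub>\<infinity>k. (cmod (f k * v k))\<^sup>2) \<le> (\<Sum>\<^sub>\<infinity>k. bound\<^sup>2 * (cmod (v k))\<^sup>2)"
    proof (rule infsum_mono)
      show "(\<lambda>k. (cmod (f k * v k))\<^sup>2) summable_on UNIV" using l2D[OF l2_cmult[OF that]] .
      show "(\<lambda>k. bound\<^sup>2 * (cmod (v k))\<^sup>2) summable_on UNIV"
        by (intro summable_on_cmult_right l2D that)
      fix k show "(cmod (f k * v k))\<^sup>2 \<le> bound\<^sup>2 * (cmod (v k))\<^sup>2"
        using power_mono[OF that(2)[of k], of 2]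
        by (simp add: norm_mult power_mult_distrib mult_right_mono)
    qed
    also have "\<dots> = (bound * l2_norm v)\<^sup>2"
      by (simp add: infsum_cmult_right' power_mult_distrib l2_norm_power2)
    finally show ?thesis
      unfolding l2_norm_def[of "\<lambda>k. f k * v k"] using bound_nonneg l2_norm_nonneg
      by (intro real_le_lsqrt) (auto simp: infsum_nonneg)
  qed
  have t: "l2_norm (\<lambda>k. u (k - 1)) = l2_norm u" "l2_norm (\<lambda>k. u (k + 1)) = l2_norm u"
    using l2_norm_translate[of u "-1"] l2_norm_translate[of u 1] by simp_all
  have "l2_norm (jac u) \<le> l2_norm (\<lambda>k. of_real (a k) * u (k - 1)) + l2_norm (\<lambda>k. of_real (b k) * u k)
      + l2_norm (\<lambda>k. of_real (a (k + 1)) * u (k + 1))"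
    unfolding jac_def
    using l2_norm_triangle[OF l2_add[OF jac_terms_l2(1)[OF assms] jac_terms_l2(2)[OF assms]] jac_terms_l2(3)[OF assms]]
      l2_norm_triangle[OF jac_terms_l2(1)[OF assms] jac_terms_l2(2)[OF assms]] by simp
  also have "\<dots> \<le> bound * l2_norm (\<lambda>k. u (k - 1)) + bound * l2_norm u + bound * l2_norm (\<lambda>k. u (k + 1))"
    using assms bound by (intro add_mono le) (auto simp: l2_translate l2_translate_minus)
  finally have n: "l2_norm (jac u) \<le> 3 * bound * l2_norm u" unfolding t by (simp add: mult_ac)
  have "cmod (dot (\<lambda>k. cnj (u k)) (jac u)) \<le> l2_norm (\<lambda>k. cnj (u k)) * l2_norm (jac u)"
    by (intro cmod_dot_le l2_cnj jac_l2 assms)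
  also have "\<dots> \<le> l2_norm u * (3 * bound * l2_norm u)"
    unfolding nc by (intro mult_left_mono n l2_norm_nonneg)
  finally show ?thesis by (simp add: power2_eq_square mult_ac)
qed

lemma minus_scalar_jacobi: "u \<in> l2 \<Longrightarrow> minus_scalar (jacobi a b) z u = (\<lambda>k. jac u k - z * u k)"
  by (simp add: minus_scalar_def jacobi_def jac_def)

section \<open>Columns of the resolvent at a point off \<open>E\<close>\<close>

context
  fixes z :: complex
  assumes z: "z \<notin> complex_of_real ` E"
begin

lemma bij_minus_scalar: "bij_betw (minus_scalar (jacobi a b) z) l2 l2"
  using z spectrum_subset by (auto simp: spectrum_def)

lemma resolvent_l2: "v \<in> l2 \<Longrightarrow> resolvent (jacobi a b) z v \<in> l2"
  unfolding resolvent_def using bij_minus_scalar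
  by (simp add: bij_betw_def inv_into_into)

lemma jac_resolvent: "v \<in> l2 \<Longrightarrow> jac (resolvent (jacobi a b) z v) k - z * resolvent (jacobi a b) z v k = v k"
proof -
  assume v: "v \<in> l2"
  have "minus_scalar (jacobi a b) z (resolvent (jacobi a b) z v) = v"
    unfolding resolvent_def using v bij_minus_scalar by (simp add: bij_betw_def f_inv_into_f)
  then show ?thesis using minus_scalar_jacobi[OF resolvent_l2[OF v]] by metis
qed

lemma resolvent_unique:
  assumes "u \<in> l2" "v \<in> l2" "\<And>k. jac u k - z * u k = v k"
  shows "u = resolvent (jacobi a b) z v"
proof -
  have "minus_scalar (jacobi a b) z u = minus_scalar (jacobi a b) z (resolvent (jacobi a b) z v)"
    using assms jac_resolvent[OF assms(2)] by (simp add: minus_scalar_jacobi resolvent_l2)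
  then show ?thesis
    using bij_minus_scalar assms(1) resolvent_l2[OF assms(2)]
    by (auto simp: bij_betw_def inj_on_def)
qed

lemma resolvent_bounded: "\<exists>C\<ge>0. \<forall>v\<in>l2. l2_norm (resolvent (jacobi a b) z v) \<le> C * l2_norm v"
proof -
  have "z \<notin> spectrum (jacobi a b)" using z spectrum_subset by blast
  then obtain C where C: "\<forall>v\<in>l2. l2_norm (resolvent (jacobi a b) z v) \<le> C * l2_norm v"
    unfolding spectrum_def by blast
  have "\<forall>v\<in>l2. l2_norm (resolvent (jacobi a b) z v) \<le> \<bar>C\<bar> * l2_norm v"
    using C l2_norm_nonneg by (meson abs_ge_self mult_right_mono order_trans)
  then show ?thesis by (intro exI[of _ "\<bar>C\<bar>"]) auto
qed

lemma col_l2: "col z n \<in> l2"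
  unfolding col_def by (rule resolvent_l2[OF delta_in_l2])

lemma jac_col: "jac (col z n) k - z * col z n k = delta n k"
  unfolding col_def by (rule jac_resolvent[OF delta_in_l2])

lemma col_unique:
  assumes "u \<in> l2" "\<And>k. jac u k - z * u k = delta n k"
  shows "u = col z n"
  unfolding col_def by (rule resolvent_unique[OF assms(1) delta_in_l2 assms(2)])

text \<open>A vanishing column would violate its own equation at site \<open>n\<close>. The
  strictness of the Herglotz and monotonicity inequalities comes from here.\<close>

lemma col_nonzero: "l2_norm (col z n) > 0"
proof (rule ccontr)
  assume "\<not> ?thesis"
  then have "col z n k = 0" for k
    using cmod_le_l2_norm[OF col_l2, of n k] l2_norm_nonneg[of "col z n"] by auto
  then show False using jac_col[of n n] by (simp add: jac_def delta_def)
qed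

end

section \<open>The diagonal Green function: Herglotz property, derivative, signs and
  asymptotics\<close>

lemma green_col: "green n z (jacobi a b) = col z n n"
  by (simp add: green_def col_def l2_inner_delta)

text \<open>The column equation paired with \<open>u\<close>; below, \<open>u\<close> is another
  column or the column itself.\<close>

lemma dot_col:
  assumes "z \<notin> complex_of_real ` E" "u \<in> l2"
  shows "dot u (jac (col z n)) - z * dot u (col z n) = u n"
proof -
  have "dot u (\<lambda>k. jac (col z n) k - z * col z n k) = u n"
    using jac_col[OF assms(1)] dot_delta by simp
  then show ?thesis
    using assms by (simp add: dot_diff_right dot_scale_right jac_l2 col_l2 l2_scale)
qed

text \<open>Pair each of the two columns with the equation of the other and subtract; the
  \<open>jac\<close> terms cancel by symmetry.\<close>

lemma resolvent_identity:
  assumes "z \<notin> complex_of_real ` E" "w \<notin> complex_of_real ` E"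
  shows "col z n n - col w n n = (z - w) * dot (col z n) (col w n)"
  using dot_col[OF assms(2) col_l2[OF assms(1)], of n n] dot_col[OF assms(1) col_l2[OF assms(2)], of n n]
    dot_jac[OF col_l2[OF assms(1)] col_l2[OF assms(2)], of n n] dot_commute[of "col z n" "col w n"]
  by (simp add: algebra_simps)

lemma cnj_in_E_iff: "cnj z \<in> complex_of_real ` E \<longleftrightarrow> z \<in> complex_of_real ` E"
proof -
  have "cnj z \<in> complex_of_real ` E" if "z \<in> complex_of_real ` E" for z using that by auto
  from this[of z] this[of "cnj z"] show ?thesis by auto
qed

lemma col_cnj:
  assumes "z \<notin> complex_of_real ` E"
  shows "col (cnj z) n = (\<lambda>k. cnj (col z n k))"
proof (rule col_unique[symmetric])
  show "cnj z \<notin> complex_of_real ` E" using assms cnj_in_E_iff by simp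
  show "(\<lambda>k. cnj (col z n k)) \<in> l2" by (intro l2_cnj col_l2 assms)
  fix k
  have "jac (\<lambda>k. cnj (col z n k)) k - cnj z * cnj (col z n k) = cnj (jac (col z n) k - z * col z n k)"
    by (simp add: jac_def)
  then show "jac (\<lambda>k. cnj (col z n k)) k - cnj z * cnj (col z n k) = delta n k"
    using jac_col[OF assms] by (simp add: delta_def)
qed

text \<open>The resolvent identity at conjugate points, where the pairing of the columns becomes a
  squared norm.\<close>

lemma Im_green:
  assumes "z \<notin> complex_of_real ` E"
  shows "Im (col z n n) = Im z * (l2_norm (col z n))\<^sup>2"
proof -
  have "col z n n - col (cnj z) n n = (z - cnj z) * dot (col z n) (col (cnj z) n)"
    using assms cnj_in_E_iff by (intro resolvent_identity) auto
  then show ?thesis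
    using dot_cnj[OF col_l2[OF assms], of n]
    by (auto simp: col_cnj[OF assms] complex_eq_iff)
qed

text \<open>In \<open>Im_green\<close> the left side is at most the norm of the column; divide by
  that norm.\<close>

lemma l2_norm_col_le:
  assumes "Im z > 0"
  shows "l2_norm (col z n) \<le> 1 / Im z"
proof -
  have z: "z \<notin> complex_of_real ` E" using assms by auto
  have "Im z * (l2_norm (col z n))\<^sup>2 \<le> l2_norm (col z n)"
    using Im_green[OF z, of n] abs_Im_le_cmod[of "col z n n"] cmod_le_l2_norm[OF col_l2[OF z], of n n]
    by linarith
  then show ?thesis using assms col_nonzero[OF z, of n]
    by (simp add: field_simps power2_eq_square)
qed

lemma open_complement_E: "closed E \<Longrightarrow> open (- complex_of_real ` E)"
  by (intro open_Compl closed_injective_linear_image) (auto simp: linear_iff scaleR_conv_of_real inj_of_real)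

text \<open>By the resolvent identity the difference quotient is
  \<open>dot (col z n) (col w n)\<close>, so it suffices that the columns depend continuously on
  \<open>z\<close> in norm.\<close>

lemma DERIV_green:
  assumes "closed E" and w: "w \<notin> complex_of_real ` E"
  shows "((\<lambda>z. col z n n) has_field_derivative dot (col w n) (col w n)) (at w)"
proof -
  obtain C where C: "C \<ge> 0" "\<forall>v\<in>l2. l2_norm (resolvent (jacobi a b) w v) \<le> C * l2_norm v"
    using resolvent_bounded[OF w] by blast
  let ?N = "l2_norm (col w n)"
  \<comment> \<open>The smallness condition bounds the perturbation by half the norm of
    \<open>col z n\<close>, which is therefore at most twice the norm of
    \<open>col w n\<close>.\<close>
  have diff: "cmod (dot (col z n) (col w n) - dot (col w n) (col w n)) \<le> 2 * C * ?N\<^sup>2 * cmod (z - w)"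
    if z: "z \<notin> complex_of_real ` E" and small: "cmod (z - w) * C \<le> 1 / 2" for z
  proof -
    let ?d = "\<lambda>k. col z n k - col w n k"
    have d: "?d \<in> l2" by (intro l2_diff col_l2 z w)
    have "?d = resolvent (jacobi a b) w (\<lambda>k. (z - w) * col z n k)"
    proof (rule resolvent_unique[OF w d l2_scale[OF col_l2[OF z]]])
      fix k
      have "jac ?d k = jac (col z n) k - jac (col w n) k" by (simp add: jac_def algebra_simps)
      then show "jac ?d k - w * ?d k = (z - w) * col z n k"
        using jac_col[OF z, of n k] jac_col[OF w, of n k] by (simp add: algebra_simps)
    qed
    then have dn: "l2_norm ?d \<le> C * (cmod (z - w) * l2_norm (col z n))"
      using C(2) l2_scale[OF col_l2[OF z], of "z - w" n] l2_norm_scale by metis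
    have "l2_norm (\<lambda>k. ?d k + col w n k) \<le> l2_norm ?d + ?N"
      by (intro l2_norm_triangle d col_l2 w)
    then have "l2_norm (col z n) \<le> l2_norm ?d + ?N" by simp
    also have "l2_norm ?d \<le> 1 / 2 * l2_norm (col z n)"
      using dn mult_right_mono[OF small l2_norm_nonneg[of "col z n"]] by (simp add: mult_ac)
    finally have "l2_norm (col z n) \<le> 2 * ?N" by simp
    then have "l2_norm ?d \<le> C * (cmod (z - w) * (2 * ?N))"
      using dn C(1) by (meson mult_left_mono norm_ge_zero order_trans)
    then have "l2_norm (col w n) * l2_norm ?d \<le> ?N * (C * (cmod (z - w) * (2 * ?N)))"
      by (intro mult_left_mono l2_norm_nonneg)
    moreover have "dot (col z n) (col w n) - dot (col w n) (col w n) = dot (col w n) ?d"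
      using z w by (simp add: dot_diff_right col_l2 dot_commute)
    moreover have "cmod (dot (col w n) ?d) \<le> ?N * l2_norm ?d"
      by (intro cmod_dot_le col_l2 w d)
    ultimately show ?thesis by (simp add: power2_eq_square mult_ac)
  qed
  have "((\<lambda>z. dot (col z n) (col w n)) \<longlongrightarrow> dot (col w n) (col w n)) (at w)"
  proof (rule Lim_null[THEN iffD2], rule Lim_null_comparison)
    have "((\<lambda>z. 2 * C * ?N\<^sup>2 * cmod (z - w)) \<longlongrightarrow> 2 * C * ?N\<^sup>2 * cmod (w - w)) (at w)"
      by (intro tendsto_intros)
    then show "((\<lambda>z. 2 * C * ?N\<^sup>2 * cmod (z - w)) \<longlongrightarrow> 0) (at w)" by simp
    have "((\<lambda>z. cmod (z - w) * C) \<longlongrightarrow> cmod (w - w) * C) (at w)"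
      by (intro tendsto_intros)
    then have "\<forall>\<^sub>F z in at w. cmod (z - w) * C < 1 / 2"
      by (rule order_tendstoD) simp
    moreover have "\<forall>\<^sub>F z in at w. z \<in> - complex_of_real ` E"
      using open_complement_E[OF assms(1)] w by (intro eventually_at_in_open') auto
    ultimately show "\<forall>\<^sub>F z in at w. norm (dot (col z n) (col w n) - dot (col w n) (col w n)) \<le> 2 * C * ?N\<^sup>2 * cmod (z - w)"
      by eventually_elim (intro diff, auto)
  qed
  moreover have "\<forall>\<^sub>F z in at w. dot (col z n) (col w n) = (col z n n - col w n n) / (z - w)"
  proof -
    have "\<forall>\<^sub>F z in at w. z \<in> - complex_of_real ` E"
      using open_complement_E[OF assms(1)] w by (intro eventually_at_in_open') auto
    moreover have "\<forall>\<^sub>F z in at w. z \<noteq> w" by (simp add: eventually_at_filter)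
    ultimately show ?thesis
      by eventually_elim (use resolvent_identity[OF _ w] in auto)
  qed
  ultimately show ?thesis
    unfolding has_field_derivative_iff by (rule Lim_transform_eventually)
qed

lemma green_real:
  assumes "x \<notin> E"
  shows "cnj (col (of_real x) n k) = col (of_real x) n k"
proof -
  have "complex_of_real x \<notin> complex_of_real ` E" using assms by auto
  from col_cnj[OF this, of n] show ?thesis by (metis complex_cnj_complex_of_real)
qed

text \<open>At real points the column is real, so its pairing with itself is its squared
  norm.\<close>

lemma DERIV_green_real:
  assumes "closed E" "x \<notin> E"
  shows "\<exists>d>0. ((\<lambda>z. col z n n) has_field_derivative of_real d) (at (complex_of_real x))"
proof -
  have x: "complex_of_real x \<notin> complex_of_real ` E" using assms by auto
  have "dot (col x n) (col x n) = of_real ((l2_norm (col x n))\<^sup>2)"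
    using dot_cnj[OF col_l2[OF x], of n] green_real[OF assms(2), of n] by simp
  then show ?thesis using DERIV_green[OF assms(1) x, of n] col_nonzero[OF x, of n]
    by (intro exI[of _ "(l2_norm (col x n))\<^sup>2"]) auto
qed

text \<open>\<open>dot_col\<close> with the column itself writes the Green function as a quadratic
  form, bounded by \<open>3 * bound\<close> times the squared norm, minus \<open>x\<close> times the
  squared norm.\<close>

lemma green_sign_outside:
  assumes "x \<notin> E"
  shows "x < - (3 * bound) \<Longrightarrow> Re (col x n n) > 0" and "x > 3 * bound \<Longrightarrow> Re (col x n n) < 0"
proof -
  have x: "complex_of_real x \<notin> complex_of_real ` E" using assms by auto
  let ?u = "col x n" let ?N = "l2_norm ?u"
  have r: "(\<lambda>k. cnj (?u k)) = ?u" using green_real[OF assms] by auto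
  have "dot ?u (jac ?u) - of_real x * of_real (?N\<^sup>2) = ?u n"
    using dot_col[OF x col_l2[OF x], of n n] dot_cnj[OF col_l2[OF x], of n] unfolding r by simp
  then have "?u n = dot ?u (jac ?u) - of_real (x * ?N\<^sup>2)" by simp
  then have e: "Re (?u n) = Re (dot ?u (jac ?u)) - x * ?N\<^sup>2"
    by (simp only: minus_complex.simps Re_complex_of_real)
  have "\<bar>Re (dot ?u (jac ?u))\<bar> \<le> 3 * bound * ?N\<^sup>2"
    using cmod_dot_jac_le[OF col_l2[OF x], of n] abs_Re_le_cmod unfolding r by (rule order_trans[rotated])
  moreover have "x * ?N\<^sup>2 < - (3 * bound) * ?N\<^sup>2" if "x < - (3 * bound)"
    using that col_nonzero[OF x, of n] by (intro mult_strict_right_mono) auto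
  moreover have "3 * bound * ?N\<^sup>2 < x * ?N\<^sup>2" if "x > 3 * bound"
    using that col_nonzero[OF x, of n] by (intro mult_strict_right_mono) auto
  ultimately show "x < - (3 * bound) \<Longrightarrow> Re (col x n n) > 0" "x > 3 * bound \<Longrightarrow> Re (col x n n) < 0"
    using e by (simp_all add: abs_le_iff)
qed

text \<open>By the column equation at its own site, the error is \<open>jac (col z n) n\<close>, and
  the column has norm at most \<open>1 / y\<close>.\<close>

lemma green_asymptotics: "((\<lambda>y. (\<i> * of_real y) * col (\<i> * of_real y) n n) \<longlongrightarrow> -1) at_top"
proof -
  have "((\<lambda>y. (\<i> * of_real y) * col (\<i> * of_real y) n n - (-1)) \<longlongrightarrow> 0) at_top"
  proof (rule Lim_null_comparison)
    show "((\<lambda>y. 3 * bound / y) \<longlongrightarrow> 0) at_top" by (rule real_tendsto_divide_at_top[OF tendsto_const filterlim_ident])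
    show "\<forall>\<^sub>F y in at_top. norm ((\<i> * of_real y) * col (\<i> * of_real y) n n - (-1)) \<le> 3 * bound / y"
      using eventually_gt_at_top[of 0]
    proof eventually_elim
      case (elim y)
      let ?z = "\<i> * of_real y"
      have z: "Im ?z > 0" using elim by simp
      then have z': "?z \<notin> complex_of_real ` E" by auto
      have c: "cmod (col ?z n k) \<le> 1 / y" for k
        using cmod_le_l2_norm[OF col_l2[OF z'], of n k] l2_norm_col_le[OF z, of n] by simp
      have t: "cmod (of_real s * col ?z n k) \<le> bound * (1 / y)" if "\<bar>s\<bar> \<le> bound" for s k
        using that c[of k] bound_nonneg by (simp only: norm_mult norm_of_real) (intro mult_mono, auto)
      have "?z * col ?z n n - (-1) = jac (col ?z n) n"
        using jac_col[OF z', of n n] by (simp add: delta_def algebra_simps)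
      then have "norm (?z * col ?z n n - (-1)) = norm (jac (col ?z n) n)" by simp
      also have "\<dots> \<le> bound * (1 / y) + bound * (1 / y) + bound * (1 / y)"
        unfolding jac_def by (intro norm_triangle_mono t bound)
      finally show ?case by simp
    qed
  qed
  then show ?thesis using Lim_null by blast
qed

text \<open>\<open>W\<close> is constant except for jumps at the sites \<open>n\<close> and
  \<open>n + 1\<close>, and it vanishes at both ends of the lattice. The first claim is the jump at
  \<open>n\<close> seen from the left; the jump at \<open>n + 1\<close> seen from the right gives
  the second.\<close>

lemma wronskian:
  fixes n :: int
  assumes z: "z \<notin> complex_of_real ` E"
  defines "W \<equiv> \<lambda>k. of_real (a (k + 1)) * (col z n k * col z (n + 1) (k + 1) - col z n (k + 1) * col z (n + 1) k)"
  shows "W n = - col z (n + 1) n" and "col z (n + 1) n = col z n (n + 1)"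
proof -
  let ?u = "col z n" let ?v = "col z (n + 1)"
  have step: "W k - W (k - 1) = ?u k * delta (n + 1) k - ?v k * delta n k" for k
    unfolding jac_col[OF z, symmetric] W_def jac_def by (simp add: algebra_simps)
  obtain C where C: "\<And>k. cmod (?u k) \<le> C" using cmod_le_l2_norm[OF col_l2[OF z]] by blast
  obtain C' where C': "\<And>k. cmod (?v k) \<le> C'" using cmod_le_l2_norm[OF col_l2[OF z]] by blast
  have bd: "cmod (W k) \<le> bound * (C * cmod (?v (k + 1)) + C * cmod (?v k))" for k
  proof -
    have "cmod (?u k * ?v (k + 1) - ?u (k + 1) * ?v k) \<le> C * cmod (?v (k + 1)) + C * cmod (?v k)"
      using norm_triangle_ineq4[of "?u k * ?v (k + 1)" "?u (k + 1) * ?v k"]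
        mult_right_mono[OF C[of k] norm_ge_zero[of "?v (k + 1)"]]
        mult_right_mono[OF C[of "k + 1"] norm_ge_zero[of "?v k"]]
      by (simp add: norm_mult)
    then show ?thesis unfolding W_def norm_mult[of "of_real _"] using bound(1)[of "k + 1"] bound_nonneg
      by (intro mult_mono) auto
  qed
  have right: "(\<lambda>j. W (n + 1 + int j)) \<longlonglongrightarrow> 0"
  proof (rule Lim_null_comparison)
    show "\<forall>\<^sub>F j in sequentially. norm (W (n + 1 + int j)) \<le> bound * (C * cmod (?v (n + 2 + int j)) + C * cmod (?v (n + 1 + int j)))"
      using bd[of "n + 1 + int _"] by (simp add: add_ac)
    have "(\<lambda>j. bound * (C * cmod (?v (n + 2 + int j)) + C * cmod (?v (n + 1 + int j)))) \<longlonglongrightarrow> bound * (C * cmod 0 + C * cmod 0)"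
      by (intro tendsto_intros l2_tendsto_0 col_l2 z)
    then show "(\<lambda>j. bound * (C * cmod (?v (n + 2 + int j)) + C * cmod (?v (n + 1 + int j)))) \<longlonglongrightarrow> 0" by simp
  qed
  have left: "(\<lambda>j. W (n - 1 - int j)) \<longlonglongrightarrow> 0"
  proof (rule Lim_null_comparison)
    show "\<forall>\<^sub>F j in sequentially. norm (W (n - 1 - int j)) \<le> bound * (C * cmod (?v (n - int j)) + C * cmod (?v (n - 1 - int j)))"
      using bd[of "n - 1 - int _"] by (simp add: algebra_simps)
    have "(\<lambda>j. bound * (C * cmod (?v (n - int j)) + C * cmod (?v (n - 1 - int j)))) \<longlonglongrightarrow> bound * (C * cmod 0 + C * cmod 0)"
      by (intro tendsto_intros l2_tendsto_0 col_l2 z)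
    then show "(\<lambda>j. bound * (C * cmod (?v (n - int j)) + C * cmod (?v (n - 1 - int j)))) \<longlonglongrightarrow> 0" by simp
  qed
  have "W (n + 1 + int j) = W (n + 1)" for j
  proof (induction j)
    case (Suc j)
    then show ?case using step[of "n + 1 + int (Suc j)"] by (simp add: delta_def algebra_simps)
  qed simp
  then have w1: "W (n + 1) = 0" using right by (simp add: LIMSEQ_const_iff)
  have "W (n - 1 - int j) = W (n - 1)" for j
  proof (induction j)
    case (Suc j)
    then show ?case using step[of "n - 1 - int j"] by (simp add: delta_def algebra_simps)
  qed simp
  then have w2: "W (n - 1) = 0" using left by (simp add: LIMSEQ_const_iff)
  show w: "W n = - ?v n" using step[of n] w2 by (simp add: delta_def)
  show "?v n = ?u (n + 1)" using step[of "n + 1"] w w1 by (simp add: delta_def)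
qed

text \<open>The factor 2 and the shift by 1 complete the square in the Wronskian identity.\<close>

definition offdiag :: "complex \<Rightarrow> int \<Rightarrow> complex" where
  "offdiag z n = 2 * of_real (a (n + 1)) * col z n (n + 1) - 1"

lemma offdiag_square:
  assumes z: "z \<notin> complex_of_real ` E"
  shows "(offdiag z n)\<^sup>2 - 1 = 4 * (of_real (a (n + 1)))\<^sup>2 * col z n n * col z (n + 1) (n + 1)"
proof -
  let ?a = "complex_of_real (a (n + 1))" let ?t = "col z n (n + 1)"
  have *: "?a * (col z n n * col z (n + 1) (n + 1) - ?t * ?t) = - ?t"
    using wronskian[OF z, of n] by simp
  have "(offdiag z n)\<^sup>2 - 1 = 4 * ?a * (?a * ?t * ?t - ?t)"
    by (simp add: offdiag_def power2_eq_square algebra_simps)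
  also have "?a * ?t * ?t - ?t = ?a * (col z n n * col z (n + 1) (n + 1))"
    using * by (simp add: algebra_simps)
  finally show ?thesis by (simp add: power2_eq_square algebra_simps)
qed

text \<open>The column equation at its own site, rewritten by the symmetry of the off-diagonal
  entries.\<close>

lemma offdiag_sum:
  assumes z: "z \<notin> complex_of_real ` E"
  shows "offdiag z n + offdiag z (n - 1) = 2 * (z - of_real (b n)) * col z n n"
proof -
  have "col z (n - 1) n = col z n (n - 1)" using wronskian(2)[OF z, of "n - 1"] by simp
  then have "of_real (a n) * col z (n - 1) n + of_real (a (n + 1)) * col z n (n + 1) = (z - of_real (b n)) * col z n n + 1"
    using jac_col[OF z, of n n] by (simp add: jac_def delta_def algebra_simps)
  then have "2 * (of_real (a n) * col z (n - 1) n + of_real (a (n + 1)) * col z n (n + 1)) = 2 * ((z - of_real (b n)) * col z n n + 1)"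
    by (rule arg_cong)
  then show ?thesis
    by (simp add: offdiag_def algebra_simps)
qed

lemma offdiag_asymptotics: "((\<lambda>y. offdiag (\<i> * of_real y) n) \<longlongrightarrow> -1) at_top"
proof -
  have "((\<lambda>y. col (\<i> * of_real y) n (n + 1)) \<longlongrightarrow> 0) at_top"
  proof (rule Lim_null_comparison)
    show "((\<lambda>y::real. 1 / y) \<longlongrightarrow> 0) at_top" by (rule real_tendsto_divide_at_top[OF tendsto_const filterlim_ident])
    show "\<forall>\<^sub>F y in at_top. norm (col (\<i> * of_real y) n (n + 1)) \<le> 1 / y"
      using eventually_gt_at_top[of 0]
    proof eventually_elim
      case (elim y)
      then have z: "Im (\<i> * of_real y) > 0" by simp
      then have "\<i> * of_real y \<notin> complex_of_real ` E" by auto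
      from cmod_le_l2_norm[OF col_l2[OF this], of n "n + 1"] l2_norm_col_le[OF z, of n]
      show ?case by simp
    qed
  qed
  then have "((\<lambda>y. 2 * of_real (a (n + 1)) * col (\<i> * of_real y) n (n + 1) - 1) \<longlongrightarrow> 2 * of_real (a (n + 1)) * 0 - 1) at_top"
    by (intro tendsto_intros)
  then show ?thesis by (simp add: offdiag_def)
qed

end

section \<open>Vertical boundary values on the upper half plane\<close>

abbreviation uhp :: "complex set" where "uhp \<equiv> {z. Im z > 0}"

lemma open_uhp: "open uhp" and convex_uhp: "convex uhp"
  using open_halfspace_Im_gt[of 0] convex_halfspace_Im_gt[of 0] by simp_all

section \<open>Limits and primitives on horizontal lines\<close>

lemma AE_lebesgue_negligible:
  fixes P :: "real \<Rightarrow> bool"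
  assumes "AE x in lebesgue. P x"
  obtains N where "negligible N" "\<And>x. x \<notin> N \<Longrightarrow> P x"
  using assms negligible_iff_null_sets unfolding eventually_ae_filter by auto

text \<open>Setting all functions to 0 on the negligible exceptional set reduces this to convergence
  everywhere.\<close>

lemma dominated_convergence_AE:
  fixes f :: "nat \<Rightarrow> real \<Rightarrow> 'm::euclidean_space"
  assumes f: "\<And>k. f k integrable_on {a..b}" and le: "\<And>k x. norm (f k x) \<le> M"
    and conv: "AE x in lebesgue. (\<lambda>k. f k x) \<longlonglongrightarrow> g x"
  shows "g integrable_on {a..b}" "(\<lambda>k. integral {a..b} (f k)) \<longlonglongrightarrow> integral {a..b} g"
proof -
  obtain N where N: "negligible N" "\<And>x. x \<notin> N \<Longrightarrow> (\<lambda>k. f k x) \<longlonglongrightarrow> g x"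
    using AE_lebesgue_negligible[OF conv] by blast
  define f' where "f' k x = (if x \<in> N then 0 else f k x)" for k x
  define g' where "g' x = (if x \<in> N then 0 else g x)" for x
  have f': "f' k integrable_on {a..b}" for k
    using f N(1) by (rule integrable_spike) (simp add: f'_def)
  have M: "M \<ge> 0" using le[of 0 0] norm_ge_zero order_trans by blast
  have le': "norm (f' k x) \<le> M" for k x using le M by (simp add: f'_def)
  have conv': "(\<lambda>k. f' k x) \<longlonglongrightarrow> g' x" for x using N(2) by (simp add: f'_def g'_def)
  note d = dominated_convergence[OF f' integrable_const_ivl[of M a b] le' conv']
  show "g integrable_on {a..b}"
    using d(1) N(1) by (rule integrable_spike) (simp add: g'_def)
  have "integral {a..b} (f' k) = integral {a..b} (f k)" for k
    by (rule integral_spike[OF N(1)]) (simp add: f'_def)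
  moreover have "integral {a..b} g' = integral {a..b} g"
    by (rule integral_spike[OF N(1)]) (simp add: g'_def)
  ultimately show "(\<lambda>k. integral {a..b} (f k)) \<longlonglongrightarrow> integral {a..b} g" using d(2) by simp
qed

lemma tendsto_at_right_sequence:
  fixes F :: "real \<Rightarrow> 'a::topological_space"
  assumes "(F \<longlongrightarrow> L) (at_right 0)"
  shows "(\<lambda>k. F (1 / real (Suc k))) \<longlonglongrightarrow> L"
proof -
  have "filterlim (\<lambda>k. 1 / real (Suc k)) (at_right 0) sequentially"
    unfolding filterlim_at using LIMSEQ_Suc[OF lim_1_over_n[where 'a = real]] by simp
  with assms show ?thesis by (rule filterlim_compose)
qed

lemma continuous_on_horizontal:
  assumes "h holomorphic_on uhp" "\<epsilon> > 0"
  shows "continuous_on T (\<lambda>s. h (Complex s \<epsilon>))"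
proof -
  have "continuous_on T (\<lambda>s. Complex s \<epsilon>)"
    unfolding Complex_eq by (intro continuous_intros)
  then show ?thesis
    by (rule continuous_on_compose2[OF holomorphic_on_imp_continuous_on[OF assms(1)]])
      (use assms(2) in auto)
qed

lemma has_integral_horizontal:
  assumes F: "\<And>z. Im z > 0 \<Longrightarrow> (F has_field_derivative h z) (at z)" and "\<epsilon> > 0" "a \<le> b"
  shows "((\<lambda>s. h (Complex s \<epsilon>)) has_integral F (Complex b \<epsilon>) - F (Complex a \<epsilon>)) {a..b}"
proof (rule fundamental_theorem_of_calculus[OF assms(3)])
  fix s assume "s \<in> {a..b}"
  have "((\<lambda>s. Complex s \<epsilon>) has_vector_derivative 1) (at s)"
    unfolding Complex_eq by (auto intro!: derivative_eq_intros)
  then have "((F \<circ> (\<lambda>s. Complex s \<epsilon>)) has_vector_derivative 1 * h (Complex s \<epsilon>)) (at s)"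
    by (rule field_vector_diff_chain_at) (use F \<open>\<epsilon> > 0\<close> in auto)
  then show "((\<lambda>s. F (Complex s \<epsilon>)) has_vector_derivative h (Complex s \<epsilon>)) (at s within {a..b})"
    by (simp add: o_def has_vector_derivative_at_within)
qed

lemma holomorphic_uhp_primitive:
  assumes "h holomorphic_on uhp"
  obtains F where "\<And>z. Im z > 0 \<Longrightarrow> (F has_field_derivative h z) (at z)"
proof -
  obtain F where F: "\<And>z. z \<in> uhp \<Longrightarrow> (F has_field_derivative h z) (at z within uhp)"
    using holomorphic_convex_primitive'[OF convex_uhp open_uhp assms] by blast
  then show ?thesis
    by (intro that[of F]) (metis at_within_open mem_Collect_eq open_uhp)
qed

lemma primitive_lipschitz:
  assumes F: "\<And>z. Im z > 0 \<Longrightarrow> (F has_field_derivative h z) (at z)"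
    and M: "\<And>z. Im z > 0 \<Longrightarrow> cmod (h z) \<le> M" and "Im z > 0" "Im w > 0"
  shows "cmod (F z - F w) \<le> M * cmod (z - w)"
  by (rule field_differentiable_bound[OF convex_uhp, where f' = h])
    (use assms in \<open>auto intro: has_field_derivative_at_within\<close>)

text \<open>A maximum principle for almost everywhere vertical boundary values. It suffices to bound the
  increments \<open>\<Phi> z = F (z + t) - F z\<close> of a primitive \<open>F\<close> by \<open>t\<close>: their bounds on horizontal lines
  converge locally uniformly by dominated convergence. The factor \<open>1 / (z + \<i>)\<close> handles infinity,
  and its effect disappears when \<open>\<Phi>\<close> is replaced by high powers of itself.\<close>

lemma bounded_holomorphic_uhp_le_1:
  assumes holo: "h holomorphic_on uhp"
    and M: "\<And>z. Im z > 0 \<Longrightarrow> cmod (h z) \<le> M"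
    and lim: "AE x in lebesgue. ((\<lambda>\<epsilon>. cmod (h (Complex x \<epsilon>))) \<longlongrightarrow> 1) (at_right 0)"
    and z0: "Im z0 > 0"
  shows "cmod (h z0) \<le> 1"
proof -
  obtain F where F: "\<And>z. Im z > 0 \<Longrightarrow> (F has_field_derivative h z) (at z)"
    using holomorphic_uhp_primitive[OF holo] by blast
  have M0: "M \<ge> 0" using M[OF z0] norm_ge_zero order_trans by blast
  let ?e = "\<lambda>k. 1 / real (Suc k)"
  have small: "(\<lambda>k. integral {a..b} (\<lambda>s. \<bar>cmod (h (Complex s (?e k))) - 1\<bar>)) \<longlonglongrightarrow> 0" for a b
  proof -
    have "(\<lambda>k. integral {a..b} (\<lambda>s. \<bar>cmod (h (Complex s (?e k))) - 1\<bar>)) \<longlonglongrightarrow> integral {a..b} (\<lambda>s::real. 0::real)"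
    proof (rule dominated_convergence_AE)
      fix k
      show "(\<lambda>s. \<bar>cmod (h (Complex s (?e k))) - 1\<bar>) integrable_on {a..b}"
        by (intro integrable_continuous_interval continuous_intros continuous_on_horizontal[OF holo]) auto
      fix x
      show "norm \<bar>cmod (h (Complex x (?e k))) - 1\<bar> \<le> M + 1"
      proof -
        have "norm \<bar>c - 1\<bar> \<le> M + 1" if "0 \<le> c" "c \<le> M" for c using that by (simp add: abs_le_iff)
        then show ?thesis using M[of "Complex x (?e k)"] by simp
      qed
    next
      show "AE x in lebesgue. (\<lambda>k. \<bar>cmod (h (Complex x (?e k))) - 1\<bar>) \<longlonglongrightarrow> 0"
        using lim
      proof eventually_elim
        case (elim x)
        have "(\<lambda>k. \<bar>cmod (h (Complex x (?e k))) - 1\<bar>) \<longlonglongrightarrow> \<bar>1 - 1\<bar>"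
          by (intro tendsto_intros tendsto_at_right_sequence[OF elim])
        then show ?case by simp
      qed
    qed
    then show ?thesis by simp
  qed
  have increment: "cmod (F (z0 + of_real t) - F z0) \<le> t" if t: "t > 0" for t
  proof (rule field_le_epsilon)
    fix \<eta> :: real assume \<eta>: "\<eta> > 0"
    define \<Phi> where "\<Phi> z = F (z + of_real t) - F z" for z
    have \<Phi>_bound: "cmod (\<Phi> z) \<le> M * t" if "Im z > 0" for z
      using primitive_lipschitz[OF F M, of "z + of_real t" z] that t by (simp add: \<Phi>_def)
    have d\<Phi>: "(\<Phi> has_field_derivative h (z + of_real t) - h z) (at z)" if "Im z > 0" for z
      unfolding \<Phi>_def using F[of z] F[of "z + of_real t"] that
      by (intro DERIV_diff DERIV_shift[THEN iffD1]) (auto simp: add.commute)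
    have power_bound: "cmod (\<Phi> z0) ^ N \<le> (t + \<eta>) ^ N * cmod (z0 + \<i>)" for N
    proof -
      \<comment> \<open>\<open>R\<close> puts \<open>z0\<close> inside the disc and is so large
        that, on the arc of radius \<open>R\<close>, dividing by \<open>z + \<i>\<close> absorbs the
        factor \<open>M ^ N\<close>.\<close>
      define R where "R = 2 + cmod z0 + M ^ N"
      have R: "R > cmod z0" "R - 1 \<ge> M ^ N" "R - 1 \<ge> 1" "R > 0"
        using zero_le_power[OF M0, of N] norm_ge_zero[of z0] unfolding R_def by linarith+
      have "\<forall>\<^sub>F k in sequentially. integral {-R..R+t} (\<lambda>s. \<bar>cmod (h (Complex s (?e k))) - 1\<bar>) < \<eta>"
        using small \<eta> by (rule order_tendstoD)
      moreover have "\<forall>\<^sub>F k in sequentially. ?e k < Im z0"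
        using LIMSEQ_Suc[OF lim_1_over_n[where 'a = real]] z0 by (intro order_tendstoD) auto
      ultimately obtain k where k: "integral {-R..R+t} (\<lambda>s. \<bar>cmod (h (Complex s (?e k))) - 1\<bar>) < \<eta>" "?e k < Im z0"
        using eventually_happens'[OF sequentially_bot eventually_conj] by blast
      \<comment> \<open>The height of the bottom edge: below \<open>z0\<close>, and with mean defect
        of \<open>cmod h\<close> from 1 smaller than \<open>\<eta>\<close>.\<close>
      define \<epsilon> where "\<epsilon> = ?e k"
      have \<epsilon>: "\<epsilon> > 0" "\<epsilon> < Im z0" using k by (auto simp: \<epsilon>_def)
      define S where "S = {z. Im z \<ge> \<epsilon>} \<inter> cball 0 R"
      have "closed S" unfolding S_def using closed_halfspace_Im_ge by (intro closed_Int) auto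
      have Spos: "Im z > 0" if "z \<in> S" for z using that \<epsilon> by (auto simp: S_def)
      define f where "f z = \<Phi> z ^ N / (z + \<i>)" for z
      have nz: "cmod (z + \<i>) \<ge> 1" if "Im z > 0" for z
        using abs_Im_le_cmod[of "z + \<i>"] that by simp
      have f_holo: "f holomorphic_on uhp"
      proof -
        have "\<Phi> holomorphic_on uhp"
          unfolding holomorphic_on_def field_differentiable_def
          using d\<Phi> has_field_derivative_at_within by blast
        then show ?thesis unfolding f_def
          by (intro holomorphic_intros) (auto simp: complex_eq_iff)
      qed
      have "cmod (f z0) \<le> (t + \<eta>) ^ N"
      proof (rule maximum_modulus_frontier[of f S])
        show "f holomorphic_on interior S"
          using f_holo by (rule holomorphic_on_subset) (use Spos interior_subset in blast)
        show "continuous_on (closure S) f"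
          using \<open>closed S\<close> Spos by (intro continuous_on_subset[OF holomorphic_on_imp_continuous_on[OF f_holo]]) auto
        show "bounded S" unfolding S_def by (intro bounded_Int) auto
        show "z0 \<in> S" using R \<epsilon> by (auto simp: S_def)
        fix z assume z: "z \<in> frontier S"
        then have zS: "z \<in> S" using \<open>closed S\<close> frontier_subset_closed by blast
        have "open ({z. Im z > \<epsilon>} \<inter> ball 0 R)" by (intro open_Int open_halfspace_Im_gt open_ball)
        moreover have "{z. Im z > \<epsilon>} \<inter> ball 0 R \<subseteq> S" by (auto simp: S_def)
        ultimately have "{z. Im z > \<epsilon>} \<inter> ball 0 R \<subseteq> interior S" by (rule interior_maximal[rotated])
        then have "z \<notin> {z. Im z > \<epsilon>} \<inter> ball 0 R" using z by (auto simp: frontier_def)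
        then consider "Im z = \<epsilon>" "cmod z \<le> R" | "cmod z = R" using zS by (fastforce simp: S_def)
        then show "cmod (f z) \<le> (t + \<eta>) ^ N"
        proof cases
          case 1
          let ?x = "Re z"
          have z_eq: "z = Complex ?x \<epsilon>" "z + of_real t = Complex (?x + t) \<epsilon>" using 1 by (auto simp: complex_eq_iff)
          \<comment> \<open>On the bottom edge the increment is an integral of \<open>h\<close> over
            an interval of length \<open>t\<close> inside \<open>{-R..R+t}\<close>.\<close>
          have hi: "((\<lambda>s. h (Complex s \<epsilon>)) has_integral \<Phi> z) {?x..?x+t}"
            unfolding \<Phi>_def z_eq(2) using has_integral_horizontal[OF F \<epsilon>(1), of ?x "?x + t"] t z_eq(1) by simp
          have int: "(\<lambda>s. \<bar>cmod (h (Complex s \<epsilon>)) - 1\<bar>) integrable_on {c..d}" for c d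
            by (intro integrable_continuous_interval continuous_intros continuous_on_horizontal[OF holo] \<epsilon>)
          have x: "\<bar>?x\<bar> \<le> R" using 1(2) abs_Re_le_cmod[of z] by linarith
          have "cmod (\<Phi> z) = cmod (integral {?x..?x+t} (\<lambda>s. h (Complex s \<epsilon>)))"
            using hi by (simp add: integral_unique)
          also have "\<dots> \<le> integral {?x..?x+t} (\<lambda>s. 1 + \<bar>cmod (h (Complex s \<epsilon>)) - 1\<bar>)"
            using hi int by (intro integral_norm_bound_integral integrable_add) (auto simp: has_integral_integrable)
          also have "\<dots> = t + integral {?x..?x+t} (\<lambda>s. \<bar>cmod (h (Complex s \<epsilon>)) - 1\<bar>)"
            using int t by (subst integral_add) auto
          also have "integral {?x..?x+t} (\<lambda>s. \<bar>cmod (h (Complex s \<epsilon>)) - 1\<bar>) \<le> integral {-R..R+t} (\<lambda>s. \<bar>cmod (h (Complex s \<epsilon>)) - 1\<bar>)"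
            using x int t by (intro integral_subset_le) auto
          also have "\<dots> \<le> \<eta>" using k(1) by (simp add: \<epsilon>_def)
          finally have "cmod (\<Phi> z) \<le> t + \<eta>" by simp
          then have "cmod (\<Phi> z) ^ N \<le> (t + \<eta>) ^ N" by (intro power_mono) auto
          moreover have "cmod (f z) \<le> cmod (\<Phi> z) ^ N / 1"
            unfolding f_def norm_divide norm_power using nz[OF Spos[OF zS]] by (intro divide_left_mono) auto
          ultimately show ?thesis by simp
        next
          case 2
          have "cmod (z + \<i>) \<ge> R - 1"
            using norm_triangle_ineq2[of z "- \<i>"] 2 by simp
          then have "cmod (f z) \<le> cmod (\<Phi> z) ^ N / (R - 1)"
            unfolding f_def norm_divide norm_power using R by (intro divide_left_mono mult_pos_pos) auto
          also have "\<dots> \<le> (M * t) ^ N / (R - 1)"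
            using R by (intro divide_right_mono power_mono \<Phi>_bound Spos zS) auto
          also have "\<dots> \<le> (R - 1) * t ^ N / (R - 1)"
            using R t by (intro divide_right_mono) (auto simp: power_mult_distrib intro: mult_right_mono)
          also have "\<dots> = t ^ N" using R by simp
          also have "\<dots> \<le> (t + \<eta>) ^ N" using t \<eta> by (intro power_mono) auto
          finally show ?thesis .
        qed
      qed
      then have "cmod (\<Phi> z0) ^ N / cmod (z0 + \<i>) \<le> (t + \<eta>) ^ N"
        by (simp add: f_def norm_divide norm_power)
      then show ?thesis using nz[OF z0] by (subst (asm) pos_divide_le_eq) auto
    qed
    have "cmod (\<Phi> z0) \<le> t + \<eta>"
    proof (rule ccontr)
      assume "\<not> ?thesis"
      then have "cmod (\<Phi> z0) / (t + \<eta>) > 1" using t \<eta> by (simp add: field_simps)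
      then obtain N where "cmod (z0 + \<i>) < (cmod (\<Phi> z0) / (t + \<eta>)) ^ N"
        using real_arch_pow by blast
      then show False using power_bound[of N] t \<eta>
        by (simp add: power_divide field_simps)
    qed
    then show "cmod (F (z0 + of_real t) - F z0) \<le> t + \<eta>" by (simp add: \<Phi>_def)
  qed
  \<comment> \<open>The bound on increments passes to the derivative at \<open>z0\<close> through
    real \<open>t > 0\<close>.\<close>
  have "((\<lambda>y. (F (z0 + y) - F z0) / y) \<longlongrightarrow> h z0) (at 0)"
    using F[OF z0] by (simp add: DERIV_def)
  moreover have "filterlim complex_of_real (at 0) (at_right 0)"
    unfolding filterlim_at by (auto intro!: tendsto_eq_intros simp: eventually_at_filter)
  ultimately have "((\<lambda>t. (F (z0 + of_real t) - F z0) / of_real t) \<longlongrightarrow> h z0) (at_right 0)"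
    by (rule filterlim_compose)
  moreover have "\<forall>\<^sub>F t in at_right 0. cmod ((F (z0 + of_real t) - F z0) / of_real t) \<le> 1"
    using eventually_at_right_less[of 0]
  proof eventually_elim
    case (elim t)
    then show ?case using increment[of t] by (simp add: norm_divide)
  qed
  ultimately show ?thesis
    by (intro Lim_norm_ubound[of "at_right 0"]) auto
qed

text \<open>The preceding maximum principle, applied to \<open>h\<close> and to its inverse.\<close>

lemma bounded_holomorphic_uhp_eq_1:
  assumes "h holomorphic_on uhp"
    and "m > 0" and "\<And>z. Im z > 0 \<Longrightarrow> cmod (h z) \<le> M" and "\<And>z. Im z > 0 \<Longrightarrow> m \<le> cmod (h z)"
    and lim: "AE x in lebesgue. ((\<lambda>\<epsilon>. cmod (h (Complex x \<epsilon>))) \<longlongrightarrow> 1) (at_right 0)"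
    and z0: "Im z0 > 0"
  shows "cmod (h z0) = 1"
proof -
  have nz: "h z \<noteq> 0" if "Im z > 0" for z using assms(2) assms(4)[OF that] by auto
  have "cmod (inverse (h z0)) \<le> 1"
  proof (rule bounded_holomorphic_uhp_le_1[OF _ _ _ z0, where M = "1 / m"])
    show "(\<lambda>z. inverse (h z)) holomorphic_on uhp"
      using nz by (intro holomorphic_intros assms(1)) auto
    show "cmod (inverse (h z)) \<le> 1 / m" if "Im z > 0" for z
      using assms(2) assms(4)[OF that] by (simp add: norm_inverse divide_inverse le_imp_inverse_le)
    show "AE x in lebesgue. ((\<lambda>\<epsilon>. cmod (inverse (h (Complex x \<epsilon>)))) \<longlongrightarrow> 1) (at_right 0)"
      using lim
    proof eventually_elim
      case (elim x)
      from tendsto_inverse[OF this] show ?case by (simp add: norm_inverse)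
    qed
  qed
  moreover have "cmod (h z0) \<le> 1"
    by (rule bounded_holomorphic_uhp_le_1[OF assms(1,3) lim z0])
  ultimately show ?thesis using nz[OF z0] by (simp add: norm_divide divide_le_eq inverse_eq_divide)
qed

text \<open>A Herglotz function \<open>g\<close> does not tend to \<open>0\<close> on a set of positive measure: as \<open>t\<close> decreases to
  \<open>0\<close>, the functions \<open>g / (g + \<i> t)\<close>, of modulus at most \<open>1\<close>, tend to \<open>1\<close> inside the half plane,
  while their boundary values vanish on that set.\<close>

lemma herglotz_boundary_nonzero:
  assumes holo: "g holomorphic_on uhp"
    and pos: "\<And>z. Im z > 0 \<Longrightarrow> Im (g z) > 0"
    and lim: "AE x in lebesgue. \<exists>L. ((\<lambda>\<epsilon>. g (Complex x \<epsilon>)) \<longlongrightarrow> L) (at_right 0)"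
  shows "AE x in lebesgue. \<exists>L. ((\<lambda>\<epsilon>. g (Complex x \<epsilon>)) \<longlongrightarrow> L) (at_right 0) \<and> L \<noteq> 0"
proof -
  define L where "L x = Lim (at_right 0) (\<lambda>\<epsilon>. g (Complex x \<epsilon>))" for x
  have L: "AE x in lebesgue. ((\<lambda>\<epsilon>. g (Complex x \<epsilon>)) \<longlongrightarrow> L x) (at_right 0)"
    using lim unfolding L_def by eventually_elim (metis tendsto_Lim trivial_limit_at_right_real)
  let ?Z = "{x. L x = 0}"
  let ?e = "\<lambda>k. 1 / real (Suc k)"
  define h where "h j z = g z / (g z + \<i> * of_real (?e j))" for j z
  have nz: "w + \<i> * of_real (?e j) \<noteq> 0" if "Im w \<ge> 0" for w j
  proof -
    have "Im (w + \<i> * of_real (?e j)) > 0" using that by (simp add: add_nonneg_pos)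
    then show ?thesis by (metis less_irrefl zero_complex.simps(2))
  qed
  have h_le: "cmod (w / (w + \<i> * of_real (?e j))) \<le> 1" if "Im w \<ge> 0" for w j
  proof -
    have "(Im w)\<^sup>2 \<le> (Im w + ?e j)\<^sup>2" using that by (intro power_mono) auto
    then have "cmod w \<le> cmod (w + \<i> * of_real (?e j))" by (simp add: cmod_def)
    then show ?thesis using nz[OF that, of j] by (simp add: norm_divide divide_le_eq)
  qed
  have h_holo: "h j holomorphic_on uhp" for j
    unfolding h_def using nz pos by (intro holomorphic_intros holo) (auto simp: less_imp_le)
  have h_le': "cmod (h j z) \<le> 1" if "Im z > 0" for j z
    unfolding h_def using pos[OF that] by (intro h_le) auto
  have L_pos: "AE x in lebesgue. Im (L x) \<ge> 0"
    using L
  proof eventually_elim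
    case (elim x)
    have "\<forall>\<^sub>F \<epsilon> in at_right 0. 0 \<le> Im (g (Complex x \<epsilon>))"
      using eventually_at_right_less[of 0] by eventually_elim (use pos in \<open>auto intro!: less_imp_le\<close>)
    then show ?case using tendsto_Im[OF elim] by (intro tendsto_lowerbound) auto
  qed
  \<comment> \<open>Almost everywhere \<open>\<psi> j\<close> is the boundary value of
    \<open>cmod (h j)\<close>; the factor \<open>of_bool\<close> keeps it below 1 also at the
    exceptional points. \<open>\<kappa>\<close> is the limit of \<open>\<psi> j\<close> in
    \<open>j\<close>.\<close>
  define \<psi> where "\<psi> j x = cmod (L x / (L x + \<i> * of_real (?e j))) * of_bool (Im (L x) \<ge> 0)" for j x
  define \<kappa> :: "real \<Rightarrow> real" where "\<kappa> x = of_bool (L x \<noteq> 0)" for x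
  have "(indicat_real ?Z has_integral 0) {a..b}" for a b
  proof (cases "a \<le> b")
    case True
    have \<psi>: "\<psi> j integrable_on {a..b}"
      "(\<lambda>k. integral {a..b} (\<lambda>s. cmod (h j (Complex s (?e k))))) \<longlonglongrightarrow> integral {a..b} (\<psi> j)" for j
    proof -
      have 1: "(\<lambda>s. cmod (h j (Complex s (?e k)))) integrable_on {a..b}" for k
        by (intro integrable_continuous_interval continuous_intros continuous_on_horizontal[OF h_holo]) auto
      have 2: "norm (cmod (h j (Complex s (?e k)))) \<le> 1" for k s using h_le' by simp
      have 3: "AE x in lebesgue. (\<lambda>k. cmod (h j (Complex x (?e k)))) \<longlonglongrightarrow> \<psi> j x"
        using L L_pos
      proof eventually_elim
        case (elim x)
        have "(\<lambda>k. cmod (h j (Complex x (?e k)))) \<longlonglongrightarrow> cmod (L x / (L x + \<i> * of_real (?e j)))"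
          unfolding h_def using nz[OF elim(2), of j]
          by (intro tendsto_intros tendsto_at_right_sequence[OF elim(1)])
        then show ?case using elim(2) by (simp add: \<psi>_def)
      qed
      show "\<psi> j integrable_on {a..b}"
        "(\<lambda>k. integral {a..b} (\<lambda>s. cmod (h j (Complex s (?e k))))) \<longlonglongrightarrow> integral {a..b} (\<psi> j)"
        by (rule dominated_convergence_AE[OF 1 2 3])+
    qed
    have \<psi>_le: "norm (\<psi> j x) \<le> 1" for j x
      using h_le[of "L x" j] by (simp add: \<psi>_def of_bool_def)
    have e0: "?e \<longlonglongrightarrow> 0" using LIMSEQ_Suc[OF lim_1_over_n[where 'a = real]] by simp
    have to1: "(\<lambda>j. w / (w + \<i> * of_real (?e j))) \<longlonglongrightarrow> 1" if "w \<noteq> 0" for w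
    proof -
      have "(\<lambda>j. w / (w + \<i> * of_real (?e j))) \<longlonglongrightarrow> w / (w + \<i> * of_real 0)"
        using that by (intro tendsto_intros e0) auto
      then show ?thesis using that by simp
    qed
    have \<kappa>: "\<kappa> integrable_on {a..b}" "(\<lambda>j. integral {a..b} (\<psi> j)) \<longlonglongrightarrow> integral {a..b} \<kappa>"
    proof -
      have 3: "AE x in lebesgue. (\<lambda>j. \<psi> j x) \<longlonglongrightarrow> \<kappa> x"
        using L_pos
      proof eventually_elim
        case (elim x)
        show ?case
        proof (cases "L x = 0")
          case True then show ?thesis by (simp add: \<psi>_def \<kappa>_def)
        next
          case False
          from tendsto_norm[OF to1[OF this]] show ?thesis using elim False by (simp add: \<psi>_def \<kappa>_def)
        qed
      qed
      show "\<kappa> integrable_on {a..b}" "(\<lambda>j. integral {a..b} (\<psi> j)) \<longlonglongrightarrow> integral {a..b} \<kappa>"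
        by (rule dominated_convergence_AE[OF \<psi>(1) \<psi>_le 3])+
    qed
    \<comment> \<open>The integral at height \<open>\<delta>\<close> is compared with those at
      smaller heights through a primitive; since \<open>cmod (h j)\<close> is at most 1, the
      vertical sides cost at most \<open>2 * \<delta>\<close>, uniformly in
      \<open>j\<close>.\<close>
    have lower: "b - a \<le> integral {a..b} \<kappa> + 2 * \<delta>" if \<delta>: "\<delta> > 0" for \<delta>
    proof -
      have "cmod (integral {a..b} (\<lambda>s. h j (Complex s \<delta>))) \<le> integral {a..b} (\<psi> j) + 2 * \<delta>" for j
      proof -
        obtain F where F: "\<And>z. Im z > 0 \<Longrightarrow> (F has_field_derivative h j z) (at z)"
          using holomorphic_uhp_primitive[OF h_holo] by blast
        have "\<forall>\<^sub>F k in sequentially. ?e k < \<delta>" using e0 \<delta> by (rule order_tendstoD)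
        then have "\<forall>\<^sub>F k in sequentially. cmod (integral {a..b} (\<lambda>s. h j (Complex s \<delta>))) - 2 * \<delta>
            \<le> integral {a..b} (\<lambda>s. cmod (h j (Complex s (?e k))))"
        proof eventually_elim
          case (elim k)
          let ?I = "\<lambda>\<epsilon>. integral {a..b} (\<lambda>s. h j (Complex s \<epsilon>))"
          have I: "?I \<epsilon> = F (Complex b \<epsilon>) - F (Complex a \<epsilon>)" if "\<epsilon> > 0" for \<epsilon>
            using has_integral_horizontal[OF F that True] by (rule integral_unique)
          have v: "cmod (F (Complex x \<delta>) - F (Complex x (?e k))) \<le> \<delta>" for x
          proof -
            have "cmod (F (Complex x \<delta>) - F (Complex x (?e k))) \<le> 1 * cmod (Complex x \<delta> - Complex x (?e k))"
              by (rule primitive_lipschitz[OF F h_le']) (use \<delta> in auto)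
            also have "Complex x \<delta> - Complex x (?e k) = \<i> * of_real (\<delta> - ?e k)"
              by (simp add: complex_eq_iff)
            also have "1 * cmod (\<i> * of_real (\<delta> - ?e k)) \<le> \<delta>"
              using elim by (simp only: norm_mult norm_of_real) simp
            finally show ?thesis .
          qed
          have "?I \<delta> = ?I (?e k) + ((F (Complex b \<delta>) - F (Complex b (?e k))) - (F (Complex a \<delta>) - F (Complex a (?e k))))"
            using I[OF \<delta>] I[of "?e k"] by simp
          then have "cmod (?I \<delta>) \<le> cmod (?I (?e k)) + (\<delta> + \<delta>)"
            using norm_triangle_mono[OF order_refl norm_triangle_le_diff[OF add_mono[OF v v]]]
            by (simp only:)
          moreover have "cmod (?I (?e k)) \<le> integral {a..b} (\<lambda>s. cmod (h j (Complex s (?e k))))"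
            by (intro integral_norm_bound_integral integrable_continuous_interval continuous_intros
                continuous_on_horizontal[OF h_holo]) auto
          ultimately show ?case by simp
        qed
        then have "cmod (integral {a..b} (\<lambda>s. h j (Complex s \<delta>))) - 2 * \<delta> \<le> integral {a..b} (\<psi> j)"
          using \<psi>(2) by (intro tendsto_lowerbound) auto
        then show ?thesis by simp
      qed
      \<comment> \<open>At a fixed height \<open>g\<close> has no zero, so \<open>h j\<close> tends
        to 1 at every point of the segment.\<close>
      moreover have "(\<lambda>j. integral {a..b} (\<lambda>s. h j (Complex s \<delta>))) \<longlonglongrightarrow> integral {a..b} (\<lambda>s. 1::complex)"
      proof (rule dominated_convergence_AE)
        show "(\<lambda>s. h k (Complex s \<delta>)) integrable_on {a..b}" for k
          by (intro integrable_continuous_interval continuous_on_horizontal[OF h_holo] \<delta>)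
        show "cmod (h k (Complex x \<delta>)) \<le> 1" for k x using h_le' \<delta> by simp
        have "g (Complex x \<delta>) \<noteq> 0" for x using pos[of "Complex x \<delta>"] \<delta> by auto
        then show "AE x in lebesgue. (\<lambda>k. h k (Complex x \<delta>)) \<longlonglongrightarrow> 1"
          unfolding h_def by (intro AE_I2 to1)
      qed
      ultimately have "cmod (integral {a..b} (\<lambda>s. 1::complex)) \<le> integral {a..b} \<kappa> + 2 * \<delta>"
        by (intro LIMSEQ_le[OF tendsto_norm tendsto_add[OF \<kappa>(2) tendsto_const]]) auto
      then show ?thesis using True by simp
    qed
    \<comment> \<open>So \<open>\<kappa>\<close> has full integral, which leaves nothing for the
      indicator \<open>1 - \<kappa>\<close> of the zero set.\<close>
    have "b - a \<le> integral {a..b} \<kappa>"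
      by (rule field_le_epsilon) (use lower[of "_ / 2"] in auto)
    moreover have ind: "indicat_real ?Z = (\<lambda>x. 1 - \<kappa> x)" by (auto simp: \<kappa>_def indicator_def)
    moreover have "(\<lambda>x. 1 - \<kappa> x) integrable_on {a..b}" using \<kappa>(1) by (intro integrable_diff) auto
    moreover have "integral {a..b} (\<lambda>x. 1 - \<kappa> x) = (b - a) - integral {a..b} \<kappa>"
      using \<kappa>(1) True by (subst integral_diff) auto
    moreover have "integral {a..b} (\<lambda>x. 1 - \<kappa> x) \<ge> 0"
      using \<open>(\<lambda>x. 1 - \<kappa> x) integrable_on {a..b}\<close> by (rule integral_nonneg) (simp add: \<kappa>_def)
    ultimately show ?thesis by (simp add: has_integral_integral)
  qed auto
  then have "negligible ?Z" unfolding negligible_def by simp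
  then have "?Z \<in> null_sets lebesgue" by (simp add: negligible_iff_null_sets)
  then have "AE x in lebesgue. x \<notin> ?Z" by (rule AE_not_in)
  then show ?thesis using L by eventually_elim auto
qed

text \<open>A logarithm that is continuous on the closed upper half plane without \<open>0\<close>.\<close>

definition lg :: "complex \<Rightarrow> complex" where
  "lg w = Ln (- \<i> * w)"

lemma exp_lg: "w \<noteq> 0 \<Longrightarrow> exp (lg w) = - \<i> * w"
  by (simp add: lg_def)

lemma Im_lg_bound: "w \<noteq> 0 \<Longrightarrow> \<bar>Im (lg w)\<bar> \<le> pi"
  using mpi_less_Im_Ln[of "- \<i> * w"] Im_Ln_le_pi[of "- \<i> * w"] by (auto simp: lg_def)

lemma notin_nonpos_Reals_uhp:
  assumes "Im w \<ge> 0" "w \<noteq> 0"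
  shows "- \<i> * w \<notin> \<real>\<^sub>\<le>\<^sub>0"
  using assms by (auto simp: complex_nonpos_Reals_iff complex_eq_iff)

lemma holomorphic_lg:
  assumes "f holomorphic_on uhp" "\<And>z. Im z > 0 \<Longrightarrow> Im (f z) > 0"
  shows "(\<lambda>z. lg (f z)) holomorphic_on uhp"
  unfolding lg_def
  by (intro holomorphic_on_Ln' holomorphic_intros assms notin_nonpos_Reals_uhp)
    (use assms(2) in \<open>auto intro: less_imp_le\<close>, fastforce)

lemma tendsto_lg:
  assumes "(f \<longlongrightarrow> L) F" "Im L \<ge> 0" "L \<noteq> 0"
  shows "((\<lambda>x. lg (f x)) \<longlongrightarrow> lg L) F"
  unfolding lg_def using notin_nonpos_Reals_uhp[OF assms(2,3)]
  by (intro tendsto_Ln tendsto_intros assms(1))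

text \<open>The branch cut of \<open>lg\<close> is the negative imaginary axis, so positive reals
  have phase \<open>- pi / 2\<close> and negative reals have phase \<open>pi / 2\<close>.\<close>

lemma Im_lg_of_real:
  assumes "t \<noteq> 0"
  shows "Im (lg (of_real t)) = - (pi / 2) * sgn t"
proof (cases "t > 0")
  case True
  have "Ln (of_real t * (- \<i>)) = of_real (ln t) + Ln (- \<i>)"
    using True Ln_times_of_real[of t "- \<i>"] by (simp add: Ln_of_real)
  then show ?thesis using True by (simp add: lg_def mult.commute)
next
  case False
  have "Ln (of_real (- t) * \<i>) = of_real (ln (- t)) + Ln \<i>"
    using False assms Ln_times_of_real[of "- t" \<i>] by (simp add: Ln_of_real del: of_real_minus)
  then show ?thesis using False assms by (simp add: lg_def mult.commute sgn_if)
qed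

text \<open>The phase of a reflectionless boundary value on a band.\<close>

lemma Im_lg_imaginary:
  assumes "Re L = 0" "Im L \<ge> 0" "L \<noteq> 0"
  shows "Im (lg L) = 0"
proof -
  have "- \<i> * L = of_real (Im L)" "Im L > 0" using assms by (auto simp: complex_eq_iff)
  then have "lg L = Ln (of_real (Im L))" by (simp only: lg_def)
  then show ?thesis using \<open>Im L > 0\<close> by (simp add: Ln_of_real)
qed

text \<open>The infimum of the points where \<open>f\<close> is nonnegative; it degenerates to
  \<open>c\<close> or \<open>d\<close> when \<open>f\<close> keeps its sign.\<close>

lemma sign_change_point:
  fixes f :: "real \<Rightarrow> real"
  assumes "c < d" and incr: "\<And>x y. c < x \<Longrightarrow> x < y \<Longrightarrow> y < d \<Longrightarrow> f x < f y"
  shows "\<exists>m. c \<le> m \<and> m \<le> d \<and> (\<forall>x. c < x \<longrightarrow> x < d \<longrightarrow> (x < m \<longrightarrow> f x < 0) \<and> (m < x \<longrightarrow> f x > 0))"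
proof (cases "\<exists>x. c < x \<and> x < d \<and> f x \<ge> 0")
  case True
  let ?S = "{x. c < x \<and> x < d \<and> f x \<ge> 0}"
  have ne: "?S \<noteq> {}" and bb: "bdd_below ?S" using True by (auto intro: bdd_belowI[of _ c])
  have "c \<le> Inf ?S" using ne by (intro cInf_greatest) auto
  moreover have "Inf ?S \<le> d" using True bb by (auto intro: cInf_lower2)
  moreover have "f x < 0" if "c < x" "x < d" "x < Inf ?S" for x
    using that cInf_lower[OF _ bb, of x] by (cases "f x \<ge> 0") auto
  moreover have "f x > 0" if x: "c < x" "x < d" "Inf ?S < x" for x
  proof -
    obtain y where "y \<in> ?S" "y < x" using x(3) cInf_less_iff[OF ne bb] by blast
    then show ?thesis using incr[of y x] x by auto
  qed
  ultimately show ?thesis by (intro exI[of _ "Inf ?S"]) auto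
next
  case False
  then show ?thesis using \<open>c < d\<close> by (intro exI[of _ d]) (auto simp: not_le)
qed

text \<open>Otherwise the image would be open and contain points off the real line.\<close>

lemma real_valued_holomorphic_constant:
  assumes "f holomorphic_on uhp" "\<And>z. Im z > 0 \<Longrightarrow> Im (f z) = 0"
  shows "f constant_on uhp"
proof (rule ccontr)
  assume "\<not> ?thesis"
  then have "open (f ` uhp)"
    using open_mapping_thm[OF assms(1) open_uhp convex_connected[OF convex_uhp] open_uhp order_refl] by blast
  moreover have "f \<i> \<in> f ` uhp" by simp
  ultimately obtain e where e: "e > 0" "ball (f \<i>) e \<subseteq> f ` uhp"
    by (meson open_contains_ball)
  have "f \<i> + \<i> * of_real (e / 2) \<in> ball (f \<i>) e" using e by (simp add: dist_norm norm_mult)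
  then obtain z where "Im z > 0" "f z = f \<i> + \<i> * of_real (e / 2)" using e(2) by auto
  then show False using assms(2)[of z] assms(2)[of \<i>] e by simp
qed

section \<open>Green functions of finite gap sets\<close>

locale bands =
  fixes g :: nat and l r :: "nat \<Rightarrow> real"
  assumes band: "i \<le> g \<Longrightarrow> l i < r i" and gap: "i < g \<Longrightarrow> r i < l (Suc i)"
begin

definition E :: "real set" where "E = (\<Union>i\<le>g. {l i..r i})"

section \<open>The inverse square root of \<open>R\<close> and the phases on bands and gaps\<close>

definition R :: "complex \<Rightarrow> complex" where
  "R z = (\<Prod>i\<le>g. (z - of_real (l i)) * (z - of_real (r i)))"

text \<open>The root is taken factor by factor, so that it extends continuously to the real line
  away from the band edges; its square is \<open>1 / R\<close> up to sign.\<close>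

definition K0 :: "complex \<Rightarrow> complex" where
  "K0 z = exp (- (1 / 2) * (\<Sum>i\<le>g. lg (z - of_real (l i)) + lg (z - of_real (r i))))"

text \<open>The unimodular factor makes this the branch of the inverse square root of
  \<open>R\<close> that behaves like \<open>1 / z ^ (g + 1)\<close> at infinity.\<close>

definition K :: "complex \<Rightarrow> complex" where
  "K z = - \<i> * (- \<i>) ^ g * K0 z"

lemma closed_E: "closed E"
  unfolding E_def by (intro closed_UN) auto

lemma K_square:
  assumes "Im z > 0"
  shows "(K z)\<^sup>2 * R z = 1"
proof -
  have nz: "z - of_real x \<noteq> 0" for x using assms by (auto simp: complex_eq_iff)
  have "(K0 z)\<^sup>2 = exp (- (\<Sum>i\<le>g. lg (z - of_real (l i)) + lg (z - of_real (r i))))"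
    unfolding K0_def exp_of_nat_mult[symmetric] power2_eq_square exp_add[symmetric] by simp
  also have "\<dots> = inverse (\<Prod>i\<le>g. exp (lg (z - of_real (l i))) * exp (lg (z - of_real (r i))))"
    by (simp add: exp_minus exp_sum exp_add)
  also have "(\<Prod>i\<le>g. exp (lg (z - of_real (l i))) * exp (lg (z - of_real (r i)))) =
      (\<Prod>i\<le>g. (-1) * ((z - of_real (l i)) * (z - of_real (r i))))"
    by (simp add: exp_lg[OF nz] algebra_simps)
  also have "\<dots> = (-1) ^ (Suc g) * R z"
    by (simp only: prod.distrib R_def prod_constant card_atMost)
  finally have "(K0 z)\<^sup>2 * R z = (-1) ^ (Suc g) * (inverse (R z) * R z)"
    by (simp add: power_inverse[symmetric])
  moreover have "R z \<noteq> 0" unfolding R_def using nz by simp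
  ultimately have "(K0 z)\<^sup>2 * R z = (-1) ^ (Suc g)" by simp
  moreover have "(K z)\<^sup>2 = (-1) ^ (Suc g) * (K0 z)\<^sup>2"
    by (simp add: K_def power_mult_distrib mult.commute[of g] flip: power_mult)
  ultimately show ?thesis by (simp add: mult.assoc power_add[symmetric] flip: power_mult_distrib)
qed

lemma l_le: "i \<le> j \<Longrightarrow> j \<le> g \<Longrightarrow> l i \<le> l j"
proof (induction j)
  case (Suc j)
  then show ?case using band[of j] gap[of j] by (cases "i = Suc j") auto
qed simp

lemma r_le: "i \<le> j \<Longrightarrow> j \<le> g \<Longrightarrow> r i \<le> r j"
proof (induction j)
  case (Suc j)
  then show ?case using band[of "Suc j"] gap[of j] by (cases "i = Suc j") auto
qed simp

lemma complement_cases: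
  assumes "x \<notin> E"
  obtains "x < l 0" | "x > r g" | j where "j < g" "r j < x" "x < l (Suc j)"
proof (cases "x < l 0")
  case False
  let ?S = "{i. i \<le> g \<and> l i \<le> x}"
  \<comment> \<open>The last band that starts at or before \<open>x\<close>.\<close>
  define j where "j = Max ?S"
  have S: "finite ?S" "0 \<in> ?S" using False by auto
  have j: "j \<in> ?S" unfolding j_def using S by (intro Max_in) auto
  then have rj: "r j < x" using assms by (force simp: E_def)
  show ?thesis
  proof (cases "j = g")
    case True then show ?thesis using that(2) rj by simp
  next
    case False
    have "Suc j \<notin> ?S"
    proof
      assume "Suc j \<in> ?S"
      from Max_ge[OF S(1) this] show False unfolding j_def[symmetric] by simp
    qed
    then show ?thesis using that(3)[of j] False j rj by auto
  qed
qed (use that in blast)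

text \<open>Up to a factor \<open>- \<pi> / 2\<close>, the boundary value of the imaginary part of the logarithm of
  \<open>\<Prod>i<g. z - \<mu> i\<close> times \<open>R\<^sup>-\<^sup>1\<^sup>/\<^sup>2\<close>, built from \<open>lg\<close>.\<close>

definition sign_sum :: "(nat \<Rightarrow> real) \<Rightarrow> real \<Rightarrow> real" where
  "sign_sum \<mu> x = (\<Sum>i<g. sgn (x - \<mu> i)) - (1 / 2) * (\<Sum>i\<le>g. sgn (x - l i) + sgn (x - r i))"

text \<open>Pairing the end points across each gap gives terms that vanish at every \<open>x\<close>
  outside the closed gap.\<close>

lemma sign_sum_regroup:
  "sign_sum \<mu> x = - (1 / 2) * sgn (x - l 0) - (1 / 2) * sgn (x - r g)
     + (\<Sum>i<g. sgn (x - \<mu> i) - (1 / 2) * sgn (x - r i) - (1 / 2) * sgn (x - l (Suc i)))"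
proof -
  have "(\<Sum>i\<le>g. sgn (x - l i)) = sgn (x - l 0) + (\<Sum>i<g. sgn (x - l (Suc i)))"
    by (rule sum.atMost_shift)
  moreover have "(\<Sum>i\<le>g. sgn (x - r i)) = (\<Sum>i<g. sgn (x - r i)) + sgn (x - r g)"
    by (simp add: lessThan_Suc_atMost[symmetric])
  ultimately show ?thesis
    unfolding sign_sum_def by (simp add: sum.distrib sum_subtractf sum_distrib_left algebra_simps)
qed

context
  fixes \<mu> :: "nat \<Rightarrow> real"
  assumes \<mu>: "\<And>i. i < g \<Longrightarrow> r i \<le> \<mu> i \<and> \<mu> i \<le> l (Suc i)"
begin

lemma term_right:
  assumes "i < g" "l (Suc i) < x"
  shows "sgn (x - \<mu> i) - (1 / 2) * sgn (x - r i) - (1 / 2) * sgn (x - l (Suc i)) = 0"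
  using assms \<mu>[of i] gap[of i] by (simp add: sgn_if)

lemma term_left:
  assumes "i < g" "x < r i"
  shows "sgn (x - \<mu> i) - (1 / 2) * sgn (x - r i) - (1 / 2) * sgn (x - l (Suc i)) = 0"
  using assms \<mu>[of i] gap[of i] by (simp add: sgn_if)

lemma sign_sum_left: "x < l 0 \<Longrightarrow> sign_sum \<mu> x = 1"
proof -
  assume x: "x < l 0"
  have "x < r i" if "i \<le> g" for i using x l_le[of 0 i] band[of i] that by linarith
  then have "(\<Sum>i<g. sgn (x - \<mu> i) - (1 / 2) * sgn (x - r i) - (1 / 2) * sgn (x - l (Suc i))) = 0"
    by (intro sum.neutral ballI term_left) auto
  moreover have "x < r g" using \<open>\<And>i. i \<le> g \<Longrightarrow> x < r i\<close> by simp
  ultimately show ?thesis using x unfolding sign_sum_regroup by (simp add: sgn_if)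
qed

lemma sign_sum_right: "x > r g \<Longrightarrow> sign_sum \<mu> x = -1"
proof -
  assume x: "x > r g"
  have "x > l i" if "i \<le> g" for i using x r_le[of i g] band[of i] that by linarith
  then have "(\<Sum>i<g. sgn (x - \<mu> i) - (1 / 2) * sgn (x - r i) - (1 / 2) * sgn (x - l (Suc i))) = 0"
    by (intro sum.neutral ballI term_right) auto
  moreover have "x > l 0" using \<open>\<And>i. i \<le> g \<Longrightarrow> x > l i\<close> by simp
  ultimately show ?thesis using x unfolding sign_sum_regroup by (simp add: sgn_if)
qed

lemma sign_sum_band:
  assumes "j \<le> g" "l j < x" "x < r j"
  shows "sign_sum \<mu> x = 0"
proof -
  have "sgn (x - \<mu> i) - (1 / 2) * sgn (x - r i) - (1 / 2) * sgn (x - l (Suc i)) = 0" if "i < g" for i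
  proof (cases "i < j")
    case True then show ?thesis using l_le[of "Suc i" j] assms that by (intro term_right) auto
  next
    case False then show ?thesis using r_le[of j i] assms that by (intro term_left) auto
  qed
  moreover have "l 0 < x" "x < r g" using l_le[of 0 j] r_le[of j g] assms by auto
  ultimately show ?thesis unfolding sign_sum_regroup by (subst sum.neutral) (auto simp: sgn_if)
qed

lemma sign_sum_gap:
  assumes "j < g" "r j < x" "x < l (Suc j)"
  shows "sign_sum \<mu> x = sgn (x - \<mu> j)"
proof -
  have "sgn (x - \<mu> i) - (1 / 2) * sgn (x - r i) - (1 / 2) * sgn (x - l (Suc i)) =
      (if i = j then sgn (x - \<mu> j) else 0)" if "i < g" for i
  proof (cases i j rule: linorder_cases)
    case less
    then show ?thesis using l_le[of "Suc i" j] band[of j] assms that by (subst term_right) auto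
  next
    case equal then show ?thesis using assms by (simp add: sgn_if)
  next
    case greater
    then show ?thesis using r_le[of "Suc j" i] band[of "Suc j"] assms that by (subst term_left) auto
  qed
  then have "(\<Sum>i<g. sgn (x - \<mu> i) - (1 / 2) * sgn (x - r i) - (1 / 2) * sgn (x - l (Suc i))) =
      (\<Sum>i<g. if i = j then sgn (x - \<mu> j) else 0)"
    by (intro sum.cong) auto
  also have "\<dots> = sgn (x - \<mu> j)" using assms(1) by simp
  moreover have "l 0 < x" "x < r g"
    using l_le[of 0 j] band[of j] r_le[of "Suc j" g] band[of "Suc j"] assms by auto
  ultimately show ?thesis unfolding sign_sum_regroup by (simp add: sgn_if)
qed

end

end

section \<open>Krein's representation of reflectionless Herglotz functions\<close>

locale herglotz_bands = bands +
  fixes G :: "complex \<Rightarrow> complex"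
  assumes G_holo: "G holomorphic_on - (complex_of_real ` E)"
    and G_pos: "Im z > 0 \<Longrightarrow> Im (G z) > 0"
    and G_real: "x \<notin> E \<Longrightarrow> Im (G (of_real x)) = 0"
    and G_deriv: "x \<notin> E \<Longrightarrow> \<exists>d>0. (G has_field_derivative of_real d) (at (of_real x))"
    and G_outside: "\<exists>M. \<forall>x. x \<notin> E \<longrightarrow> (x < - M \<longrightarrow> Re (G (of_real x)) > 0) \<and> (x > M \<longrightarrow> Re (G (of_real x)) < 0)"
    and G_asymptotics: "((\<lambda>y. (\<i> * of_real y) * G (\<i> * of_real y)) \<longlongrightarrow> -1) at_top"
    and G_reflectionless: "AE x in lebesgue. x \<in> E \<longrightarrow>
      (\<exists>L. ((\<lambda>\<epsilon>. G (Complex x \<epsilon>)) \<longlongrightarrow> L) (at_right 0) \<and> Re L = 0)"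
begin

lemma G_holo_uhp: "G holomorphic_on uhp"
  using G_holo by (rule holomorphic_on_subset) auto

lemma G_increasing:
  assumes "x < y" and disj: "\<And>t. x \<le> t \<Longrightarrow> t \<le> y \<Longrightarrow> t \<notin> E"
  shows "Re (G (of_real x)) < Re (G (of_real y))"
proof (rule DERIV_pos_imp_increasing[OF assms(1)])
  fix t assume "x \<le> t" "t \<le> y"
  then obtain d where d: "d > 0" "(G has_field_derivative of_real d) (at (of_real t))"
    using G_deriv disj by blast
  have "(complex_of_real has_vector_derivative 1) (at t)"
    by (auto intro!: derivative_eq_intros)
  from field_vector_diff_chain_at[OF this d(2)]
  have "((\<lambda>t. Re (G (of_real t))) has_vector_derivative d) (at t)"
    using bounded_linear.has_vector_derivative[OF bounded_linear_Re] by (fastforce simp: o_def)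
  then show "\<exists>y. ((\<lambda>t. Re (G (of_real t))) has_real_derivative y) (at t) \<and> y > 0"
    using d(1) by (auto simp: has_real_derivative_iff_has_vector_derivative)
qed

lemma gap_notin_E:
  assumes "j < g" "r j < t" "t < l (Suc j)"
  shows "t \<notin> E"
proof
  assume "t \<in> E"
  then obtain i where i: "i \<le> g" "l i \<le> t" "t \<le> r i" by (auto simp: E_def)
  then show False using l_le[of "Suc j" i] r_le[of i j] assms by (cases "i \<le> j") auto
qed

lemma left_notin_E: "t < l 0 \<Longrightarrow> t \<notin> E"
  using l_le[of 0] by (fastforce simp: E_def)

lemma right_notin_E: "t > r g \<Longrightarrow> t \<notin> E"
  using r_le[of _ g] by (fastforce simp: E_def)

text \<open>The sign is given only far to the left; monotonicity carries it up to the first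
  band.\<close>

lemma G_left: 
  assumes x: "x < l 0"
  shows "Re (G (of_real x)) > 0"
proof -
  obtain M where M: "\<And>x. x \<notin> E \<Longrightarrow> x < - M \<Longrightarrow> Re (G (of_real x)) > 0" using G_outside by blast
  define y where "y = min x (- M) - 1"
  have y: "y < x" "y < - M" "y < l 0" using x by (auto simp: y_def)
  have "Re (G (of_real y)) < Re (G (of_real x))"
    using y x left_notin_E by (intro G_increasing) auto
  then show ?thesis using M[of y] left_notin_E y by auto
qed

lemma G_right: 
  assumes x: "x > r g"
  shows "Re (G (of_real x)) < 0"
proof -
  obtain M where M: "\<And>x. x \<notin> E \<Longrightarrow> x > M \<Longrightarrow> Re (G (of_real x)) < 0" using G_outside by blast
  define y where "y = max x M + 1"
  have y: "y > x" "y > M" "y > r g" using x by (auto simp: y_def)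
  have "Re (G (of_real x)) < Re (G (of_real y))"
    using y x right_notin_E by (intro G_increasing) auto
  then show ?thesis using M[of y] right_notin_E y by auto
qed

text \<open>\<open>\<mu> i\<close> is the zero of \<open>G\<close> in the gap \<open>i\<close>, or
  an edge of the gap if \<open>G\<close> keeps its sign there.\<close>

lemma G_sign_changes:
  obtains \<mu> where "\<And>i. i < g \<Longrightarrow> r i \<le> \<mu> i \<and> \<mu> i \<le> l (Suc i)"
    and "\<And>i x. i < g \<Longrightarrow> r i < x \<Longrightarrow> x < l (Suc i) \<Longrightarrow> x \<noteq> \<mu> i \<Longrightarrow> sgn (Re (G (of_real x))) = sgn (x - \<mu> i)"
proof -
  have "\<exists>m. r i \<le> m \<and> m \<le> l (Suc i) \<and> (\<forall>x. r i < x \<longrightarrow> x < l (Suc i) \<longrightarrow>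
      (x < m \<longrightarrow> Re (G (of_real x)) < 0) \<and> (m < x \<longrightarrow> Re (G (of_real x)) > 0))" if "i < g" for i
    using gap_notin_E[OF that] by (intro sign_change_point gap that G_increasing) auto
  then obtain \<mu> where \<mu>: "\<And>i. i < g \<Longrightarrow> r i \<le> \<mu> i \<and> \<mu> i \<le> l (Suc i) \<and> (\<forall>x. r i < x \<longrightarrow> x < l (Suc i) \<longrightarrow>
      (x < \<mu> i \<longrightarrow> Re (G (of_real x)) < 0) \<and> (\<mu> i < x \<longrightarrow> Re (G (of_real x)) > 0))"
    by metis
  show ?thesis
  proof (rule that[of \<mu>])
    fix i x assume "i < g" "r i < x" "x < l (Suc i)" "x \<noteq> \<mu> i"
    then show "sgn (Re (G (of_real x))) = sgn (x - \<mu> i)"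
      using \<mu>[of i] by (cases "x < \<mu> i") auto
  qed (use \<mu> in blast)
qed

lemma G_boundary_limit:
  assumes "x \<notin> E"
  shows "((\<lambda>\<epsilon>. G (Complex x \<epsilon>)) \<longlongrightarrow> G (of_real x)) (at_right 0)"
proof -
  have "isCont G (of_real x)" using G_deriv[OF assms] DERIV_isCont by blast
  moreover have "((\<lambda>\<epsilon>. Complex x \<epsilon>) \<longlongrightarrow> of_real x) (at_right 0)"
    unfolding Complex_eq by (auto intro!: tendsto_eq_intros)
  ultimately show ?thesis by (rule isCont_tendsto_compose)
qed

text \<open>Limits come from reflectionlessness on \<open>E\<close> and from continuity elsewhere;
  \<open>herglotz_boundary_nonzero\<close> excludes the value 0, where \<open>lg\<close> is not
  continuous.\<close>

lemma AE_boundary: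
  "AE x in lebesgue. \<exists>L. ((\<lambda>\<epsilon>. G (Complex x \<epsilon>)) \<longlongrightarrow> L) (at_right 0) \<and> L \<noteq> 0 \<and> Im L \<ge> 0 \<and>
      (if x \<in> E then Re L = 0 else L = G (of_real x))"
proof -
  have "AE x in lebesgue. \<exists>L. ((\<lambda>\<epsilon>. G (Complex x \<epsilon>)) \<longlongrightarrow> L) (at_right 0)"
    using G_reflectionless by eventually_elim (use G_boundary_limit in blast)
  then have "AE x in lebesgue. \<exists>L. ((\<lambda>\<epsilon>. G (Complex x \<epsilon>)) \<longlongrightarrow> L) (at_right 0) \<and> L \<noteq> 0"
    by (intro herglotz_boundary_nonzero G_holo_uhp G_pos)
  then show ?thesis using G_reflectionless
  proof eventually_elim
    case (elim x)
    then obtain L where L: "((\<lambda>\<epsilon>. G (Complex x \<epsilon>)) \<longlongrightarrow> L) (at_right 0)" "L \<noteq> 0" by blast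
    have uniq: "L' = L" if "((\<lambda>\<epsilon>. G (Complex x \<epsilon>)) \<longlongrightarrow> L') (at_right 0)" for L'
      using tendsto_unique[OF trivial_limit_at_right_real that L(1)] .
    have "\<forall>\<^sub>F \<epsilon> in at_right 0. 0 \<le> Im (G (Complex x \<epsilon>))"
      using eventually_at_right_less[of 0] by eventually_elim (use G_pos in \<open>auto intro!: less_imp_le\<close>)
    then have "Im L \<ge> 0" using tendsto_Im[OF L(1)] by (intro tendsto_lowerbound) auto
    moreover have "if x \<in> E then Re L = 0 else L = G (of_real x)"
    proof (cases "x \<in> E")
      case True
      then obtain L' where "((\<lambda>\<epsilon>. G (Complex x \<epsilon>)) \<longlongrightarrow> L') (at_right 0)" "Re L' = 0"
        using elim(2) by blast
      then show ?thesis using uniq[of L'] True by simp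
    next
      case False
      then show ?thesis using uniq[OF G_boundary_limit[OF False]] by simp
    qed
    ultimately show ?case using L by blast
  qed
qed

text \<open>The quotient of the two sides has a logarithm whose imaginary part is bounded and has
  boundary values 0 almost everywhere; such a logarithm is a real constant.\<close>

theorem G_representation:
  obtains \<mu> :: "nat \<Rightarrow> real"
  where "\<And>z. Im z > 0 \<Longrightarrow> G z = - ((\<Prod>i<g. z - of_real (\<mu> i)) * K z)"
proof -
  obtain \<mu> where \<mu>: "\<And>i. i < g \<Longrightarrow> r i \<le> \<mu> i \<and> \<mu> i \<le> l (Suc i)"
    and sign: "\<And>i x. i < g \<Longrightarrow> r i < x \<Longrightarrow> x < l (Suc i) \<Longrightarrow> x \<noteq> \<mu> i \<Longrightarrow> sgn (Re (G (of_real x))) = sgn (x - \<mu> i)"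
    using G_sign_changes by metis
  have nz: "z - of_real x \<noteq> 0" if "Im z > 0" for z x using that by (auto simp: complex_eq_iff)
  \<comment> \<open>A logarithm of this quotient, up to a constant.\<close>
  define D where "D z = lg (G z) - (\<Sum>i<g. lg (z - of_real (\<mu> i)))
      + (1 / 2) * (\<Sum>i\<le>g. lg (z - of_real (l i)) + lg (z - of_real (r i)))" for z
  have D_holo: "D holomorphic_on uhp"
    unfolding D_def using G_pos
    by (intro holomorphic_intros holomorphic_lg G_holo_uhp) auto
  define C where "C = pi + (\<Sum>i<g. pi) + (1 / 2) * (\<Sum>i\<le>g. pi + pi)"
  have D_bound: "\<bar>Im (D z)\<bar> \<le> C" if z: "Im z > 0" for z
  proof -
    have "G z \<noteq> 0" using G_pos[OF z] by auto
    have 1: "\<bar>Im (lg (G z))\<bar> \<le> pi" using \<open>G z \<noteq> 0\<close> by (rule Im_lg_bound)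
    have b: "\<bar>Im (lg (z - of_real x))\<bar> \<le> pi" for x by (rule Im_lg_bound[OF nz[OF z]])
    have 2: "\<bar>\<Sum>i<g. Im (lg (z - of_real (\<mu> i)))\<bar> \<le> (\<Sum>i<g. pi)"
      by (intro sum_abs[THEN order_trans] sum_mono b)
    have 3: "\<bar>\<Sum>i\<le>g. Im (lg (z - of_real (l i))) + Im (lg (z - of_real (r i)))\<bar> \<le> (\<Sum>i\<le>g. pi + pi)"
      by (intro sum_abs[THEN order_trans] sum_mono abs_triangle_ineq[THEN order_trans] add_mono b)
    have "Im (D z) = Im (lg (G z)) - (\<Sum>i<g. Im (lg (z - of_real (\<mu> i))))
      + (1 / 2) * (\<Sum>i\<le>g. Im (lg (z - of_real (l i))) + Im (lg (z - of_real (r i))))"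
      by (simp add: D_def Im_sum)
    with 1 2 3 show ?thesis unfolding C_def by (simp only: abs_le_iff) linarith
  qed
  have D_lim: "AE x in lebesgue. ((\<lambda>\<epsilon>. Im (D (Complex x \<epsilon>))) \<longlongrightarrow> 0) (at_right 0)"
  proof -
    \<comment> \<open>The points where some linear factor vanishes and its \<open>lg\<close> is
      singular.\<close>
    let ?N = "l ` {..g} \<union> r ` {..g} \<union> \<mu> ` {..<g}"
    have "?N \<in> null_sets lebesgue"
      by (intro null_sets_completionI finite_imp_null_set_lborel) auto
    then have "AE x in lebesgue. x \<notin> ?N" by (rule AE_not_in)
    then show ?thesis using AE_boundary
    proof eventually_elim
      case (elim x)
      then obtain L where L: "((\<lambda>\<epsilon>. G (Complex x \<epsilon>)) \<longlongrightarrow> L) (at_right 0)" "L \<noteq> 0" "Im L \<ge> 0"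
        "if x \<in> E then Re L = 0 else L = G (of_real x)" by blast
      have t: "((\<lambda>\<epsilon>. lg (Complex x \<epsilon> - of_real c)) \<longlongrightarrow> lg (of_real (x - c))) (at_right 0)" if "x \<noteq> c" for c
      proof (rule tendsto_lg)
        show "((\<lambda>\<epsilon>. Complex x \<epsilon> - of_real c) \<longlongrightarrow> of_real (x - c)) (at_right 0)"
          unfolding Complex_eq by (auto intro!: tendsto_eq_intros)
      qed (use that in auto)
      have ne: "i \<le> g \<Longrightarrow> x \<noteq> l i" "i \<le> g \<Longrightarrow> x \<noteq> r i" "i < g \<Longrightarrow> x \<noteq> \<mu> i" for i
        using elim(1) by auto
      have "((\<lambda>\<epsilon>. Im (D (Complex x \<epsilon>))) \<longlongrightarrow> Im (lg L - (\<Sum>i<g. lg (of_real (x - \<mu> i)))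
          + (1 / 2) * (\<Sum>i\<le>g. lg (of_real (x - l i)) + lg (of_real (x - r i))))) (at_right 0)"
        unfolding D_def using ne by (intro tendsto_intros tendsto_lg L t) auto
      also have "Im (lg L - (\<Sum>i<g. lg (of_real (x - \<mu> i)))
          + (1 / 2) * (\<Sum>i\<le>g. lg (of_real (x - l i)) + lg (of_real (x - r i)))) =
        Im (lg L) - (\<Sum>i<g. Im (lg (of_real (x - \<mu> i))))
          + (1 / 2) * (\<Sum>i\<le>g. Im (lg (of_real (x - l i))) + Im (lg (of_real (x - r i))))"
        by (simp add: Im_sum del: of_real_diff)
      also have "\<dots> = Im (lg L) - (\<Sum>i<g. - (pi / 2) * sgn (x - \<mu> i))
          + (1 / 2) * (\<Sum>i\<le>g. - (pi / 2) * sgn (x - l i) + - (pi / 2) * sgn (x - r i))"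
        by (intro arg_cong2[where f = "(+)"] arg_cong2[where f = "(-)"] arg_cong2[where f = "(*)"]
            sum.cong refl Im_lg_of_real) (use ne in auto)
      also have "\<dots> = Im (lg L) + (pi / 2) * sign_sum \<mu> x"
        by (simp only: sign_sum_def sum_distrib_left[symmetric] distrib_left[symmetric]) (simp add: algebra_simps)
      also have "\<dots> = 0"
      proof (cases "x \<in> E")
        case True
        then obtain j where j: "j \<le> g" "l j \<le> x" "x \<le> r j" by (auto simp: E_def)
        have "sign_sum \<mu> x = 0"
          by (rule sign_sum_band[OF \<mu> j(1)]) (use j ne[of j] in auto)
        moreover have "Im (lg L) = 0" using L True by (intro Im_lg_imaginary) auto
        ultimately show ?thesis by simp
      next
        case False
        then have L': "L = of_real (Re (G (of_real x)))" using L(4) G_real[OF False] by (simp add: complex_eq_iff)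
        then have "Re (G (of_real x)) \<noteq> 0" using L(2) by auto
        then have "Im (lg L) = - (pi / 2) * sgn (Re (G (of_real x)))"
          by (subst L') (rule Im_lg_of_real)
        moreover have "sgn (Re (G (of_real x))) = sign_sum \<mu> x"
          using False
        proof (rule complement_cases)
          assume "x < l 0" then show ?thesis using G_left[of x] sign_sum_left[OF \<mu>, of x] by simp
        next
          assume "x > r g" then show ?thesis using G_right[of x] sign_sum_right[OF \<mu>, of x] by simp
        next
          fix j assume j: "j < g" "r j < x" "x < l (Suc j)"
          then show ?thesis using sign[OF j] sign_sum_gap[OF \<mu> j] ne(3)[of j] by simp
        qed
        ultimately show ?thesis by simp
      qed
      finally show ?case .
    qed
  qed
  \<comment> \<open>\<open>Im D\<close> becomes a modulus: \<open>cmod (exp (\<i> * D z))\<close>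
    lies between positive constants and has boundary values 1.\<close>
  have D_real: "Im (D z) = 0" if z: "Im z > 0" for z
  proof -
    have e: "cmod (exp (\<i> * D z)) = exp (- Im (D z))" for z by (simp add: norm_exp_eq_Re)
    have "cmod (exp (\<i> * D z)) = 1"
    proof (rule bounded_holomorphic_uhp_eq_1[OF _ _ _ _ _ z, where m = "exp (- C)" and M = "exp C"])
      show "(\<lambda>z. exp (\<i> * D z)) holomorphic_on uhp" by (intro holomorphic_intros D_holo)
      show "cmod (exp (\<i> * D z)) \<le> exp C" if "Im z > 0" for z
        unfolding e using D_bound[OF that] by (simp add: abs_le_iff)
      show "exp (- C) \<le> cmod (exp (\<i> * D z))" if "Im z > 0" for z
        unfolding e using D_bound[OF that] by (simp add: abs_le_iff)
      show "AE x in lebesgue. ((\<lambda>\<epsilon>. cmod (exp (\<i> * D (Complex x \<epsilon>)))) \<longlongrightarrow> 1) (at_right 0)"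
        using D_lim
      proof eventually_elim
        case (elim x)
        have "((\<lambda>\<epsilon>. exp (- Im (D (Complex x \<epsilon>)))) \<longlongrightarrow> exp (- 0)) (at_right 0)"
          by (intro tendsto_intros elim)
        then show ?case unfolding e by simp
      qed
    qed simp
    then show ?thesis unfolding e by simp
  qed
  then obtain d0 where d0: "\<And>z. Im z > 0 \<Longrightarrow> D z = d0"
    using real_valued_holomorphic_constant[OF D_holo] by (auto simp: constant_on_def)
  define c where "c = exp (Re d0)"
  have exp_d0: "exp d0 = of_real c"
    using D_real[of \<i>] d0[of \<i>] unfolding c_def exp_of_real[symmetric] by (simp add: complex_eq_iff[of "of_real _"] of_real_Re complex_is_Real_iff)
  have G_eq: "G z = - (of_real c * (\<Prod>i<g. z - of_real (\<mu> i)) * K z)" if z: "Im z > 0" for z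
  proof -
    have G0: "G z \<noteq> 0" using G_pos[OF z] by auto
    have "lg (G z) = d0 + (\<Sum>i<g. lg (z - of_real (\<mu> i)))
        + (- (1 / 2) * (\<Sum>i\<le>g. lg (z - of_real (l i)) + lg (z - of_real (r i))))"
      using d0[OF z] by (simp add: D_def algebra_simps)
    then have "exp (lg (G z)) = exp d0 * exp (\<Sum>i<g. lg (z - of_real (\<mu> i))) * K0 z"
      by (simp only: exp_add K0_def)
    also have "exp (\<Sum>i<g. lg (z - of_real (\<mu> i))) = (\<Prod>i<g. (- \<i>) * (z - of_real (\<mu> i)))"
      by (simp add: exp_sum exp_lg[OF nz[OF z]])
    also have "\<dots> = (- \<i>) ^ g * (\<Prod>i<g. z - of_real (\<mu> i))"
      by (simp only: prod.distrib prod_constant card_lessThan)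
    finally have "- \<i> * G z = of_real c * ((- \<i>) ^ g * (\<Prod>i<g. z - of_real (\<mu> i))) * K0 z"
      by (simp only: exp_lg[OF G0] exp_d0)
    then have "\<i> * (- \<i> * G z) = \<i> * (of_real c * ((- \<i>) ^ g * (\<Prod>i<g. z - of_real (\<mu> i))) * K0 z)"
      by (rule arg_cong)
    then show ?thesis by (simp add: K_def mult_ac)
  qed
  \<comment> \<open>The squares of both sides are compared on the imaginary axis: squaring replaces
    \<open>K\<close> by \<open>R\<close>, and the positivity of \<open>c\<close> recovers the
    sign.\<close>
  have "c = 1"
  proof -
    let ?z = "\<lambda>y. \<i> * complex_of_real y"
    define q where "q x y = (?z y - of_real x) / ?z y" for x y
    have q: "(q x \<longlongrightarrow> 1) at_top" for x
    proof -
      have "((\<lambda>y. q x y - 1) \<longlongrightarrow> 0) at_top"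
      proof (rule Lim_null_comparison)
        show "((\<lambda>y::real. \<bar>x\<bar> / y) \<longlongrightarrow> 0) at_top"
          by (rule real_tendsto_divide_at_top[OF tendsto_const filterlim_ident])
        show "\<forall>\<^sub>F y in at_top. norm (q x y - 1) \<le> \<bar>x\<bar> / y"
          using eventually_gt_at_top[of 0]
          by eventually_elim (simp add: q_def diff_divide_distrib norm_divide norm_mult)
      qed
      then show ?thesis by (simp add: Lim_null[symmetric])
    qed
    have lim1: "((\<lambda>y. (?z y * G (?z y))\<^sup>2 * (\<Prod>i\<le>g. q (l i) y * q (r i) y)) \<longlongrightarrow> (-1)\<^sup>2 * (\<Prod>i\<le>g. 1 * 1)) at_top"
      by (intro tendsto_intros G_asymptotics q)
    have lim2: "((\<lambda>y. (of_real c)\<^sup>2 * (\<Prod>i<g. q (\<mu> i) y)\<^sup>2) \<longlongrightarrow> (complex_of_real c)\<^sup>2 * (\<Prod>i<g. 1)\<^sup>2) at_top"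
      by (intro tendsto_intros q)
    have "\<forall>\<^sub>F y in at_top. (?z y * G (?z y))\<^sup>2 * (\<Prod>i\<le>g. q (l i) y * q (r i) y) = (of_real c)\<^sup>2 * (\<Prod>i<g. q (\<mu> i) y)\<^sup>2"
      using eventually_gt_at_top[of 0]
    proof eventually_elim
      case (elim y)
      let ?w = "?z y"
      have w: "Im ?w > 0" "?w \<noteq> 0" using elim by auto
      have P: "(\<Prod>i\<le>g. q (l i) y * q (r i) y) = R ?w / (?w\<^sup>2) ^ (Suc g)"
        by (simp only: q_def R_def times_divide_times_eq prod_dividef prod_constant card_atMost power2_eq_square)
      have Q: "(\<Prod>i<g. q (\<mu> i) y) = (\<Prod>i<g. ?w - of_real (\<mu> i)) / ?w ^ g"
        by (simp only: q_def prod_dividef prod_constant card_lessThan)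
      have "(?w * G ?w)\<^sup>2 * (R ?w / (?w\<^sup>2) ^ (Suc g)) =
          (of_real c)\<^sup>2 * (\<Prod>i<g. ?w - of_real (\<mu> i))\<^sup>2 * ((K ?w)\<^sup>2 * R ?w) / (?w\<^sup>2) ^ g"
        using w(2) by (simp add: G_eq[OF w(1)] power_mult_distrib)
      also have "\<dots> = (of_real c)\<^sup>2 * ((\<Prod>i<g. ?w - of_real (\<mu> i)) / ?w ^ g)\<^sup>2"
        unfolding K_square[OF w(1)] by (simp add: power_divide mult.commute flip: power_mult)
      finally show ?case unfolding P Q .
    qed
    from tendsto_unique[OF trivial_limit_at_top_linorder Lim_transform_eventually[OF lim1 this] lim2]
    have "(complex_of_real c)\<^sup>2 = 1" by simp
    then have "c\<^sup>2 = 1" by (metis of_real_eq_1_iff of_real_power)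
    then show ?thesis using exp_gt_zero[of "Re d0"] by (simp add: c_def power2_eq_1_iff)
  qed
  with G_eq show ?thesis by (intro that[of \<mu>]) simp
qed

end

section \<open>Polynomials associated with the Green functions\<close>

lemma poly_eq_uhp:
  assumes "\<And>z. Im z > 0 \<Longrightarrow> poly p z = poly q z"
  shows "p = (q :: complex poly)"
proof (rule ccontr)
  assume "p \<noteq> q"
  then have "finite {z. poly (p - q) z = 0}" by (intro poly_roots_finite) simp
  moreover have "(\<lambda>k. \<i> * of_nat (Suc k)) ` UNIV \<subseteq> {z. poly (p - q) z = 0}" using assms by auto
  ultimately have "finite ((\<lambda>k. \<i> * of_nat (Suc k)) ` (UNIV :: nat set))" by (rule finite_subset[rotated])
  then show False by (subst (asm) finite_image_iff) (auto simp: inj_on_def)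
qed

lemma filterlim_imaginary_axis: "filterlim (\<lambda>y. \<i> * complex_of_real y) at_infinity at_top"
proof (rule filterlim_at_infinity_conv_norm_at_top[THEN iffD2])
  have "\<forall>\<^sub>F y::real in at_top. y = norm (\<i> * complex_of_real y)"
    using eventually_ge_at_top[of 0] by eventually_elim (simp add: norm_mult)
  then show "LIM y at_top. norm (\<i> * complex_of_real y) :> at_top"
    by (rule filterlim_mono_eventually[OF filterlim_ident order_refl order_refl])
qed

text \<open>Takes the place of Liouville's theorem when multipliers are compared at
  infinity.\<close>

lemma poly_tendsto_imaginary_axis:
  assumes "((\<lambda>y. poly p (\<i> * of_real y)) \<longlongrightarrow> c) at_top"
  shows "p = [:c:]"
proof (cases "degree p = 0")
  case True
  then obtain d where d: "p = [:d:]" by (rule degree_eq_zeroE)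
  then have "d = c" using assms tendsto_const_iff[of "at_top :: real filter" d c] by simp
  then show ?thesis using d by simp
next
  case False
  then have "filterlim (\<lambda>y. poly p (\<i> * of_real y)) at_infinity at_top"
    by (intro filterlim_compose[OF filterlim_poly_at_infinity filterlim_imaginary_axis]) simp
  then show ?thesis using not_tendsto_and_filterlim_at_infinity[OF _ assms] by simp
qed

text \<open>After removing the gcd, the square of the rest of \<open>q\<close> is coprime to that of
  \<open>p\<close>, hence divides the squarefree \<open>r\<close>; so this rest is constant.\<close>

lemma dvd_of_square_dvd:
  fixes p q r :: "complex poly"
  assumes dvd: "q\<^sup>2 dvd p\<^sup>2 * r" and sqfree: "\<And>c. \<not> [:- c, 1:]\<^sup>2 dvd r"
  shows "q dvd p"
proof (cases "q = 0")
  case True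
  \<comment> \<open>Here \<open>p\<^sup>2 * r\<close> vanishes, and squarefreeness excludes
    \<open>r = 0\<close>.\<close>
  then show ?thesis using dvd sqfree[of 0] by auto
next
  case False
  then have "gcd p q \<noteq> 0" by simp
  from this gcd_coprime_exists[OF this] obtain p' q' d where
    d0: "d \<noteq> 0" and pq: "p = p' * d" "q = q' * d" "coprime p' q'" by blast
  have "q'\<^sup>2 * d\<^sup>2 dvd (p'\<^sup>2 * r) * d\<^sup>2"
    using dvd unfolding pq(1,2) by (simp only: power_mult_distrib mult_ac)
  then have "q'\<^sup>2 dvd p'\<^sup>2 * r" using d0 by simp
  moreover have "coprime (q'\<^sup>2) (p'\<^sup>2)" using pq(3) by (simp add: coprime_commute)
  ultimately have dr: "q'\<^sup>2 dvd r" by (simp add: coprime_dvd_mult_right_iff)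
  have "poly q' c \<noteq> 0" for c
    using sqfree[of c] dr by (meson dvd_power_same dvd_trans poly_eq_0_iff_dvd)
  then obtain a where "a \<noteq> 0" "q' = [:a:]" using fundamental_theorem_of_algebra_alt[of q'] by auto
  then have "q' dvd 1" by (simp add: is_unit_triv)
  then show ?thesis unfolding pq(1,2) by (metis dvd_trans mult_dvd_mono dvd_refl one_dvd)
qed

text \<open>The three-term recurrence with parameter \<open>z\<close> and initial values \<open>x\<close>, \<open>y\<close> at sites \<open>n\<close>, \<open>n + 1\<close>,
  as polynomials in \<open>z\<close>.\<close>

fun transfer :: "(int \<Rightarrow> real) \<Rightarrow> (int \<Rightarrow> real) \<Rightarrow> complex poly \<Rightarrow> complex poly \<Rightarrow> int \<Rightarrow> nat \<Rightarrow> complex poly" where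
  "transfer a b x y n 0 = x"
| "transfer a b x y n (Suc 0) = y"
| "transfer a b x y n (Suc (Suc j)) = smult (inverse (of_real (a (n + int j + 2))))
     ([:- of_real (b (n + int j + 1)), 1:] * transfer a b x y n (Suc j)
      - smult (of_real (a (n + int j + 1))) (transfer a b x y n j))"

text \<open>The algebraic content of being reflectionless on a finite gap set: on the upper half plane
  \<open>gr n\<close> are the diagonal Green functions and \<open>h n + 1\<close> is twice the off-diagonal one times its
  coefficient; \<open>K\<close> is \<open>Rp\<^sup>-\<^sup>1\<^sup>/\<^sup>2\<close>.\<close>

locale green_data =
  fixes g :: nat and K :: "complex \<Rightarrow> complex" and Rp :: "complex poly"
    and a b :: "int \<Rightarrow> real" and gr h :: "int \<Rightarrow> complex \<Rightarrow> complex" and G :: "int \<Rightarrow> complex poly"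
  assumes K_Rp: "Im z > 0 \<Longrightarrow> (K z)\<^sup>2 * poly Rp z = 1"
    and degree_Rp: "degree Rp = 2 * g + 2" and lead_Rp: "lead_coeff Rp = 1"
    and sqfree_Rp: "\<not> [:- c, 1:]\<^sup>2 dvd Rp"
    and pos_a: "a n > 0"
    and gr_nonzero: "Im z > 0 \<Longrightarrow> gr n z \<noteq> 0"
    and h_square: "Im z > 0 \<Longrightarrow> (h n z)\<^sup>2 - 1 = 4 * (of_real (a (n + 1)))\<^sup>2 * gr n z * gr (n + 1) z"
    and h_sum: "Im z > 0 \<Longrightarrow> h n z + h (n - 1) z = 2 * (z - of_real (b n)) * gr n z"
    and gr_asymptotics: "((\<lambda>y. \<i> * of_real y * gr n (\<i> * of_real y)) \<longlongrightarrow> -1) at_top"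
    and h_asymptotics: "((\<lambda>y. h n (\<i> * of_real y)) \<longlongrightarrow> -1) at_top"
    and gr_eq: "Im z > 0 \<Longrightarrow> gr n z = - (poly (G n) z * K z)"
    and degree_G: "degree (G n) = g" and lead_G: "lead_coeff (G n) = 1"
begin

lemma K_nonzero: "Im z > 0 \<Longrightarrow> K z \<noteq> 0"
  using K_Rp[of z] by auto

lemma G_nonzero: "Im z > 0 \<Longrightarrow> poly (G n) z \<noteq> 0"
  using gr_nonzero[of z n] gr_eq[of z n] by auto

section \<open>The polynomials \<open>H n\<close>\<close>

abbreviation ca :: "int \<Rightarrow> complex" where "ca n \<equiv> of_real (a n)"
abbreviation cb :: "int \<Rightarrow> complex" where "cb n \<equiv> of_real (b n)"

lemma ca_nonzero: "ca n \<noteq> 0" using pos_a[of n] by simp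

text \<open>\<open>PH n\<close> is \<open>(X - b n) * H n\<close> for the polynomial \<open>H n\<close> with \<open>h n = - H n K\<close>; that \<open>X - b n\<close>
  divides it is read off from its square.\<close>

definition PH :: "int \<Rightarrow> complex poly" where
  "PH n = [:- cb n, 1:]\<^sup>2 * G n + smult ((ca (n + 1))\<^sup>2) (G (n + 1)) - smult ((ca n)\<^sup>2) (G (n - 1))"

text \<open>Subtracting \<open>h_square\<close> at \<open>n - 1\<close> from that at
  \<open>n\<close> and dividing by the sum of the two \<open>h\<close> gives their difference; with
  \<open>h_sum\<close> this isolates \<open>h n\<close>.\<close>

lemma PH_eq:
  assumes z: "Im z > 0"
  shows "(z - cb n) * h n z = - (poly (PH n) z * K z)"
proof -
  have "gr n z * ((h n z - h (n - 1) z) * (z - cb n) - 2 * ((ca (n + 1))\<^sup>2 * gr (n + 1) z - (ca n)\<^sup>2 * gr (n - 1) z)) = 0"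
    using h_square[OF z, of n] h_square[OF z, of "n - 1"] h_sum[OF z, of n] by simp algebra
  then have d: "(h n z - h (n - 1) z) * (z - cb n) = 2 * ((ca (n + 1))\<^sup>2 * gr (n + 1) z - (ca n)\<^sup>2 * gr (n - 1) z)"
    using gr_nonzero[OF z] by simp
  have "2 * ((z - cb n) * h n z) = (h n z - h (n - 1) z) * (z - cb n) + (z - cb n) * (h n z + h (n - 1) z)"
    by (simp add: algebra_simps)
  also have "\<dots> = 2 * ((z - cb n)\<^sup>2 * gr n z + (ca (n + 1))\<^sup>2 * gr (n + 1) z - (ca n)\<^sup>2 * gr (n - 1) z)"
    unfolding d h_sum[OF z] by (simp add: power2_eq_square algebra_simps)
  also have "\<dots> = 2 * (- (poly (PH n) z * K z))"
    by (simp add: PH_def gr_eq[OF z] algebra_simps)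
  finally have e: "2 * ((z - cb n) * h n z) = 2 * (- (poly (PH n) z * K z))" .
  show ?thesis by (rule mult_left_cancel[THEN iffD1, OF _ e]) simp
qed

lemma PH_square: "(PH n)\<^sup>2 = [:- cb n, 1:]\<^sup>2 * (Rp + smult (4 * (ca (n + 1))\<^sup>2) (G n * G (n + 1)))"
proof (rule poly_eq_uhp)
  fix z assume z: "Im z > 0"
  have "(poly (PH n) z)\<^sup>2 = (poly (PH n) z)\<^sup>2 * ((K z)\<^sup>2 * poly Rp z)" by (simp add: K_Rp[OF z])
  also have "\<dots> = (- (poly (PH n) z * K z))\<^sup>2 * poly Rp z" by (simp add: power_mult_distrib)
  also have "\<dots> = (z - cb n)\<^sup>2 * (1 + ((h n z)\<^sup>2 - 1)) * poly Rp z"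
    unfolding PH_eq[OF z, symmetric] by (simp add: power_mult_distrib)
  also have "\<dots> = (z - cb n)\<^sup>2 * (poly Rp z + 4 * (ca (n + 1))\<^sup>2 * poly (G n) z * poly (G (n + 1)) z * ((K z)\<^sup>2 * poly Rp z))"
    unfolding h_square[OF z] gr_eq[OF z] by (simp add: power2_eq_square algebra_simps)
  also have "\<dots> = poly ([:- cb n, 1:]\<^sup>2 * (Rp + smult (4 * (ca (n + 1))\<^sup>2) (G n * G (n + 1)))) z"
    unfolding K_Rp[OF z] by simp
  finally show "poly ((PH n)\<^sup>2) z = poly ([:- cb n, 1:]\<^sup>2 * (Rp + smult (4 * (ca (n + 1))\<^sup>2) (G n * G (n + 1)))) z"
    by simp
qed

definition H :: "int \<Rightarrow> complex poly" where
  "H n = PH n div [:- cb n, 1:]"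

lemma PH_H: "PH n = [:- cb n, 1:] * H n"
proof -
  have "poly ((PH n)\<^sup>2) (cb n) = 0" unfolding PH_square by simp
  then have "[:- cb n, 1:] dvd PH n" by (simp add: poly_eq_0_iff_dvd)
  then show ?thesis by (simp only: H_def dvd_mult_div_cancel)
qed

lemma h_eq:
  assumes z: "Im z > 0"
  shows "h n z = - (poly (H n) z * K z)"
proof -
  have "z - cb n \<noteq> 0" using z by (auto simp: complex_eq_iff)
  moreover have "(z - cb n) * h n z = (z - cb n) * (- (poly (H n) z * K z))"
    unfolding PH_eq[OF z] PH_H by (simp add: algebra_simps)
  ultimately show ?thesis by (rule mult_left_cancel[THEN iffD1])
qed

lemma H_square: "(H n)\<^sup>2 = Rp + smult (4 * (ca (n + 1))\<^sup>2) (G n * G (n + 1))"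
proof -
  have "[:- cb n, 1:]\<^sup>2 * (H n)\<^sup>2 = [:- cb n, 1:]\<^sup>2 * (Rp + smult (4 * (ca (n + 1))\<^sup>2) (G n * G (n + 1)))"
    using PH_square[of n] unfolding PH_H by (simp only: power_mult_distrib)
  then show ?thesis by (simp only: mult_cancel_left) simp
qed

lemma H_sum: "H n + H (n - 1) = [:- 2 * cb n, 2:] * G n"
proof (rule poly_eq_uhp)
  fix z assume z: "Im z > 0"
  have "- (poly (H n + H (n - 1)) z * K z) = h n z + h (n - 1) z"
    unfolding h_eq[OF z] by (simp add: algebra_simps)
  also have "\<dots> = - (poly ([:- 2 * cb n, 2:] * G n) z * K z)"
    unfolding h_sum[OF z] gr_eq[OF z] by (simp add: algebra_simps)
  finally show "poly (H n + H (n - 1)) z = poly ([:- 2 * cb n, 2:] * G n) z"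
    using K_nonzero[OF z] by simp
qed

text \<open>The square determines the degree, and the leading coefficient up to sign; the leading
  coefficient 2 in \<open>H_sum\<close> rules out the value -1.\<close>

lemma degree_H: "degree (H n) = g + 1" and lead_H: "lead_coeff (H n) = 1"
proof -
  have G0: "G n \<noteq> 0" for n using lead_G[of n] by auto
  have sq: "degree (H n) = g + 1 \<and> (coeff (H n) (g + 1) = 1 \<or> coeff (H n) (g + 1) = -1)" for n
  proof -
    have "degree (smult (4 * (ca (n + 1))\<^sup>2) (G n * G (n + 1))) = 2 * g"
      using G0 ca_nonzero[of "n + 1"] by (simp add: degree_mult_eq degree_G)
    then have lt: "degree (smult (4 * (ca (n + 1))\<^sup>2) (G n * G (n + 1))) < degree Rp"
      by (simp add: degree_Rp)
    have d: "degree ((H n)\<^sup>2) = 2 * g + 2"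
      unfolding H_square using degree_add_eq_left[OF lt] degree_Rp by simp
    moreover have lc: "lead_coeff ((H n)\<^sup>2) = 1"
      unfolding H_square using lead_coeff_add_le[OF lt] lead_Rp by (simp add: add.commute)
    moreover have "H n \<noteq> 0" using d by auto
    ultimately have "degree (H n) = g + 1" by (simp add: degree_power_eq)
    moreover have "(lead_coeff (H n))\<^sup>2 = 1" using lc by (simp only: lead_coeff_power)
    ultimately
    show ?thesis by (auto simp: power2_eq_1_iff)
  qed
  have "coeff (H n) (g + 1) + coeff (H (n - 1)) (g + 1) = coeff ([:- 2 * cb n, 2:] * G n) (g + 1)"
    unfolding H_sum[symmetric] by simp
  also have "\<dots> = 2" using degree_G[of n] lead_G[of n] by (simp add: coeff_eq_0)
  finally have "coeff (H n) (g + 1) = 1" using sq[of n] sq[of "n - 1"] by auto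
  then show "degree (H n) = g + 1" "lead_coeff (H n) = 1" using sq[of n] by auto
qed

text \<open>The two Weyl functions \<open>m\<^sup>\<plusminus>\<close>, for \<open>s = \<plusminus> 1\<close>.\<close>

definition m :: "complex \<Rightarrow> int \<Rightarrow> complex \<Rightarrow> complex" where
  "m s n z = (h n z + s) / (2 * ca (n + 1) * gr n z)"

section \<open>Weyl functions: Riccati equation, products and asymptotics\<close>

context
  fixes z :: complex
  assumes z: "Im z > 0"
begin

lemma h_plus_nonzero:
  assumes "s\<^sup>2 = 1"
  shows "h n z + s \<noteq> 0"
proof -
  have "(h n z + s) * (h n z - s) \<noteq> 0"
    using h_square[OF z, of n] gr_nonzero[OF z] ca_nonzero[of "n + 1"] assms
    by (simp add: algebra_simps power2_eq_square)
  then show ?thesis by auto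
qed

lemma m_nonzero: "s\<^sup>2 = 1 \<Longrightarrow> m s n z \<noteq> 0"
  using h_plus_nonzero gr_nonzero[OF z] ca_nonzero by (simp add: m_def)

lemma m_prod:
  assumes "s\<^sup>2 = 1"
  shows "m s n z * m (- s) n z = gr (n + 1) z / gr n z"
proof -
  have "m s n z * m (- s) n z = ((h n z)\<^sup>2 - 1) / (4 * (ca (n + 1))\<^sup>2 * (gr n z)\<^sup>2)"
    using assms by (simp add: m_def algebra_simps power2_eq_square)
  then show ?thesis unfolding h_square[OF z]
    using gr_nonzero[OF z] ca_nonzero[of "n + 1"] by (simp add: power2_eq_square field_simps)
qed

lemma m_diff: "m 1 n z - m (-1) n z = 1 / (ca (n + 1) * gr n z)"
  by (simp add: m_def diff_divide_distrib[symmetric])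

text \<open>The Riccati form of the three-term recurrence.\<close>

lemma m_recurrence:
  assumes s: "s\<^sup>2 = 1"
  shows "ca (n + 1) * m s n z + ca n / m s (n - 1) z = z - cb n"
proof -
  have 1: "ca (n + 1) * m s n z = (h n z + s) / (2 * gr n z)"
    using ca_nonzero[of "n + 1"] by (simp add: m_def)
  have "(h (n - 1) z + s) * (h (n - 1) z - s) = 4 * (ca n)\<^sup>2 * gr (n - 1) z * gr n z"
    using h_square[OF z, of "n - 1"] s by (simp add: algebra_simps power2_eq_square)
  then have "ca n * (2 * ca n * gr (n - 1) z) * (2 * gr n z) = (h (n - 1) z - s) * (h (n - 1) z + s)"
    by (simp add: algebra_simps power2_eq_square)
  then have 2: "ca n / m s (n - 1) z = (h (n - 1) z - s) / (2 * gr n z)"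
    using gr_nonzero[OF z] h_plus_nonzero[OF s, of "n - 1"] ca_nonzero[of n] by (simp add: m_def field_simps)
  have "ca (n + 1) * m s n z + ca n / m s (n - 1) z = (h n z + h (n - 1) z) / (2 * gr n z)"
    unfolding 1 2 by (simp add: add_divide_distrib[symmetric])
  also have "\<dots> = z - cb n" unfolding h_sum[OF z] using gr_nonzero[OF z] by simp
  finally show ?thesis .
qed

text \<open>By the Riccati equation the products solve the three-term recurrence with initial values
  1 and \<open>m s n z\<close>; they are expanded in the fundamental system.\<close>

lemma prod_m_transfer:
  assumes s: "s\<^sup>2 = 1"
  shows "(\<Prod>i<j. m s (n + int i) z) = poly (transfer a b 1 0 n j) z + poly (transfer a b 0 1 n j) z * m s n z"
proof (induction j rule: induct_nat_012)
  case (ge2 j)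
  let ?u = "\<lambda>j. \<Prod>i<j. m s (n + int i) z"
  let ?M = "m s (n + int j) z"
  have "ca (n + int j + 2) * m s (n + int j + 1) z = z - cb (n + int j + 1) - ca (n + int j + 1) / m s (n + int j) z"
    using m_recurrence[OF s, of "n + int j + 1"] by (simp add: algebra_simps)
  then have "ca (n + int j + 2) * m s (n + int j + 1) z * ?M = (z - cb (n + int j + 1)) * ?M - ca (n + int j + 1)"
    using m_nonzero[OF s, of "n + int j"] by (simp add: left_diff_distrib)
  then have "?u j * (ca (n + int j + 2) * m s (n + int j + 1) z * ?M) = ?u j * ((z - cb (n + int j + 1)) * ?M - ca (n + int j + 1))"
    by (rule arg_cong)
  moreover have "?u (Suc j) = ?u j * ?M" by simp
  moreover have "?u (Suc (Suc j)) = ?u (Suc j) * m s (n + int j + 1) z" by (simp add: add_ac)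
  ultimately have "ca (n + int j + 2) * ?u (Suc (Suc j)) = (z - cb (n + int j + 1)) * ?u (Suc j) - ca (n + int j + 1) * ?u j"
    by (simp add: algebra_simps)
  then have "?u (Suc (Suc j)) = ((z - cb (n + int j + 1)) * ?u (Suc j) - ca (n + int j + 1) * ?u j) / ca (n + int j + 2)"
    using ca_nonzero[of "n + int j + 2"] by (metis nonzero_mult_div_cancel_left)
  then show ?case unfolding ge2.IH using ca_nonzero[of "n + int j + 2"] by (simp add: field_simps)
qed auto

lemma prod_m_both: "(\<Prod>i<j. m 1 (n + int i) z) * (\<Prod>i<j. m (-1) (n + int i) z) = gr (n + int j) z / gr n z"
proof (induction j)
  case 0 then show ?case using gr_nonzero[OF z] by simp
next
  case (Suc j)
  have "(\<Prod>i<Suc j. m 1 (n + int i) z) * (\<Prod>i<Suc j. m (-1) (n + int i) z) =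
      (gr (n + int j) z / gr n z) * (m 1 (n + int j) z * m (-1) (n + int j) z)"
    unfolding Suc.IH[symmetric] by (simp add: mult_ac)
  also have "\<dots> = gr (n + int (Suc j)) z / gr n z"
    using m_prod[of 1 "n + int j"] gr_nonzero[OF z] by (simp add: add_ac)
  finally show ?case .
qed

end

lemma m_minus_asymptotics: "((\<lambda>y. m (-1) n (\<i> * of_real y) / (\<i> * of_real y)) \<longlongrightarrow> 1 / ca (n + 1)) at_top"
proof -
  have "((\<lambda>y. (h n (\<i> * of_real y) + (-1)) / (2 * ca (n + 1) * (\<i> * of_real y * gr n (\<i> * of_real y))))
      \<longlongrightarrow> (- 1 + (-1)) / (2 * ca (n + 1) * (-1))) at_top"
    using ca_nonzero[of "n + 1"] by (intro tendsto_intros h_asymptotics gr_asymptotics) auto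
  then show ?thesis by (simp add: m_def mult_ac)
qed

text \<open>The definition is indeterminate here, since \<open>h n + 1\<close> tends to 0;
  \<open>m_prod\<close> reduces the claim to the other Weyl function.\<close>

lemma m_plus_asymptotics: "((\<lambda>y. \<i> * of_real y * m 1 n (\<i> * of_real y)) \<longlongrightarrow> ca (n + 1)) at_top"
proof -
  let ?z = "\<lambda>y. \<i> * complex_of_real y"
  have "((\<lambda>y. (?z y * gr (n + 1) (?z y)) / (?z y * gr n (?z y)) / (m (-1) n (?z y) / ?z y))
      \<longlongrightarrow> (-1) / (-1) / (1 / ca (n + 1))) at_top"
    using ca_nonzero[of "n + 1"] by (intro tendsto_intros gr_asymptotics m_minus_asymptotics) auto
  moreover have "\<forall>\<^sub>F y in at_top. (?z y * gr (n + 1) (?z y)) / (?z y * gr n (?z y)) / (m (-1) n (?z y) / ?z y) = ?z y * m 1 n (?z y)"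
    using eventually_gt_at_top[of 0]
  proof eventually_elim
    case (elim y)
    then have w: "Im (?z y) > 0" "?z y \<noteq> 0" by auto
    show ?case using m_prod[OF w(1), of 1 n] m_nonzero[OF w(1), of "-1" n] w(2) gr_nonzero[OF w(1)]
      by (simp add: field_simps)
  qed
  ultimately have "((\<lambda>y. ?z y * m 1 n (?z y)) \<longlongrightarrow> (-1) / (-1) / (1 / ca (n + 1))) at_top"
    by (rule Lim_transform_eventually)
  then show ?thesis by simp
qed

end

section \<open>Discrete Schroedinger operators with at most two gaps\<close>

text \<open>Two consecutive values determine the sequence in both directions, and by the pigeonhole
  principle some pair recurs.\<close>

lemma periodic_of_finite_range:
  fixes b F :: "_ \<Rightarrow> 'a::ab_group_add"
  assumes rec: "\<And>n::int. b (n + 1) = F (b n) - b (n - 1)"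
    and fin: "finite (range (\<lambda>n. (b n, b (n + 1))))"
  shows "\<exists>p::nat. p \<ge> 1 \<and> (\<forall>n. b (n + int p) = b n)"
proof -
  let ?f = "\<lambda>k::nat. (b (int k), b (int k + 1))"
  have "finite (range ?f)" by (rule finite_subset[OF _ fin]) auto
  then have "\<not> inj ?f" using finite_imageD infinite_UNIV_nat by blast
  then obtain i j where ij: "i < j" "?f i = ?f j"
    by (auto simp: inj_on_def) (metis linorder_neqE_nat)
  define p where "p = j - i"
  have "b (n + int p) = b n \<and> b (n + 1 + int p) = b (n + 1)" for n
  proof (induction n rule: int_induct[of _ "int i"])
    case base
    then show ?case using ij by (simp add: p_def algebra_simps of_nat_diff)
  next
    case (step1 n)
    have "b (n + 1 + 1 + int p) = F (b (n + 1 + int p)) - b (n + int p)"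
      using rec[of "n + 1 + int p"] by (simp add: add_ac)
    also have "\<dots> = F (b (n + 1)) - b n" using step1 by simp
    also have "\<dots> = b (n + 1 + 1)" using rec[of "n + 1"] by simp
    finally show ?case using step1 by blast
  next
    case (step2 n)
    have "b (n - 1 + int p) = F (b (n + int p)) - b (n + 1 + int p)"
      using rec[of "n + int p"] by (simp add: algebra_simps)
    also have "\<dots> = F (b n) - b (n + 1)" using step2 by simp
    also have "\<dots> = b (n - 1)" using rec[of n] by simp
    finally show ?case using step2 by simp
  qed
  then show ?thesis using ij by (intro exI[of _ p]) (auto simp: p_def)
qed

text \<open>The relations between the coefficients of the monic polynomials \<open>X\<^sup>2 + p\<^sub>n X + q\<^sub>n\<close> and
  \<open>X\<^sup>3 + u\<^sub>n X\<^sup>2 + v\<^sub>n X + w\<^sub>n\<close> for at most two gaps.\<close>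

lemma periodic_of_coefficient_relations:
  fixes b p q u v w :: "int \<Rightarrow> complex" and \<rho>1 \<rho>2 \<rho>3 \<rho>4 \<rho>5 :: complex
  assumes s2: "\<And>n. u n + u (n - 1) = 2 * (p n - b n)"
    and s1: "\<And>n. v n + v (n - 1) = 2 * (q n - b n * p n)"
    and s0: "\<And>n. w n + w (n - 1) = - 2 * (b n * q n)"
    and r5: "\<And>n. 2 * u n = \<rho>5"
    and r4: "\<And>n. (u n)\<^sup>2 + 2 * v n = \<rho>4 + 4"
    and r3: "\<And>n. 2 * w n + 2 * (u n * v n) = \<rho>3 + 4 * (p n + p (n + 1))"
    and r2: "\<And>n. (v n)\<^sup>2 + 2 * (u n * w n) = \<rho>2 + 4 * (q n + q (n + 1) + p n * p (n + 1))"
    and r1: "\<And>n. 2 * (v n * w n) = \<rho>1 + 4 * (p n * q (n + 1) + p (n + 1) * q n)"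
  shows "\<exists>P::nat. P \<ge> 1 \<and> (\<forall>n. b (n + int P) = b n \<and> p (n + int P) = p n \<and> q (n + int P) = q n \<and>
      u (n + int P) = u n \<and> v (n + int P) = v n \<and> w (n + int P) = w n)"
proof -
  \<comment> \<open>The two highest coefficients make \<open>u\<close> and \<open>v\<close>
    constants \<open>U\<close> and \<open>V\<close>; then \<open>p\<close>, \<open>q\<close> and
    \<open>w\<close> are expressed through \<open>b\<close>.\<close>
  define U where "U = \<rho>5 / 2"
  define V where "V = (\<rho>4 + 4 - U\<^sup>2) / 2"
  define C where "C = \<rho>3 / 2 + 4 * U - U * V"
  define k where "k = (\<rho>2 - V\<^sup>2 - 2 * U * C + 8 * V + 4 * U\<^sup>2) / 4"
  have u: "u n = U" for n using r5[of n] by (simp add: U_def eq_divide_eq mult.commute)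
  have v: "v n = V" for n using r4[of n] by (simp add: V_def u field_simps)
  have p: "p n = b n + U" for n
  proof -
    have "2 * p n = 2 * (b n + U)" using s2[of n] by (simp add: u algebra_simps)
    then show ?thesis by (simp only: mult_cancel_left) simp
  qed
  have q: "q n = V + b n * (b n + U)" for n
  proof -
    have "2 * q n = 2 * (V + b n * (b n + U))" using s1[of n] by (simp add: v p algebra_simps)
    then show ?thesis by (simp only: mult_cancel_left) simp
  qed
  have w: "w n = C + 2 * (b n + b (n + 1))" for n
    using r3[of n] by (simp add: u v p C_def field_simps)
  \<comment> \<open>Inserting these expressions into \<open>s0\<close> gives a two-step recurrence
    for \<open>b\<close>.\<close>
  define F where "F x = - C - 2 * x - x * (V + x * (x + U))" for x
  have rec: "b (n + 1) = F (b n) - b (n - 1)" for n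
  proof -
    have "2 * b (n + 1) = 2 * (F (b n) - b (n - 1))"
      using s0[of n] by (simp add: w q F_def algebra_simps eq_neg_iff_add_eq_0)
    then show ?thesis by (simp only: mult_cancel_left) simp
  qed
  \<comment> \<open>The coefficient of \<open>X\<^sup>2\<close> gives the product of neighbouring
    values in terms of their sum.\<close>
  have prod: "b n * b (n + 1) = (b n + b (n + 1))\<^sup>2 + U * (b n + b (n + 1)) + k" for n
  proof -
    have "4 * (b n * b (n + 1)) = 4 * ((b n + b (n + 1))\<^sup>2 + U * (b n + b (n + 1))) + 4 * k"
      using r2[of n] unfolding u v w p q k_def by (simp add: algebra_simps power2_eq_square)
    then have "4 * (b n * b (n + 1)) = 4 * ((b n + b (n + 1))\<^sup>2 + U * (b n + b (n + 1)) + k)"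
      by (simp only: distrib_left)
    then show ?thesis by (simp only: mult_cancel_left) simp
  qed
  \<comment> \<open>Eliminating the product from the coefficient of \<open>X\<close> leaves a cubic
    equation for the sum; its leading coefficient 4 shows that it is not trivial.\<close>
  define c where "c = [:\<rho>1 + 8 * U * V - 2 * V * C, 4 * (k + U\<^sup>2), 8 * U, 4:]"
  have root: "poly c (b n + b (n + 1)) = 0" for n
  proof -
    let ?s = "b n + b (n + 1)"
    have "2 * (V * (C + 2 * ?s)) = \<rho>1 + 4 * (V * (?s + 2 * U) + (b n * b (n + 1) + U * ?s + U\<^sup>2) * ?s)"
      using r1[of n] unfolding u v w p q by (simp add: algebra_simps power2_eq_square)
    then show ?thesis unfolding prod c_def by (simp add: algebra_simps power2_eq_square)
  qed
  define M where "M s = s\<^sup>2 + U * s + k" for s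
  \<comment> \<open>For each of the finitely many sums \<open>s\<close>, both values are roots of a
    quadratic with constant term \<open>M s\<close>.\<close>
  have "range (\<lambda>n. (b n, b (n + 1))) \<subseteq>
      (\<lambda>(s, x). (x, s - x)) ` (SIGMA s:{s. poly c s = 0}. {x. poly [:M s, - s, 1:] x = 0})"
  proof clarify
    fix n
    let ?s = "b n + b (n + 1)"
    have "poly [:M ?s, - ?s, 1:] (b n) = 0"
      using prod[of n] unfolding M_def by (simp add: algebra_simps)
    then show "(b n, b (n + 1)) \<in> (\<lambda>(s, x). (x, s - x)) ` (SIGMA s:{s. poly c s = 0}. {x. poly [:M s, - s, 1:] x = 0})"
      using root[of n] by (intro image_eqI[of _ _ "(?s, b n)"]) auto
  qed
  moreover have "finite (SIGMA s:{s. poly c s = 0}. {x. poly [:M s, - s, 1:] x = 0})"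
    by (intro finite_SigmaI poly_roots_finite) (auto simp: c_def)
  ultimately have "finite (range (\<lambda>n. (b n, b (n + 1))))"
    by (meson finite_imageI finite_subset)
  from periodic_of_finite_range[of b F, OF rec this] obtain P :: nat where P: "P \<ge> 1" "\<And>n. b (n + int P) = b n"
    by blast
  have "b (n + int P + 1) = b (n + 1)" for n using P(2)[of "n + 1"] by (simp add: add_ac)
  then show ?thesis using P u v by (intro exI[of _ P]) (simp add: p q w)
qed

lemma monic_quadratic:
  fixes f :: "complex poly"
  assumes "degree f = 2" "lead_coeff f = 1"
  shows "f = [:coeff f 0, coeff f 1, 1:]"
proof (rule poly_eqI)
  fix k :: nat
  have "k = 0 \<or> k = 1 \<or> k = 2 \<or> k > 2" by arith
  then show "coeff f k = coeff [:coeff f 0, coeff f 1, 1:] k"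
    using assms by (elim disjE) (auto simp: coeff_pCons coeff_eq_0 numeral_2_eq_2 split: nat.splits)
qed

lemma monic_cubic:
  fixes f :: "complex poly"
  assumes "degree f = 3" "lead_coeff f = 1"
  shows "f = [:coeff f 0, coeff f 1, coeff f 2, 1:]"
proof (rule poly_eqI)
  fix k :: nat
  have "k = 0 \<or> k = 1 \<or> k = 2 \<or> k = 3 \<or> k > 3" by arith
  then show "coeff f k = coeff [:coeff f 0, coeff f 1, coeff f 2, 1:] k"
    using assms by (elim disjE) (auto simp: coeff_pCons coeff_eq_0 numeral_2_eq_2 numeral_3_eq_3 split: nat.splits)
qed

locale schroedinger_green_data = green_data g K Rp "\<lambda>_. 1" b gr h G
  for g K Rp b gr h G +
  assumes g_le_2: "g \<le> 2"
begin

text \<open>\<open>G\<close> and \<open>H\<close> are included because the Weyl functions are built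
  from them.\<close>

lemma schroedinger_periodic:
  "\<exists>P::nat. P \<ge> 1 \<and> (\<forall>n. b (n + int P) = b n \<and> G (n + int P) = G n \<and> H (n + int P) = H n)"
proof -
  txt \<open>A factor \<open>X\<^bsup>2 - g\<^esup>\<close> reduces to degree \<open>2\<close>.\<close>
  define x :: "complex poly" where "x = monom 1 (2 - g)"
  have x0: "x \<noteq> 0" by (simp add: x_def)
  define G' where "G' n = x * G n" for n
  define H' where "H' n = x * H n" for n
  define R' where "R' = x\<^sup>2 * Rp"
  have nz: "G n \<noteq> 0" "H n \<noteq> 0" for n using lead_G[of n] lead_H[of n] by auto
  have "degree (G' n) = 2" "lead_coeff (G' n) = 1" for n
    using nz x0 g_le_2 lead_G[of n] unfolding G'_def lead_coeff_mult
    by (simp_all add: degree_mult_eq degree_G x_def degree_monom_eq lead_coeff_monom)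
  then have G': "G' n = [:coeff (G' n) 0, coeff (G' n) 1, 1:]" for n by (rule monic_quadratic)
  have "degree (H' n) = 3" "lead_coeff (H' n) = 1" for n
    using nz x0 g_le_2 lead_H[of n] unfolding H'_def lead_coeff_mult
    by (simp_all add: degree_mult_eq degree_H x_def degree_monom_eq lead_coeff_monom)
  then have H': "H' n = [:coeff (H' n) 0, coeff (H' n) 1, coeff (H' n) 2, 1:]" for n by (rule monic_cubic)
  define p q u v w where "p n = coeff (G' n) 1" and "q n = coeff (G' n) 0"
    and "u n = coeff (H' n) 2" and "v n = coeff (H' n) 1" and "w n = coeff (H' n) 0" for n
  note defs = p_def q_def u_def v_def w_def
  have G'_eq: "G' n = [:q n, p n, 1:]" and H'_eq: "H' n = [:w n, v n, u n, 1:]" for n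
    using G'[of n] H'[of n] by (simp_all add: defs)
  have sum: "H' n + H' (n - 1) = [:- 2 * cb n, 2:] * G' n" for n
    using arg_cong[OF H_sum[of n], of "\<lambda>f. x * f"] by (simp only: G'_def H'_def distrib_left mult_ac)
  have square: "(H' n)\<^sup>2 = R' + smult 4 (G' n * G' (n + 1))" for n
    using arg_cong[OF H_square[of n], of "\<lambda>f. x\<^sup>2 * f"]
    by (simp add: G'_def H'_def R'_def power_mult_distrib distrib_left power2_eq_square mult_ac)
  have sum_coeff: "coeff ([:w n, v n, u n, 1:] + [:w (n - 1), v (n - 1), u (n - 1), 1:]) k
      = coeff ([:- 2 * cb n, 2:] * [:q n, p n, 1:]) k" for n k
    using sum[of n] unfolding G'_eq H'_eq by simp
  have square_coeff: "coeff ([:w n, v n, u n, 1:] * [:w n, v n, u n, 1:]) k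
      = coeff R' k + 4 * coeff ([:q n, p n, 1:] * [:q (n + 1), p (n + 1), 1:]) k" for n k
    using arg_cong[OF square[of n], of "\<lambda>f. coeff f k"] unfolding G'_eq H'_eq power2_eq_square
    by (simp only: coeff_add coeff_smult)
  have "\<exists>P::nat. P \<ge> 1 \<and> (\<forall>n. cb (n + int P) = cb n \<and> p (n + int P) = p n \<and> q (n + int P) = q n \<and>
      u (n + int P) = u n \<and> v (n + int P) = v n \<and> w (n + int P) = w n)"
  proof (rule periodic_of_coefficient_relations)
    fix n
    show "u n + u (n - 1) = 2 * (p n - cb n)"
      using sum_coeff[of n 2] by (simp add: numeral_2_eq_2 algebra_simps)
    show "v n + v (n - 1) = 2 * (q n - cb n * p n)"
      using sum_coeff[of n 1] by (simp add: algebra_simps)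
    show "w n + w (n - 1) = - 2 * (cb n * q n)"
      using sum_coeff[of n 0] by (simp add: algebra_simps)
    show "2 * u n = coeff R' 5"
      using square_coeff[of n 5] by (simp add: eval_nat_numeral)
    show "(u n)\<^sup>2 + 2 * v n = coeff R' 4 + 4"
      using square_coeff[of n 4] by (simp add: eval_nat_numeral algebra_simps)
    show "2 * w n + 2 * (u n * v n) = coeff R' 3 + 4 * (p n + p (n + 1))"
      using square_coeff[of n 3] by (simp add: eval_nat_numeral algebra_simps)
    show "(v n)\<^sup>2 + 2 * (u n * w n) = coeff R' 2 + 4 * (q n + q (n + 1) + p n * p (n + 1))"
      using square_coeff[of n 2] by (simp add: eval_nat_numeral algebra_simps)
    show "2 * (v n * w n) = coeff R' 1 + 4 * (p n * q (n + 1) + p (n + 1) * q n)"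
      using square_coeff[of n 1] by (simp add: eval_nat_numeral algebra_simps)
  qed
  then obtain P :: nat where P: "P \<ge> 1" "\<And>n. cb (n + int P) = cb n \<and> p (n + int P) = p n \<and> q (n + int P) = q n \<and>
      u (n + int P) = u n \<and> v (n + int P) = v n \<and> w (n + int P) = w n" by blast
  have "G' (n + int P) = G' n" "H' (n + int P) = H' n" for n unfolding G'_eq H'_eq using P(2)[of n] by simp_all
  then have "G (n + int P) = G n" "H (n + int P) = H n" for n
    using x0 by (simp_all add: G'_def H'_def)
  then show ?thesis using P by (intro exI[of _ P]) (metis of_real_eq_iff)
qed

end

section \<open>Comparison of two operators with the same spectrum\<close>

lemma nonzero_mult_right_cancel: "x * y = z * y \<Longrightarrow> y \<noteq> 0 \<Longrightarrow> x = (z::complex)"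
  by simp

text \<open>\<open>D\<close> belongs to the periodic Schroedinger operator, \<open>J\<close> to an
  arbitrary operator with the same \<open>K\<close> and \<open>Rp\<close>.\<close>

locale green_data_comparison =
  D: green_data g K Rp "\<lambda>_. 1" b0 gr0 h0 G0 + J: green_data g K Rp a b gr h G
  for g K Rp b0 gr0 h0 G0 a b gr h G +
  fixes p :: nat
  assumes G0_periodic: "G0 (n + int p) = G0 n" and H0_periodic: "D.H (n + int p) = D.H n"
begin

section \<open>Monodromy of the periodic operator\<close>

definition "A0 = transfer (\<lambda>_. 1) b0 0 1 0 p"
definition "B0 = transfer (\<lambda>_. 1) b0 1 0 0 p"
definition "A1 = transfer (\<lambda>_. 1) b0 0 1 0 (Suc p)"
definition "B1 = transfer (\<lambda>_. 1) b0 1 0 0 (Suc p)"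
text \<open>The trace of the monodromy matrix with rows \<open>B0\<close>, \<open>A0\<close> and
  \<open>B1\<close>, \<open>A1\<close>.\<close>

definition "\<Delta> = A1 + B0"
definition "Q = A0 div G0 0"

text \<open>The Floquet multiplier: the factor acquired by the Weyl solution of sign
  \<open>s\<close> over one period.\<close>

definition lam :: "complex \<Rightarrow> complex \<Rightarrow> complex" where
  "lam s z = (\<Prod>i<p. D.m s (int i) z)"

lemma sign_cases: "s\<^sup>2 = 1 \<Longrightarrow> s = 1 \<or> s = (-1::complex)"
  by (simp add: power2_eq_1_iff)

context
  fixes z :: complex
  assumes z: "Im z > 0"
begin

lemma gr0_periodic: "gr0 (n + int p) z = gr0 n z"
  unfolding D.gr_eq[OF z] G0_periodic ..

lemma h0_periodic: "h0 (n + int p) z = h0 n z"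
  unfolding D.h_eq[OF z] H0_periodic ..

lemma m0_periodic: "D.m s (int p) z = D.m s 0 z"
  unfolding D.m_def using gr0_periodic[of 0] h0_periodic[of 0] by simp

lemma lam_eq: "s\<^sup>2 = 1 \<Longrightarrow> lam s z = poly B0 z + poly A0 z * D.m s 0 z"
  using D.prod_m_transfer[OF z, of s 0 p] by (simp add: lam_def A0_def B0_def)

lemma lam_m_eq: "s\<^sup>2 = 1 \<Longrightarrow> lam s z * D.m s 0 z = poly B1 z + poly A1 z * D.m s 0 z"
  using D.prod_m_transfer[OF z, of s 0 "Suc p"] m0_periodic[of s]
  by (simp add: lam_def A1_def B1_def del: transfer.simps)

lemma lam_prod: "lam 1 z * lam (-1) z = 1"
  using D.prod_m_both[OF z, of 0 p] gr0_periodic[of 0] D.gr_nonzero[OF z] by (simp add: lam_def)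

lemma m0_diff: "D.m 1 0 z - D.m (-1) 0 z = 1 / gr0 0 z"
  using D.m_diff[OF z, of 0] by simp

text \<open>The vectors with entries 1 and \<open>D.m s 0 z\<close> are eigenvectors of the
  monodromy matrix for the two multipliers; they are independent, since the two Weyl functions
  differ.\<close>

lemma lam_sum: "lam 1 z + lam (-1) z = poly \<Delta> z"
proof -
  let ?d = "D.m 1 0 z - D.m (-1) 0 z"
  have d: "?d \<noteq> 0" unfolding m0_diff using D.gr_nonzero[OF z] by simp
  have 1: "lam 1 z - lam (-1) z = poly A0 z * ?d"
    using lam_eq[of 1] lam_eq[of "-1"] by (simp add: algebra_simps)
  have 2: "lam 1 z * D.m 1 0 z - lam (-1) z * D.m (-1) 0 z = poly A1 z * ?d"
    using lam_m_eq[of 1] lam_m_eq[of "-1"] by (simp add: algebra_simps)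
  have "lam 1 z * ?d + (lam 1 z - lam (-1) z) * D.m (-1) 0 z = poly A1 z * ?d"
    using 2 by (simp add: algebra_simps)
  then have "(lam 1 z + poly A0 z * D.m (-1) 0 z) * ?d = poly A1 z * ?d"
    unfolding 1 by (simp add: algebra_simps)
  then have "lam 1 z + poly A0 z * D.m (-1) 0 z = poly A1 z"
    using d by (rule nonzero_mult_right_cancel)
  moreover have "lam (-1) z = poly B0 z + poly A0 z * D.m (-1) 0 z" by (rule lam_eq) simp
  ultimately show ?thesis unfolding \<Delta>_def by (simp add: algebra_simps)
qed

lemma lam_diff: "(lam 1 z - lam (-1) z) * gr0 0 z = poly A0 z"
proof -
  have "lam 1 z - lam (-1) z = poly A0 z * (D.m 1 0 z - D.m (-1) 0 z)"
    using lam_eq[of 1] lam_eq[of "-1"] by (simp add: algebra_simps)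
  then show ?thesis unfolding m0_diff using D.gr_nonzero[OF z, of 0] by simp
qed

end

text \<open>The squared difference of two reciprocal multipliers with sum \<open>\<Delta>\<close>;
  \<open>Rp\<close> cancels the square of \<open>K\<close>.\<close>

lemma A0_square: "A0\<^sup>2 * Rp = (\<Delta>\<^sup>2 - 4) * (G0 0)\<^sup>2"
proof (rule poly_eq_uhp)
  fix z assume z: "Im z > 0"
  have "(lam 1 z - lam (-1) z)\<^sup>2 = (lam 1 z + lam (-1) z)\<^sup>2 - 4 * (lam 1 z * lam (-1) z)"
    by (simp add: power2_eq_square algebra_simps)
  then have d: "(lam 1 z - lam (-1) z)\<^sup>2 = (poly \<Delta> z)\<^sup>2 - 4"
    unfolding lam_sum[OF z] lam_prod[OF z] by simp
  have "poly (A0\<^sup>2 * Rp) z = (lam 1 z - lam (-1) z)\<^sup>2 * (gr0 0 z)\<^sup>2 * poly Rp z"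
    by (simp add: lam_diff[OF z, symmetric] power_mult_distrib)
  also have "\<dots> = ((poly \<Delta> z)\<^sup>2 - 4) * (poly (G0 0) z)\<^sup>2 * ((K z)\<^sup>2 * poly Rp z)"
    unfolding d D.gr_eq[OF z] by (simp add: power_mult_distrib mult_ac)
  finally show "poly (A0\<^sup>2 * Rp) z = poly ((\<Delta>\<^sup>2 - 4) * (G0 0)\<^sup>2) z"
    unfolding D.K_Rp[OF z] by (simp add: poly_numeral)
qed

lemma A0_Q: "A0 = G0 0 * Q"
proof -
  have "G0 0 dvd A0" by (rule dvd_of_square_dvd[OF _ D.sqfree_Rp]) (simp add: A0_square)
  then show ?thesis by (simp only: Q_def dvd_mult_div_cancel)
qed

text \<open>With \<open>lam_sum\<close>, the multipliers are expressed by the polynomials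
  \<open>\<Delta>\<close> and \<open>Q\<close> and by \<open>K\<close>, which both operators
  share.\<close>

lemma lam_diff_Q:
  assumes z: "Im z > 0"
  shows "(lam 1 z - lam (-1) z) * K z = - poly Q z"
proof -
  have "poly (G0 0) z * ((lam 1 z - lam (-1) z) * K z) = poly (G0 0) z * (- poly Q z)"
    using lam_diff[OF z] unfolding D.gr_eq[OF z] A0_Q by (simp add: algebra_simps)
  then show ?thesis using D.G_nonzero[OF z] by (rule mult_left_cancel[THEN iffD1, rotated])
qed

section \<open>Comparison of the multipliers with the Weyl functions of \<open>J\<close>\<close>

definition "c n = smult (1 / 2) (\<Delta> - Q * J.H n)"
definition "d n = smult (J.ca (n + 1)) (Q * G n)"

lemma J_m_K:
  assumes z: "Im z > 0"
  shows "K z * (2 * J.ca (n + 1) * poly (G n) z * J.m s n z - poly (J.H n) z) = - s"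
proof -
  have "2 * J.ca (n + 1) * gr n z * J.m s n z = h n z + s"
    using J.ca_nonzero[of "n + 1"] J.gr_nonzero[OF z, of n] by (simp add: J.m_def)
  then show ?thesis unfolding J.gr_eq[OF z] J.h_eq[OF z] by (simp add: algebra_simps)
qed

text \<open>\<open>lam s\<close> is half of \<open>\<Delta>\<close> plus a polynomial multiple of
  \<open>s / K\<close>, and \<open>J_m_K\<close> writes \<open>s / K\<close> through the Weyl
  function of \<open>J\<close>.\<close>

lemma lam_J:
  assumes z: "Im z > 0" and s: "s\<^sup>2 = 1"
  shows "lam s z = poly (c n) z + poly (d n) z * J.m s n z"
proof -
  have "s * (lam 1 z - lam (-1) z) * K z = poly Q z * (- s)"
    unfolding mult.assoc[of s] lam_diff_Q[OF z] by simp
  also have "\<dots> = poly Q z * (2 * J.ca (n + 1) * poly (G n) z * J.m s n z - poly (J.H n) z) * K z"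
    unfolding J_m_K[OF z, symmetric, of s n] by (simp add: mult_ac)
  finally have e: "s * (lam 1 z - lam (-1) z) = poly Q z * (2 * J.ca (n + 1) * poly (G n) z * J.m s n z - poly (J.H n) z)"
    using J.K_nonzero[OF z] by (rule nonzero_mult_right_cancel)
  have "2 * lam s z = (lam 1 z + lam (-1) z) + s * (lam 1 z - lam (-1) z)"
    using sign_cases[OF s] by auto
  also have "\<dots> = 2 * (poly (c n) z + poly (d n) z * J.m s n z)"
    unfolding lam_sum[OF z] e c_def d_def by (simp add: algebra_simps)
  finally have e2: "2 * lam s z = 2 * (poly (c n) z + poly (d n) z * J.m s n z)" .
  show ?thesis by (rule mult_left_cancel[THEN iffD1, OF _ e2]) simp
qed

text \<open>The analogue of \<open>lam\<close> for \<open>J\<close>, from any site \<open>n\<close>,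
  since the period of \<open>J\<close> is yet to be proved.\<close>

definition Lam :: "complex \<Rightarrow> int \<Rightarrow> complex \<Rightarrow> complex" where
  "Lam s n z = (\<Prod>i<p. J.m s (n + int i) z)"

definition "A n = transfer a b 0 1 n p"
definition "B n = transfer a b 1 0 n p"

lemma Lam_eq: "Im z > 0 \<Longrightarrow> s\<^sup>2 = 1 \<Longrightarrow> Lam s n z = poly (B n) z + poly (A n) z * J.m s n z"
  using J.prod_m_transfer[of z s n p] by (simp add: Lam_def A_def B_def)

definition \<alpha> :: "int \<Rightarrow> real" where "\<alpha> n = (\<Prod>i<p. a (n + int i + 1))"

text \<open>Each factor of \<open>Lam 1\<close>, decaying like a coefficient over \<open>z\<close>,
  is paired with a factor of \<open>lam (-1)\<close>, growing like \<open>z\<close>.\<close>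

lemma ratio_plus: "((\<lambda>y. Lam 1 n (\<i> * of_real y) * lam (-1) (\<i> * of_real y)) \<longlongrightarrow> of_real (\<alpha> n)) at_top"
proof -
  let ?z = "\<lambda>y. \<i> * complex_of_real y"
  have "((\<lambda>y. \<Prod>i<p. (?z y * J.m 1 (n + int i) (?z y)) * (D.m (-1) (int i) (?z y) / ?z y))
      \<longlongrightarrow> (\<Prod>i<p. J.ca (n + int i + 1) * (1 / of_real 1))) at_top"
    by (intro tendsto_intros J.m_plus_asymptotics D.m_minus_asymptotics)
  moreover have "\<forall>\<^sub>F y in at_top. (\<Prod>i<p. (?z y * J.m 1 (n + int i) (?z y)) * (D.m (-1) (int i) (?z y) / ?z y)) = Lam 1 n (?z y) * lam (-1) (?z y)"
    using eventually_gt_at_top[of 0]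
    by eventually_elim (simp add: Lam_def lam_def flip: prod.distrib)
  ultimately have "((\<lambda>y. Lam 1 n (?z y) * lam (-1) (?z y)) \<longlongrightarrow> (\<Prod>i<p. J.ca (n + int i + 1) * (1 / of_real 1))) at_top"
    by (rule Lim_transform_eventually)
  then show ?thesis by (simp add: \<alpha>_def)
qed

lemma ratio_minus: "((\<lambda>y. Lam (-1) n (\<i> * of_real y) * lam 1 (\<i> * of_real y)) \<longlongrightarrow> of_real (1 / \<alpha> n)) at_top"
proof -
  let ?z = "\<lambda>y. \<i> * complex_of_real y"
  have "((\<lambda>y. \<Prod>i<p. (J.m (-1) (n + int i) (?z y) / ?z y) * (?z y * D.m 1 (int i) (?z y)))
      \<longlongrightarrow> (\<Prod>i<p. (1 / J.ca (n + int i + 1)) * of_real 1)) at_top"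
    by (intro tendsto_intros D.m_plus_asymptotics J.m_minus_asymptotics)
  moreover have "\<forall>\<^sub>F y in at_top. (\<Prod>i<p. (J.m (-1) (n + int i) (?z y) / ?z y) * (?z y * D.m 1 (int i) (?z y))) = Lam (-1) n (?z y) * lam 1 (?z y)"
    using eventually_gt_at_top[of 0]
    by eventually_elim (simp add: Lam_def lam_def flip: prod.distrib)
  ultimately have "((\<lambda>y. Lam (-1) n (?z y) * lam 1 (?z y)) \<longlongrightarrow> (\<Prod>i<p. (1 / J.ca (n + int i + 1)) * of_real 1)) at_top"
    by (rule Lim_transform_eventually)
  then show ?thesis by (simp add: \<alpha>_def prod_dividef)
qed

text \<open>The quotients \<open>Lam s / lam s = Lam s * lam (- s)\<close> of the two monodromy multipliers are
  polynomials of the form \<open>X\<^sub>1\<^sub>1 + X\<^sub>1\<^sub>2 m\<close>, and they converge at infinity along the imaginary axis.\<close>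

lemma X12_eq_0: "A n * c n = B n * d n"
proof -
  let ?z = "\<lambda>y. \<i> * complex_of_real y"
  let ?X = "A n * c n - B n * d n"
  \<comment> \<open>In the difference of the two expanded products, only the terms linear in the
    Weyl functions survive.\<close>
  have X: "poly ?X z = (Lam 1 n z * lam (-1) z - Lam (-1) n z * lam 1 z) * (J.ca (n + 1) * gr n z)" if z: "Im z > 0" for z
  proof -
    have "Lam 1 n z * lam (-1) z - Lam (-1) n z * lam 1 z = poly ?X z * (J.m 1 n z - J.m (-1) n z)"
      using Lam_eq[OF z, of 1 n] Lam_eq[OF z, of "-1" n] lam_J[OF z, of 1 n] lam_J[OF z, of "-1" n]
      by (simp add: algebra_simps)
    then show ?thesis unfolding J.m_diff[OF z] using J.ca_nonzero[of "n + 1"] J.gr_nonzero[OF z, of n] by simp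
  qed
  \<comment> \<open>The quotients converge while \<open>gr n\<close> tends to 0, so the polynomial
    \<open>?X\<close> tends to 0.\<close>
  have "((\<lambda>y. inverse (?z y)) \<longlongrightarrow> 0) at_top"
    by (rule tendsto_inverse_0[THEN filterlim_compose, OF filterlim_imaginary_axis])
  then have "((\<lambda>y. (Lam 1 n (?z y) * lam (-1) (?z y) - Lam (-1) n (?z y) * lam 1 (?z y)) * (J.ca (n + 1) * ((?z y * gr n (?z y)) * inverse (?z y))))
      \<longlongrightarrow> (of_real (\<alpha> n) - of_real (1 / \<alpha> n)) * (J.ca (n + 1) * ((-1) * 0))) at_top"
    by (intro tendsto_intros ratio_plus ratio_minus J.gr_asymptotics)
  moreover have "\<forall>\<^sub>F y in at_top. (Lam 1 n (?z y) * lam (-1) (?z y) - Lam (-1) n (?z y) * lam 1 (?z y)) * (J.ca (n + 1) * ((?z y * gr n (?z y)) * inverse (?z y))) = poly ?X (?z y)"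
    using eventually_gt_at_top[of 0]
  proof eventually_elim
    case (elim y)
    then have w: "Im (?z y) > 0" "?z y \<noteq> 0" by auto
    have "(x * v) * inverse x = v" if "x \<noteq> 0" for x v :: complex using that by simp
    from this[OF w(2)] have "(?z y * gr n (?z y)) * inverse (?z y) = gr n (?z y)" .
    then show ?case unfolding X[OF w(1)] by (simp only:)
  qed
  ultimately have "((\<lambda>y. poly ?X (?z y)) \<longlongrightarrow> (of_real (\<alpha> n) - of_real (1 / \<alpha> n)) * (J.ca (n + 1) * ((-1) * 0))) at_top"
    by (rule Lim_transform_eventually)
  then have "?X = [:(of_real (\<alpha> n) - of_real (1 / \<alpha> n)) * (J.ca (n + 1) * ((-1) * 0)):]"
    by (rule poly_tendsto_imaginary_axis)
  then show ?thesis by simp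
qed

text \<open>By \<open>X12_eq_0\<close> the mixed terms form a multiple of the sum of the two Weyl
  functions. Their sum and product are rational, and the factor \<open>G n\<close> of
  \<open>d n\<close> clears the denominators. The resulting polynomial does not depend on
  \<open>s\<close>.\<close>

lemma ratio_polynomial:
  assumes z: "Im z > 0" and s: "s\<^sup>2 = 1"
  shows "Lam s n z * lam (- s) z =
    poly (B n * c n + B n * Q * J.H n + smult (J.ca (n + 1)) (A n * Q * G (n + 1))) z"
proof -
  let ?m = "J.m s n z" let ?m' = "J.m (- s) n z"
  have s': "(- s)\<^sup>2 = 1" using s by simp
  have "K z * (2 * J.ca (n + 1) * poly (G n) z * (?m + ?m') - 2 * poly (J.H n) z) = K z * 0"
    using J_m_K[OF z, of n s] J_m_K[OF z, of n "- s"] by (simp add: algebra_simps)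
  then have "2 * J.ca (n + 1) * poly (G n) z * (?m + ?m') - 2 * poly (J.H n) z = 0"
    using J.K_nonzero[OF z] by (rule mult_left_cancel[THEN iffD1, rotated])
  then have sum: "J.ca (n + 1) * poly (G n) z * (?m + ?m') = poly (J.H n) z" by (simp add: mult.assoc)
  have "poly (G n) z * (?m * ?m') = poly (G (n + 1)) z"
    unfolding J.m_prod[OF z s] J.gr_eq[OF z] using J.K_nonzero[OF z] J.G_nonzero[OF z, of n] by simp
  then have prod: "poly (d n) z * (?m * ?m') = J.ca (n + 1) * poly Q z * poly (G (n + 1)) z"
    by (simp add: d_def mult_ac)
  have dm: "poly (d n) z * (?m + ?m') = poly Q z * poly (J.H n) z"
    unfolding sum[symmetric] d_def by (simp add: mult_ac)
  have ac: "poly (A n) z * poly (c n) z = poly (B n) z * poly (d n) z"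
    using X12_eq_0[of n] by (metis poly_mult)
  have "Lam s n z * lam (- s) z = poly (B n) z * poly (c n) z + poly (A n) z * poly (c n) z * ?m
      + poly (B n) z * poly (d n) z * ?m' + poly (A n) z * (poly (d n) z * (?m * ?m'))"
    unfolding Lam_eq[OF z s] lam_J[OF z s', of n] by (simp add: algebra_simps)
  also have "\<dots> = poly (B n) z * poly (c n) z + poly (B n) z * (poly (d n) z * (?m + ?m'))
      + poly (A n) z * (poly (d n) z * (?m * ?m'))"
    unfolding ac by (simp add: algebra_simps)
  finally show ?thesis unfolding dm prod by (simp add: algebra_simps)
qed

text \<open>One polynomial serves both signs, so its limits \<open>\<alpha> n\<close> and
  \<open>1 / \<alpha> n\<close> coincide; positivity gives 1.\<close>

lemma Lam_lam:
  assumes z: "Im z > 0" and s: "s\<^sup>2 = 1"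
  shows "Lam s n z = lam s z"
proof -
  define X where "X = B n * c n + B n * Q * J.H n + smult (J.ca (n + 1)) (A n * Q * G (n + 1))"
  have X: "Lam s n z * lam (- s) z = poly X z" if "Im z > 0" "s\<^sup>2 = 1" for s z
    unfolding X_def by (rule ratio_polynomial[OF that])
  have ev: "\<forall>\<^sub>F y in at_top. Lam s n (\<i> * of_real y) * lam (- s) (\<i> * of_real y) = poly X (\<i> * of_real y)"
    if "s\<^sup>2 = 1" for s using eventually_gt_at_top[of 0] by eventually_elim (use X that in auto)
  have "((\<lambda>y. poly X (\<i> * of_real y)) \<longlongrightarrow> of_real (\<alpha> n)) at_top"
    using Lim_transform_eventually[OF ratio_plus ev[of 1]] by simp
  then have X1: "X = [:of_real (\<alpha> n):]" by (rule poly_tendsto_imaginary_axis)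
  have "((\<lambda>y. poly X (\<i> * of_real y)) \<longlongrightarrow> of_real (1 / \<alpha> n)) at_top"
    using Lim_transform_eventually[OF ratio_minus] ev[of "-1"] by simp
  then have "X = [:of_real (1 / \<alpha> n):]" by (rule poly_tendsto_imaginary_axis)
  with X1 have "complex_of_real (\<alpha> n) = of_real (1 / \<alpha> n)" by simp
  then have "\<alpha> n = 1 / \<alpha> n" by (simp only: of_real_eq_iff)
  moreover have "\<alpha> n > 0" unfolding \<alpha>_def using J.pos_a by (intro prod_pos) auto
  ultimately have "(\<alpha> n)\<^sup>2 = 1" by (simp add: field_simps power2_eq_square)
  then have "\<alpha> n = 1" using \<open>\<alpha> n > 0\<close> by (simp add: power2_eq_1_iff)
  then have 1: "Lam s n z * lam (- s) z = 1" using X[OF z s] X1 by simp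
  have 2: "lam s z * lam (- s) z = 1" using sign_cases[OF s] lam_prod[OF z] by (auto simp: mult.commute)
  have "lam (- s) z \<noteq> 0" using 2 by auto
  with 1 2 show ?thesis by (metis nonzero_mult_right_cancel)
qed

text \<open>The products over \<open>p\<close> sites from \<open>n\<close> and from
  \<open>n + 1\<close> are both \<open>lam s z\<close>, and they differ only in their end
  factors.\<close>

lemma J_m_periodic:
  assumes z: "Im z > 0" and s: "s\<^sup>2 = 1"
  shows "J.m s (n + int p) z = J.m s n z"
proof -
  have "(\<Prod>i<Suc p. J.m s (n + int i) z) = J.m s n z * Lam s (n + 1) z"
    unfolding prod.lessThan_Suc_shift by (simp add: Lam_def add_ac)
  moreover have "(\<Prod>i<Suc p. J.m s (n + int i) z) = J.m s (n + int p) z * Lam s n z"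
    by (simp add: Lam_def)
  ultimately have "J.m s (n + int p) z * Lam s n z = J.m s n z * Lam s (n + 1) z" by metis
  then have "J.m s (n + int p) z * lam s z = J.m s n z * lam s z" unfolding Lam_lam[OF z s] .
  moreover have "lam s z \<noteq> 0" using sign_cases[OF s] lam_prod[OF z] by auto
  ultimately show ?thesis by (rule nonzero_mult_right_cancel)
qed

text \<open>\<open>a\<close> is read off from the asymptotics of \<open>m (-1)\<close>, then
  \<open>b\<close> from the Riccati equation at the single point \<open>\<i>\<close>.\<close>

theorem coefficients_periodic: "a (n + int p) = a n" "b (n + int p) = b n"
proof -
  show a: "a (n + int p) = a n" for n
  proof -
    let ?z = "\<lambda>y. \<i> * complex_of_real y"
    have "\<forall>\<^sub>F y in at_top. J.m (-1) (n - 1 + int p) (?z y) / ?z y = J.m (-1) (n - 1) (?z y) / ?z y"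
      using eventually_gt_at_top[of 0] by eventually_elim (simp add: J_m_periodic)
    from tendsto_unique[OF _ Lim_transform_eventually[OF J.m_minus_asymptotics this] J.m_minus_asymptotics]
    have "1 / J.ca (n - 1 + int p + 1) = 1 / J.ca (n - 1 + 1)" by simp
    then show ?thesis by simp
  qed
  have "J.cb (n + int p) = J.cb n"
  proof -
    have i: "Im \<i> > 0" by simp
    have idx: "n + int p + 1 = n + 1 + int p" "n + int p - 1 = n - 1 + int p" by simp_all
    have "J.ca (n + 1) * J.m 1 n \<i> + J.ca n / J.m 1 (n - 1) \<i> = \<i> - J.cb (n + int p)"
      using J.m_recurrence[OF i one_power2, of "n + int p"]
      unfolding idx a J_m_periodic[OF i one_power2] .
    from trans[OF this[symmetric] J.m_recurrence[OF i one_power2]]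
    have "\<i> - J.cb (n + int p) = \<i> - J.cb n" .
    then show ?thesis by simp
  qed
  then show "b (n + int p) = b n" by simp
qed

end

section \<open>Periodicity of the shift\<close>

lemma shift_inverse:
  assumes "u \<in> l2"
  shows "inv_into l2 shift u = (\<lambda>k. u (k + 1))"
proof (rule inv_into_f_eq)
  show "inj_on shift l2"
  proof (rule inj_onI)
    fix v w assume vw: "v \<in> l2" "w \<in> l2" "shift v = shift w"
    have "v k = w k" for k using fun_cong[OF vw(3), of "k + 1"] vw(1,2) by (simp add: shift_def)
    then show "v = w" by blast
  qed
  show u': "(\<lambda>k. u (k + 1)) \<in> l2" using assms by (simp add: l2_translate)
  show "shift (\<lambda>k. u (k + 1)) = u" using u' by (simp add: shift_def)
qed

lemma conj_shift_jacobi: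
  assumes "bounded (range a)" "bounded (range b)"
  shows "conj_shift (jacobi a b) = jacobi (\<lambda>k. a (k - 1)) (\<lambda>k. b (k - 1))"
proof
  fix u
  show "conj_shift (jacobi a b) u = jacobi (\<lambda>k. a (k - 1)) (\<lambda>k. b (k - 1)) u"
  proof (cases "u \<in> l2")
    case False
    then show ?thesis by (simp add: conj_shift_def compose_def jacobi_def)
  next
    case True
    then have v: "(\<lambda>k. u (k + 1)) \<in> l2" "(\<lambda>k. u (k + 2)) \<in> l2" by (simp_all add: l2_translate)
    \<comment> \<open>Membership of the image in \<open>l2\<close> has to be shown, since
      \<open>shift\<close> is \<open>undefined\<close> elsewhere.\<close>
    obtain A B where AB: "\<And>k. \<bar>a k\<bar> \<le> A" "\<And>k. \<bar>b k\<bar> \<le> B" using assms by (auto simp: bounded_iff)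
    have "(\<lambda>k. of_real (a k) * u k + of_real (b k) * u (k + 1) + of_real (a (k + 1)) * u (k + 2)) \<in> l2"
      by (intro l2_add l2_cmult[OF True, of _ A] l2_cmult[OF v(1), of _ B] l2_cmult[OF v(2), of _ A]) (simp_all add: AB)
    then have Jv: "jacobi a b (\<lambda>k. u (k + 1)) \<in> l2"
      using v(1) by (simp add: jacobi_def add.assoc)
    have "conj_shift (jacobi a b) u = shift (jacobi a b (\<lambda>k. u (k + 1)))"
      using True by (simp add: conj_shift_def compose_def shift_inverse)
    also have "\<dots> = jacobi (\<lambda>k. a (k - 1)) (\<lambda>k. b (k - 1)) u"
      using Jv v True by (simp add: shift_def jacobi_def algebra_simps)
    finally show ?thesis .
  qed
qed

lemma conj_shift_power_jacobi:
  assumes "bounded (range a)" "bounded (range b)"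
  shows "(conj_shift ^^ p) (jacobi a b) = jacobi (\<lambda>k. a (k - int p)) (\<lambda>k. b (k - int p))"
proof (induction p)
  case (Suc p)
  have "bounded (range (\<lambda>k. a (k - int p)))" "bounded (range (\<lambda>k. b (k - int p)))"
    by (auto intro: bounded_subset[OF assms(1)] bounded_subset[OF assms(2)])
  then show ?case using Suc by (simp add: conj_shift_jacobi algebra_simps)
qed simp

section \<open>Ordering of the bands and simplicity of their end points\<close>

lemma finite_gap_sets_ordered:
  assumes "E \<in> finite_gap_sets n"
  obtains l r :: "nat \<Rightarrow> real" where "\<And>i. i \<le> n \<Longrightarrow> l i < r i" "\<And>i. i < n \<Longrightarrow> r i < l (Suc i)"
    "E = (\<Union>i\<le>n. {l i..r i})"
proof -
  obtain \<I> where \<I>: "finite \<I>" "card \<I> = n + 1" "\<And>I. I \<in> \<I> \<Longrightarrow> \<exists>c d. c < d \<and> I = {c..d}"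
    "pairwise disjnt \<I>" "E = \<Union>\<I>"
    using assms unfolding finite_gap_sets_def by blast
  have I: "I = {Inf I..Sup I}" "Inf I < Sup I" if "I \<in> \<I>" for I
    using \<I>(3)[OF that] by auto
  have disj: "I = I'" if "I \<in> \<I>" "I' \<in> \<I>" "x \<in> I" "x \<in> I'" for I I' x
    using \<I>(4) that by (auto simp: pairwise_def disjnt_iff)
  \<comment> \<open>Intervals with a common left end point meet, hence are equal; so sorting the
    left end points enumerates the bands.\<close>
  have inj: "inj_on Inf \<I>"
  proof (rule inj_onI)
    fix I I' assume II: "I \<in> \<I>" "I' \<in> \<I>" "Inf I = Inf I'"
    have "Inf I \<in> {Inf I..Sup I}" "Inf I \<in> {Inf I'..Sup I'}" using I(2)[OF II(1)] I(2)[OF II(2)] II(3) by auto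
    then show "I = I'" using disj[OF II(1,2)] I(1)[OF II(1)] I(1)[OF II(2)] by simp
  qed
  define xs where "xs = sorted_list_of_set (Inf ` \<I>)"
  have xs: "set xs = Inf ` \<I>" "length xs = n + 1" "sorted_wrt (<) xs"
    using \<I>(1,2) inj by (simp_all add: xs_def card_image)
  define J where "J i = inv_into \<I> Inf (xs ! i)" for i
  have J: "J i \<in> \<I>" "Inf (J i) = xs ! i" if "i \<le> n" for i
  proof -
    have "xs ! i \<in> Inf ` \<I>" using that xs(1,2) nth_mem[of i xs] by simp
    then show "J i \<in> \<I>" "Inf (J i) = xs ! i"
      unfolding J_def by (auto intro: inv_into_into f_inv_into_f)
  qed
  show ?thesis
  proof (rule that[of "\<lambda>i. Inf (J i)" "\<lambda>i. Sup (J i)"])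
    show "Inf (J i) < Sup (J i)" if "i \<le> n" for i using I J(1)[OF that] by blast
    show "Sup (J i) < Inf (J (Suc i))" if "i < n" for i
    proof (rule ccontr)
      assume *: "\<not> ?thesis"
      have i: "i \<le> n" "Suc i \<le> n" using that by auto
      have lt: "Inf (J i) < Inf (J (Suc i))"
        using J(2)[OF i(1)] J(2)[OF i(2)] sorted_wrt_nth_less[OF xs(3), of i "Suc i"] xs(2) that by simp
      then have "Inf (J (Suc i)) \<in> {Inf (J i)..Sup (J i)}" using * by simp
      moreover have "Inf (J (Suc i)) \<in> {Inf (J (Suc i))..Sup (J (Suc i))}" using I(2)[OF J(1)[OF i(2)]] by simp
      ultimately have "J i = J (Suc i)"
        using disj[OF J(1)[OF i(1)] J(1)[OF i(2)]] I(1)[OF J(1)[OF i(1)]] I(1)[OF J(1)[OF i(2)]] by simp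
      then show False using lt by simp
    qed
    have "\<I> = J ` {..n}"
    proof
      show "J ` {..n} \<subseteq> \<I>" using J(1) by auto
      show "\<I> \<subseteq> J ` {..n}"
      proof
        fix X assume X: "X \<in> \<I>"
        then obtain i where "i < length xs" "xs ! i = Inf X" using xs(1) by (metis image_eqI in_set_conv_nth)
        then have "i \<le> n" "J i = X" using xs(2) X inj by (auto simp: J_def)
        then show "X \<in> J ` {..n}" by auto
      qed
    qed
    then have "E = (\<Union>i\<le>n. J i)" using \<I>(5) by simp
    also have "\<dots> = (\<Union>i\<le>n. {Inf (J i)..Sup (J i)})"
    proof (rule SUP_cong)
      fix i assume "i \<in> {..n}"
      then show "J i = {Inf (J i)..Sup (J i)}" using I(1)[OF J(1)[of i]] by simp
    qed simp
    finally show "E = (\<Union>i\<le>n. {Inf (J i)..Sup (J i)})" .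
  qed
qed

lemma prod_linear_squarefree:
  fixes S :: "complex set"
  assumes "finite S"
  shows "\<not> [:- c, 1:]\<^sup>2 dvd (\<Prod>x\<in>S. [:- x, 1:])"
proof
  assume dvd: "[:- c, 1:]\<^sup>2 dvd (\<Prod>x\<in>S. [:- x, 1:])"
  then have "[:- c, 1:] dvd (\<Prod>x\<in>S. [:- x, 1:])"
    by (rule dvd_trans[rotated]) (simp only: power2_eq_square dvd_triv_left)
  then have "poly (\<Prod>x\<in>S. [:- x, 1:]) c = 0" by (simp only: poly_eq_0_iff_dvd)
  then have c: "c \<in> S" using assms by (auto simp: poly_prod)
  have "[:- c, 1:] * [:- c, 1:] dvd [:- c, 1:] * (\<Prod>x\<in>S - {c}. [:- x, 1:])"
    using dvd unfolding prod.remove[OF assms c] power2_eq_square .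
  then have "[:- c, 1:] dvd (\<Prod>x\<in>S - {c}. [:- x, 1:])"
    by (rule dvd_mult_cancel_left[THEN iffD1, THEN disjE]) simp
  then have "poly (\<Prod>x\<in>S - {c}. [:- x, 1:]) c = 0" by (simp only: poly_eq_0_iff_dvd)
  then show False using assms by (auto simp: poly_prod)
qed

lemma prod_linear_monic:
  fixes f :: "'a \<Rightarrow> complex"
  assumes "finite S"
  shows "degree (\<Prod>x\<in>S. [:- f x, 1:]) = card S" "lead_coeff (\<Prod>x\<in>S. [:- f x, 1:]) = 1"
  by (simp add: degree_prod_eq_sum_degree) (simp only: lead_coeff_prod, simp)

section \<open>From reflectionless operators to \<open>green_data\<close>\<close>

context bands
begin

definition Rp :: "complex poly" where
  "Rp = (\<Prod>i\<le>g. [:- of_real (l i), 1:] * [:- of_real (r i), 1:])"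

lemma poly_Rp: "poly Rp z = R z"
  by (simp add: Rp_def R_def poly_prod algebra_simps)

text \<open>The end points of the bands are pairwise distinct, so \<open>Rp\<close> is a product of
  linear factors over a set.\<close>

lemma sqfree_Rp: "\<not> [:- c, 1:]\<^sup>2 dvd Rp"
proof -
  let ?L = "(\<lambda>i. complex_of_real (l i)) ` {..g}" and ?R = "(\<lambda>i. complex_of_real (r i)) ` {..g}"
  have l_less: "l i < l j" if "i < j" "j \<le> g" for i j
    using band[of i] gap[of i] l_le[of "Suc i" j] that by simp
  have r_less: "r i < r j" if "i < j" "j \<le> g" for i j
    using band[of "Suc i"] gap[of i] r_le[of "Suc i" j] that by simp
  have "inj_on (\<lambda>i. complex_of_real (l i)) {..g}"
    by (rule linorder_inj_onI) (use l_less in force)+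
  moreover have "inj_on (\<lambda>i. complex_of_real (r i)) {..g}"
    by (rule linorder_inj_onI) (use r_less in force)+
  moreover have "l i \<noteq> r j" if "i \<le> g" "j \<le> g" for i j
    using l_le[of i j] band[of j] l_le[of "Suc j" i] gap[of j] that by (cases "i \<le> j") auto
  then have "?L \<inter> ?R = {}" by auto
  ultimately have "Rp = (\<Prod>x\<in>?L \<union> ?R. [:- x, 1:])"
    by (simp add: Rp_def prod.distrib prod.union_disjoint prod.reindex del: mult_pCons_left mult_pCons_right)
  then show ?thesis using prod_linear_squarefree[of "?L \<union> ?R" c] by simp
qed

lemma green_data_of_reflectionless:
  assumes "jacobi_coefficients a b E" and refl: "reflectionless_on (jacobi a b) E"
  obtains gr h G where "green_data g K Rp a b gr h G"
proof -
  interpret jacobi_coefficients a b E by fact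
  have herglotz: "herglotz_bands g l r (\<lambda>z. col z n n)" for n
  proof
    have off: "z \<notin> complex_of_real ` E" if "Im z > 0" for z using that by auto
    show "(\<lambda>z. col z n n) holomorphic_on - (complex_of_real ` E)"
      unfolding holomorphic_on_def field_differentiable_def
      using DERIV_green[OF closed_E] has_field_derivative_at_within by blast
    show "Im (col z n n) > 0" if "Im z > 0" for z
      unfolding Im_green[OF off[OF that]] by (intro mult_pos_pos that zero_less_power col_nonzero off)
    show "Im (col (of_real x) n n) = 0" if "x \<notin> E" for x
      using green_real[OF that] by (metis complex_is_Real_iff Reals_cnj_iff)
    show "\<exists>d>0. ((\<lambda>z. col z n n) has_field_derivative of_real d) (at (of_real x))" if "x \<notin> E" for x
      by (rule DERIV_green_real[OF closed_E that])
    show "\<exists>M. \<forall>x. x \<notin> E \<longrightarrow> (x < - M \<longrightarrow> 0 < Re (col (of_real x) n n)) \<and> (M < x \<longrightarrow> Re (col (of_real x) n n) < 0)"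
      using green_sign_outside by blast
    show "((\<lambda>y. \<i> * of_real y * col (\<i> * of_real y) n n) \<longlongrightarrow> -1) at_top"
      by (rule green_asymptotics)
    show "AE x in lebesgue. x \<in> E \<longrightarrow> (\<exists>L. ((\<lambda>\<epsilon>. col (Complex x \<epsilon>) n n) \<longlongrightarrow> L) (at_right 0) \<and> Re L = 0)"
      using refl unfolding reflectionless_on_def green_col by blast
  qed
  have "\<exists>\<mu> :: nat \<Rightarrow> real. \<forall>z. Im z > 0 \<longrightarrow> col z n n = - ((\<Prod>i<g. z - of_real (\<mu> i)) * K z)" for n
    using herglotz_bands.G_representation[OF herglotz] by metis
  then obtain \<mu> :: "int \<Rightarrow> nat \<Rightarrow> real" where
    \<mu>: "\<And>n z. Im z > 0 \<Longrightarrow> col z n n = - ((\<Prod>i<g. z - of_real (\<mu> n i)) * K z)" by metis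
  have "green_data g K Rp a b (\<lambda>n z. col z n n) (\<lambda>n z. offdiag z n) (\<lambda>n. \<Prod>i<g. [:- of_real (\<mu> n i), 1:])"
  proof
    fix n :: int and z c :: complex
    show "\<not> [:- c, 1:]\<^sup>2 dvd Rp" by (rule sqfree_Rp)
    show "degree Rp = 2 * g + 2"
      unfolding Rp_def by (subst degree_prod_eq_sum_degree) (auto simp: degree_mult_eq simp del: mult_pCons_left mult_pCons_right)
    show "lead_coeff Rp = 1"
      unfolding Rp_def lead_coeff_prod lead_coeff_mult by simp
    show "a n > 0" by (rule a_pos)
    show "((\<lambda>y. \<i> * of_real y * col (\<i> * of_real y) n n) \<longlongrightarrow> -1) at_top" by (rule green_asymptotics)
    show "((\<lambda>y. offdiag (\<i> * of_real y) n) \<longlongrightarrow> -1) at_top" by (rule offdiag_asymptotics)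
    show "degree (\<Prod>i<g. [:- complex_of_real (\<mu> n i), 1:]) = g" "lead_coeff (\<Prod>i<g. [:- complex_of_real (\<mu> n i), 1:]) = 1"
      using prod_linear_monic[of "{..<g}" "\<lambda>i. complex_of_real (\<mu> n i)"] by simp_all
    assume z: "Im z > 0"
    then have off: "z \<notin> complex_of_real ` E" by auto
    show "(K z)\<^sup>2 * poly Rp z = 1" unfolding poly_Rp by (rule K_square[OF z])
    show "col z n n \<noteq> 0"
      using herglotz_bands.G_pos[OF herglotz z, of n] by auto
    show "(offdiag z n)\<^sup>2 - 1 = 4 * (of_real (a (n + 1)))\<^sup>2 * col z n n * col z (n + 1) (n + 1)"
      by (rule offdiag_square[OF off])
    show "offdiag z n + offdiag z (n - 1) = 2 * (z - of_real (b n)) * col z n n"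
      by (rule offdiag_sum[OF off])
    show "col z n n = - (poly (\<Prod>i<g. [:- of_real (\<mu> n i), 1:]) z * K z)"
      unfolding \<mu>[OF z] by (simp add: poly_prod algebra_simps)
  qed
  then show ?thesis by (rule that)
qed

end

theorem theorem1p4:
  fixes n :: nat and E :: "real set"
  assumes "n \<in> {0, 1, 2}"
    and "E \<in> finite_gap_sets n"
    and "\<exists>H. is_discrete_schroedinger H \<and> H \<in> reflectionless_jacobi E"
  shows "\<exists>p::nat. p \<ge> 1 \<and> (\<forall>J\<in>reflectionless_jacobi E. (conj_shift ^^ p) J = J)"
proof -
  obtain l r where lr: "\<And>i. i \<le> n \<Longrightarrow> l i < r i" "\<And>i. i < n \<Longrightarrow> r i < l (Suc i)"
    and E: "E = (\<Union>i\<le>n. {l i..r i})"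
    using finite_gap_sets_ordered[OF assms(2)] by metis
  interpret bands n l r by standard (use lr in auto)
  have E_eq: "bands.E n l r = E" unfolding E E_def ..
  obtain H b0 where H: "H \<in> reflectionless_jacobi E" "H = jacobi (\<lambda>_. 1) b0" "bounded (range b0)"
    using assms(3) by (auto simp: is_discrete_schroedinger_def)
  have "jacobi_coefficients (\<lambda>_. 1) b0 E" "reflectionless_on (jacobi (\<lambda>_. 1) b0) E"
    using H by (auto simp: jacobi_coefficients_def reflectionless_jacobi_def intro: exI[of _ 1])
  then obtain gr0 h0 G0 where D: "green_data n K Rp (\<lambda>_. 1) b0 gr0 h0 G0"
    using green_data_of_reflectionless unfolding E_eq by blast
  interpret D: schroedinger_green_data n K Rp b0 gr0 h0 G0
    using D assms(1) by (auto simp: schroedinger_green_data_def schroedinger_green_data_axioms_def)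
  \<comment> \<open>The period of this one operator serves for all \<open>J\<close> in the
    class.\<close>
  obtain p :: nat where p: "p \<ge> 1" "\<And>k. G0 (k + int p) = G0 k" "\<And>k. D.H (k + int p) = D.H k"
    using D.schroedinger_periodic by blast
  have "(conj_shift ^^ p) J = J" if J: "J \<in> reflectionless_jacobi E" for J
  proof -
    obtain a b where ab: "bounded (range a)" "bounded (range b)" "\<exists>c>0. \<forall>k. c \<le> a k" "J = jacobi a b"
      using J by (auto simp: reflectionless_jacobi_def is_jacobi_def)
    then have "jacobi_coefficients a b E" "reflectionless_on (jacobi a b) E"
      using J by (auto simp: jacobi_coefficients_def reflectionless_jacobi_def)
    then obtain gr h G where "green_data n K Rp a b gr h G"
      using green_data_of_reflectionless unfolding E_eq by blast
    then interpret C: green_data_comparison n K Rp b0 gr0 h0 G0 a b gr h G p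
      using D p(2,3) by (simp add: green_data_comparison_def green_data_comparison_axioms_def)
    have "a (k - int p) = a k" "b (k - int p) = b k" for k
      using C.coefficients_periodic[of "k - int p"] by simp_all
    then show ?thesis unfolding ab(4) conj_shift_power_jacobi[OF ab(1,2)] by simp
  qed
  then show ?thesis using p(1) by blast
qed

end
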